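(* Let $u$ be a nonconstant inner function and let $A$ be a closed densely defined operator in $K_u$ that commutes with $S_u^\alpha$ for some $\alpha\in\mathbb{C}\cup\{\infty\}$. Then $A$ is self-adjoint if and only if $A=\Phi(S_u^\beta)$ for some $\beta\in\mathbb{T}$ and some real-valued measurable function $\Phi$ on $\mathbb{T}$.
   Context: $H^2$ is the Hardy space on the unit disk $\mathbb{D}$ (functions identified with boundary values on the circle $\mathbb{T}$). For a nonconstant inner function $u$, $K_u=H^2\ominus uH^2$, $P_u$ is the orthogonal projection of $L^2(\mathbb{T})$ onto $K_u$, and $S_uf=P_u(zf)$ on $K_u$. With $k_0^u=1-\overline{u(0)}u$, $\widetilde{k_0^u}(z)=\frac{u(z)-u(0)}{z}$ and $(x\otimes y)h=\langle h,y\rangle x$, for $|\alpha|\le1$ put $S_u^\alpha=S_u+\frac{\alpha}{1-\alpha\overline{u(0)}}\,k_0^u\otimes\widetilde{k_0^u}$; for $1<|\alpha|<\infty$, $S_u^\alpha$ is understood as $(S_u^{1/\overline\alpha})^*$, and $S_u^\infty=S_u^*$. A closed densely defined operator $A$ commutes with a bounded operator $B$ if $B\mathcal{D}(A)\subset\mathcal{D}(A)$ and $BAf=ABf$ for all $f\in\mathcal{D}(A)$. Self-adjoint means $A^*=A$, including equality of domains. For $\beta\in\mathbb{T}$: the Clark measure $\mu_\beta$ is the finite positive Borel measure on $\mathbb{T}$ with $\operatorname{Re}\frac{1+\overline\beta u(z)}{1-\overline\beta u(z)}=\int_{\mathbb{T}}\operatorname{Re}\frac{\zeta+z}{\zeta-z}\,d\mu_\beta(\zeta)$,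 $z\in\mathbb{D}$; $V_\beta:L^2(\mu_\beta)\to K_u$, $(V_\beta f)(z)=(1-\overline\beta u(z))\int\frac{f(\zeta)}{1-\overline\zeta z}d\mu_\beta(\zeta)$, is unitary and $S_u^\beta=V_\beta M_\zeta V_\beta^{-1}$, with $M_\zeta$ multiplication by the independent variable. For measurable $\Phi:\mathbb{T}\to\mathbb{C}$, $M_\Phi f=\Phi f$ on $\mathcal{D}(M_\Phi)=\{f\in L^2(\mu_\beta):\Phi f\in L^2(\mu_\beta)\}$, and $\Phi(S_u^\beta)=V_\beta M_\Phi V_\beta^{-1}$ with domain $\{f\in K_u: V_\beta^{-1}f\in\mathcal{D}(M_\Phi)\}$. *)

theory Defs
  imports "HOL-Complex_Analysis.Complex_Analysis" "HOL-Probability.Probability"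
begin

abbreviation unit_disc :: "complex set" where
  "unit_disc \<equiv> ball 0 1"

abbreviation unit_circle :: "complex set" where
  "unit_circle \<equiv> sphere 0 1"

definition taylor_coeff :: "(complex \<Rightarrow> complex) \<Rightarrow> nat \<Rightarrow> complex" where
  "taylor_coeff f n = (deriv ^^ n) f 0 / fact n"

text \<open>Elements of the Hardy space are functions on the disc. They are extended by 0 to the whole
  complex plane, so that equality in the Hardy space is equality of functions.\<close>

definition H2 :: "(complex \<Rightarrow> complex) set" where
  "H2 = {f. f holomorphic_on unit_disc \<and> (\<forall>z. z \<notin> unit_disc \<longrightarrow> f z = 0) \<and>
            summable (\<lambda>n. (cmod (taylor_coeff f n))\<^sup>2)}"

text \<open>The inner product is linear in the first argument. The Taylor coefficients are the
  Fourier coefficients of the boundary function, so by Parseval this is the inner product of the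
  boundary functions in \<open>L\<^sup>2\<close> of the circle with normalized arc length.\<close>

definition h2_inner :: "(complex \<Rightarrow> complex) \<Rightarrow> (complex \<Rightarrow> complex) \<Rightarrow> complex" where
  "h2_inner f g = (\<Sum>n. taylor_coeff f n * cnj (taylor_coeff g n))"

definition h2_norm :: "(complex \<Rightarrow> complex) \<Rightarrow> real" where
  "h2_norm f = sqrt (Re (h2_inner f f))"

text \<open>Only the values of an inner function on the open disc matter. Almost every point of the
  circle is expressed as \<open>cis t\<close> for almost every real \<open>t\<close>.\<close>

definition inner_function :: "(complex \<Rightarrow> complex) \<Rightarrow> bool" where
  "inner_function u \<longleftrightarrow>
     u holomorphic_on unit_disc \<and> bounded (u ` unit_disc) \<and>
     (AE t in lborel. \<exists>l. ((\<lambda>r. u (of_real r * cis t)) \<longlongrightarrow> l) (at_left (1::real)) \<and> cmod l = 1)"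

definition model_space :: "(complex \<Rightarrow> complex) \<Rightarrow> (complex \<Rightarrow> complex) set" where
  "model_space u = {f \<in> H2. \<forall>g\<in>H2. h2_inner f (\<lambda>z. u z * g z) = 0}"

text \<open>The orthogonal projection onto a closed subspace \<open>K\<close> of the Hardy space, for arguments in the
  Hardy space. This is the restriction to the Hardy space of the projection of \<open>L\<^sup>2\<close> of the circle
  onto \<open>K\<close>; the compressed shift applies it only to \<open>z f\<close> with \<open>f\<close> in the Hardy space.\<close>

definition orth_proj ::
  "(complex \<Rightarrow> complex) set \<Rightarrow> (complex \<Rightarrow> complex) \<Rightarrow> (complex \<Rightarrow> complex)" where
  "orth_proj K f = (THE g. g \<in> K \<and> (\<forall>h\<in>K. h2_inner (\<lambda>z. f z - g z) h = 0))"

text \<open>A possibly unbounded operator is a partial function; its domain is \<open>dom A\<close>. Equality of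
  operators therefore includes equality of domains.\<close>

type_synonym operator = "(complex \<Rightarrow> complex) \<rightharpoonup> (complex \<Rightarrow> complex)"

definition linear_operator_in :: "(complex \<Rightarrow> complex) set \<Rightarrow> operator \<Rightarrow> bool" where
  "linear_operator_in K A \<longleftrightarrow>
     dom A \<subseteq> K \<and> ran A \<subseteq> K \<and> (\<lambda>z. 0) \<in> dom A \<and>
     (\<forall>f\<in>dom A. \<forall>g\<in>dom A. \<forall>c.
        A (\<lambda>z. c * f z + g z) = Some (\<lambda>z. c * the (A f) z + the (A g) z))"

definition densely_defined_in :: "(complex \<Rightarrow> complex) set \<Rightarrow> operator \<Rightarrow> bool" where
  "densely_defined_in K A \<longleftrightarrow>
     (\<forall>g\<in>K. \<forall>\<epsilon>>0. \<exists>f\<in>dom A. h2_norm (\<lambda>z. g z - f z) < \<epsilon>)"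

definition closed_in :: "(complex \<Rightarrow> complex) set \<Rightarrow> operator \<Rightarrow> bool" where
  "closed_in K A \<longleftrightarrow>
     (\<forall>F f g. (\<forall>n::nat. F n \<in> dom A) \<and> f \<in> K \<and> g \<in> K \<and>
        (\<lambda>n. h2_norm (\<lambda>z. F n z - f z)) \<longlonglongrightarrow> 0 \<and>
        (\<lambda>n. h2_norm (\<lambda>z. the (A (F n)) z - g z)) \<longlonglongrightarrow> 0
        \<longrightarrow> A f = Some g)"

text \<open>The adjoint in \<open>K\<close> of an operator that is densely defined in \<open>K\<close>; density makes the vector
  \<open>h\<close> unique.\<close>

definition op_adjoint :: "(complex \<Rightarrow> complex) set \<Rightarrow> operator \<Rightarrow> operator" where
  "op_adjoint K A = (\<lambda>g.
     if g \<in> K \<and> (\<exists>h\<in>K. \<forall>f\<in>dom A. h2_inner (the (A f)) g = h2_inner f h)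
     then Some (THE h. h \<in> K \<and> (\<forall>f\<in>dom A. h2_inner (the (A f)) g = h2_inner f h))
     else None)"

definition self_adjoint_in :: "(complex \<Rightarrow> complex) set \<Rightarrow> operator \<Rightarrow> bool" where
  "self_adjoint_in K A \<longleftrightarrow> op_adjoint K A = A"

text \<open>Here \<open>B\<close> is meant to be defined on the whole space.\<close>

definition commutes_with :: "operator \<Rightarrow> operator \<Rightarrow> bool" where
  "commutes_with A B \<longleftrightarrow>
     (\<forall>f\<in>dom A. the (B f) \<in> dom A \<and> the (B (the (A f))) = the (A (the (B f))))"

definition compressed_shift ::
  "(complex \<Rightarrow> complex) \<Rightarrow> (complex \<Rightarrow> complex) \<Rightarrow> (complex \<Rightarrow> complex)" where
  "compressed_shift u f = orth_proj (model_space u) (\<lambda>z. z * f z)"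

definition k0 :: "(complex \<Rightarrow> complex) \<Rightarrow> (complex \<Rightarrow> complex)" where
  "k0 u = (\<lambda>z. if z \<in> unit_disc then 1 - cnj (u 0) * u z else 0)"

text \<open>The difference quotient has a removable singularity at 0, where Isabelle's division would
  give 0.\<close>

definition k0_conj :: "(complex \<Rightarrow> complex) \<Rightarrow> (complex \<Rightarrow> complex)" where
  "k0_conj u = (\<lambda>z. if z \<in> unit_disc then (if z = 0 then deriv u 0 else (u z - u 0) / z) else 0)"

definition rank_one ::
  "(complex \<Rightarrow> complex) \<Rightarrow> (complex \<Rightarrow> complex) \<Rightarrow> (complex \<Rightarrow> complex) \<Rightarrow> (complex \<Rightarrow> complex)"
  where "rank_one x y h = (\<lambda>z. h2_inner h y * x z)"

definition perturbed_shift :: "(complex \<Rightarrow> complex) \<Rightarrow> complex \<Rightarrow> operator" where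
  "perturbed_shift u \<alpha> = (\<lambda>f. if f \<in> model_space u
     then Some (\<lambda>z. compressed_shift u f z
                  + \<alpha> / (1 - \<alpha> * cnj (u 0)) * rank_one (k0 u) (k0_conj u) f z)
     else None)"

text \<open>The operators \<open>S\<^sub>u\<^sup>\<alpha>\<close> for \<open>\<alpha>\<close> in the extended plane: \<open>Some \<alpha>\<close> is a finite parameter and \<open>None\<close>
  is infinity. The operator at infinity is the adjoint of \<open>S\<^sub>u\<close>, which is the one with parameter 0.\<close>

definition S_op :: "(complex \<Rightarrow> complex) \<Rightarrow> complex option \<Rightarrow> operator" where
  "S_op u a = (case a of
     Some \<alpha> \<Rightarrow> if cmod \<alpha> \<le> 1 then perturbed_shift u \<alpha>
               else op_adjoint (model_space u) (perturbed_shift u (1 / cnj \<alpha>))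
   | None \<Rightarrow> op_adjoint (model_space u)
               (\<lambda>f. if f \<in> model_space u then Some (compressed_shift u f) else None))"

abbreviation borel_circle :: "complex measure" where
  "borel_circle \<equiv> restrict_space borel unit_circle"

definition clark_measure :: "(complex \<Rightarrow> complex) \<Rightarrow> complex \<Rightarrow> complex measure" where
  "clark_measure u \<beta> = (THE \<mu>. sets \<mu> = sets borel_circle \<and> finite_measure \<mu> \<and>
     (\<forall>z\<in>unit_disc. Re ((1 + cnj \<beta> * u z) / (1 - cnj \<beta> * u z))
                     = (\<integral>\<zeta>. Re ((\<zeta> + z) / (\<zeta> - z)) \<partial>\<mu>)))"

text \<open>Square integrable functions, not identified when they agree almost everywhere.\<close>

definition L2 :: "complex measure \<Rightarrow> (complex \<Rightarrow> complex) set" where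
  "L2 \<mu> = {f \<in> borel_measurable \<mu>. integrable \<mu> (\<lambda>\<zeta>. (cmod (f \<zeta>))\<^sup>2)}"

definition clark_V ::
  "(complex \<Rightarrow> complex) \<Rightarrow> complex \<Rightarrow> (complex \<Rightarrow> complex) \<Rightarrow> (complex \<Rightarrow> complex)" where
  "clark_V u \<beta> f = (\<lambda>z. if z \<in> unit_disc
     then (1 - cnj \<beta> * u z) * (\<integral>\<zeta>. f \<zeta> / (1 - cnj \<zeta> * z) \<partial>clark_measure u \<beta>)
     else 0)"

text \<open>The inverse of \<open>V\<^sub>\<beta>\<close> picks a representative of a class modulo almost everywhere equality;
  nothing below depends on the choice.\<close>

definition clark_V_inv ::
  "(complex \<Rightarrow> complex) \<Rightarrow> complex \<Rightarrow> (complex \<Rightarrow> complex) \<Rightarrow> (complex \<Rightarrow> complex)" where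
  "clark_V_inv u \<beta> = inv_into (L2 (clark_measure u \<beta>)) (clark_V u \<beta>)"

definition mult_dom :: "complex measure \<Rightarrow> (complex \<Rightarrow> complex) \<Rightarrow> (complex \<Rightarrow> complex) set" where
  "mult_dom \<mu> \<Phi> = {f \<in> L2 \<mu>. (\<lambda>\<zeta>. \<Phi> \<zeta> * f \<zeta>) \<in> L2 \<mu>}"

definition clark_calculus :: "(complex \<Rightarrow> complex) \<Rightarrow> complex \<Rightarrow> (complex \<Rightarrow> complex) \<Rightarrow> operator"
  where "clark_calculus u \<beta> \<Phi> = (\<lambda>f.
     if f \<in> model_space u \<and> clark_V_inv u \<beta> f \<in> mult_dom (clark_measure u \<beta>) \<Phi>
     then Some (clark_V u \<beta> (\<lambda>\<zeta>. \<Phi> \<zeta> * clark_V_inv u \<beta> f \<zeta>))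
     else None)"

end

theory Submission
  imports Defs
begin

text \<open>
  Everything about a self-adjoint \<open>A\<close> is read off from its resolvents \<open>R = (A - \<i>)\<^sup>-\<^sup>1\<close> and
  \<open>R' = (A + \<i>)\<^sup>-\<^sup>1\<close>. They are bounded, adjoint to each other, and commute with every bounded operator
  that commutes with \<open>A\<close>; in particular both commute with \<open>S\<^sub>\<alpha>\<close>, also when only \<open>S\<^sub>\<alpha>\<^sup>*\<close> is
  given. If \<open>\<bar>\<alpha>\<bar> < 1\<close>, such a pair has \<open>k\<^sub>0\<close> as an eigenvector because the defect operators of
  \<open>S\<^sub>\<alpha>\<close> have rank one, and since the vectors \<open>S\<^sub>u\<^sup>n k\<^sub>0\<close> span, \<open>R\<close> and hence \<open>A\<close> are scalar. If
  \<open>\<bar>\<alpha>\<bar> = 1\<close>, the Clark transform turns \<open>S\<^sub>\<alpha>\<close> into multiplication by the variable and \<open>R\<close> into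
  multiplication by a function \<open>\<phi>\<close>; the resolvent identity makes \<open>\<Phi> = \<i> + 1/\<phi>\<close> real. Conversely,
  multiplication by a real function is self-adjoint and the Clark transform is unitary.

  The Clark measure is a weak limit of the measures with densities \<open>Re ((1 + cnj \<beta> u) / (1 - cnj \<beta> u))\<close>
  on circles of radius tending to 1. The Clark transform \<open>V\<close> matches the Cauchy kernels, suitably
  scaled, with the reproducing kernels of the model space. It is therefore a partial isometry, and it
  is injective because \<open>cnj \<zeta>\<close>, and with it every trigonometric polynomial, lies in the closed span of
  the Cauchy kernels.
\<close>

section \<open>Semi-inner product spaces\<close>

text \<open>Commuting with \<open>S\<close> alone would only place the resolvent in the commutant of
  \<open>S\<close>, which may contain non-scalar operators when |\<alpha>| < 1. Self-adjointness
  puts the adjoint of the resolvent there as well, and such a pair is constrained by the adjoint of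
  \<open>S\<close> too. The formula for \<Phi> is the equation \<phi> = 1/(\<Phi> - i), for the
  multiplier of the inverse of A - i, solved for \<Phi>. Boundary functions are avoided:
  \<open>H2\<close> is handled by Taylor coefficients and by means over circles of radius less than
  1. That the radial limits of u are unimodular enters once, in proving that multiplication by u is
  isometric; later facts such as |u| < 1 are drawn from this isometry. Square integrable functions
  are not identified modulo null sets. Hence the abstract spaces are sets of functions with a
  semi-inner product: a nonzero vector may have norm 0, limits need not be unique, and uniqueness is
  recovered separately where the inner product is definite.\<close>

locale semi_hilbert =
  fixes X :: "('a \<Rightarrow> complex) set" and ip :: "('a \<Rightarrow> complex) \<Rightarrow> ('a \<Rightarrow> complex) \<Rightarrow> complex"
  assumes zero_mem: "(\<lambda>_. 0) \<in> X"
    and lin_mem: "\<And>c f g. f \<in> X \<Longrightarrow> g \<in> X \<Longrightarrow> (\<lambda>x. c * f x + g x) \<in> X"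
    and ip_lin: "\<And>c f g h. f \<in> X \<Longrightarrow> g \<in> X \<Longrightarrow> h \<in> X \<Longrightarrow>
      ip (\<lambda>x. c * f x + g x) h = c * ip f h + ip g h"
    and ip_sym: "\<And>f g. f \<in> X \<Longrightarrow> g \<in> X \<Longrightarrow> ip g f = cnj (ip f g)"
    and ip_nonneg: "\<And>f. f \<in> X \<Longrightarrow> 0 \<le> Re (ip f f)"
    and complete: "\<And>F. (\<And>n. F n \<in> X) \<Longrightarrow>
      (\<And>e. e > 0 \<Longrightarrow> \<exists>N. \<forall>m\<ge>N. \<forall>n\<ge>N. Re (ip (\<lambda>x. F m x - F n x) (\<lambda>x. F m x - F n x)) < e) \<Longrightarrow>
      \<exists>f\<in>X. (\<lambda>n. Re (ip (\<lambda>x. F n x - f x) (\<lambda>x. F n x - f x))) \<longlonglongrightarrow> 0"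
begin

abbreviation sqn :: "('a \<Rightarrow> complex) \<Rightarrow> real" where
  "sqn f \<equiv> Re (ip f f)"

lemma scale_mem: "f \<in> X \<Longrightarrow> (\<lambda>x. c * f x) \<in> X"
  using lin_mem[of f "\<lambda>_. 0" c] zero_mem by simp

lemma add_mem: "f \<in> X \<Longrightarrow> g \<in> X \<Longrightarrow> (\<lambda>x. f x + g x) \<in> X"
  using lin_mem[of f g 1] by simp

lemma diff_mem: "f \<in> X \<Longrightarrow> g \<in> X \<Longrightarrow> (\<lambda>x. f x - g x) \<in> X"
  using lin_mem[of g f "-1"] by simp

lemmas mems = zero_mem scale_mem add_mem diff_mem

lemma ip_zero: "h \<in> X \<Longrightarrow> ip (\<lambda>_. 0) h = 0"
  using ip_lin[of "\<lambda>_. 0" "\<lambda>_. 0" h 1] zero_mem by simp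

lemma ip_scale: "f \<in> X \<Longrightarrow> h \<in> X \<Longrightarrow> ip (\<lambda>x. c * f x) h = c * ip f h"
  using ip_lin[of f "\<lambda>_. 0" h c] zero_mem ip_zero by simp

lemma ip_add: "f \<in> X \<Longrightarrow> g \<in> X \<Longrightarrow> h \<in> X \<Longrightarrow> ip (\<lambda>x. f x + g x) h = ip f h + ip g h"
  using ip_lin[of f g h 1] by simp

lemma ip_diff: "f \<in> X \<Longrightarrow> g \<in> X \<Longrightarrow> h \<in> X \<Longrightarrow> ip (\<lambda>x. f x - g x) h = ip f h - ip g h"
  using ip_lin[of g f h "-1"] by simp

lemma ip_zero_right: "h \<in> X \<Longrightarrow> ip h (\<lambda>_. 0) = 0"
  using ip_sym[of "\<lambda>_. 0" h] zero_mem ip_zero by simp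

lemma ip_scale_right: "f \<in> X \<Longrightarrow> h \<in> X \<Longrightarrow> ip h (\<lambda>x. c * f x) = cnj c * ip h f"
  using ip_sym[of "\<lambda>x. c * f x" h] ip_sym[of f h] ip_scale[of f h c] scale_mem by simp

lemma ip_add_right: "f \<in> X \<Longrightarrow> g \<in> X \<Longrightarrow> h \<in> X \<Longrightarrow> ip h (\<lambda>x. f x + g x) = ip h f + ip h g"
  using ip_sym[of "\<lambda>x. f x + g x" h] ip_sym[of f h] ip_sym[of g h] ip_add[of f g h] add_mem
  by simp

lemma ip_diff_right: "f \<in> X \<Longrightarrow> g \<in> X \<Longrightarrow> h \<in> X \<Longrightarrow> ip h (\<lambda>x. f x - g x) = ip h f - ip h g"
  using ip_sym[of "\<lambda>x. f x - g x" h] ip_sym[of f h] ip_sym[of g h] ip_diff[of f g h] diff_mem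
  by simp

lemmas ips = ip_zero ip_scale ip_add ip_diff ip_zero_right ip_scale_right ip_add_right ip_diff_right

lemma Im_ip_self: "f \<in> X \<Longrightarrow> Im (ip f f) = 0"
  using ip_sym[of f f] by (simp add: complex_eq_iff)

lemma ip_self: "f \<in> X \<Longrightarrow> ip f f = of_real (sqn f)"
  by (simp add: complex_eq_iff Im_ip_self)

lemma Re_ip_sym: "f \<in> X \<Longrightarrow> g \<in> X \<Longrightarrow> Re (ip g f) = Re (ip f g)"
  using ip_sym[of f g] by simp

text \<open>With a real multiple of <f, g> as coefficient every term is real, so the squared norm
  becomes a real quadratic polynomial in s. Both Cauchy-Schwarz and the orthogonality of a
  projection's remainder come from it.\<close>

lemma sqn_sub_scale:
  assumes "f \<in> X" "g \<in> X"
  shows "sqn (\<lambda>x. f x - (of_real s * ip f g) * g x) =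
    sqn f - 2 * s * (cmod (ip f g))\<^sup>2 + s\<^sup>2 * (cmod (ip f g))\<^sup>2 * sqn g"
proof -
  have "ip (\<lambda>x. f x - (of_real s * ip f g) * g x) (\<lambda>x. f x - (of_real s * ip f g) * g x) =
    ip f f - of_real s * cnj (ip f g) * ip f g - of_real s * ip f g * (cnj (ip f g)
     - of_real s * cnj (ip f g) * ip g g)"
    using assms ip_sym[of f g] by (simp add: ips mems)
  also have "\<dots> = of_real (sqn f - 2 * s * (cmod (ip f g))\<^sup>2 + s\<^sup>2 * (cmod (ip f g))\<^sup>2 * sqn g)"
    using ip_self[OF assms(1)] ip_self[OF assms(2)] complex_norm_square[of "ip f g"]
    by (simp add: power2_eq_square algebra_simps)
  finally show ?thesis by simp
qed

lemma Cauchy_Schwarz: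
  assumes "f \<in> X" "g \<in> X"
  shows "(cmod (ip f g))\<^sup>2 \<le> sqn f * sqn g"
proof -
  have pos: "0 \<le> sqn f - 2 * s * (cmod (ip f g))\<^sup>2 + s\<^sup>2 * (cmod (ip f g))\<^sup>2 * sqn g" for s
    using sqn_sub_scale[OF assms] ip_nonneg assms by (metis diff_mem scale_mem)
  show ?thesis
  proof (cases "sqn g = 0")
    case True
    have "cmod (ip f g) ^ 2 \<le> 0"
    proof (rule ccontr)
      assume "\<not> ?thesis"
      then have p: "cmod (ip f g) ^ 2 > 0" by simp
      \<comment> \<open>When \<open>sqn g\<close> is 0 the polynomial is affine in s, and this s
        would give it the negative value - \<open>sqn f\<close> - 2.\<close>
      have "sqn f - 2 * ((sqn f + 1) / (cmod (ip f g))\<^sup>2) * (cmod (ip f g))\<^sup>2 \<ge> 0"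
        using pos[of "(sqn f + 1) / (cmod (ip f g))\<^sup>2"] True by simp
      then have "sqn f - 2 * (sqn f + 1) \<ge> 0" using p by simp
      then show False using ip_nonneg[OF assms(1)] by simp
    qed
    then show ?thesis using True by simp
  next
    case False
    then have g: "sqn g > 0" using ip_nonneg[OF assms(2)] by simp
    have "0 \<le> sqn f - (cmod (ip f g))\<^sup>2 / sqn g"
      using pos[of "1 / sqn g"] g by (simp add: field_simps power2_eq_square)
    then show ?thesis using g by (simp add: field_simps)
  qed
qed

lemma ip_eq_0_of_sqn_0: "f \<in> X \<Longrightarrow> g \<in> X \<Longrightarrow> sqn f = 0 \<Longrightarrow> ip f g = 0"
  using Cauchy_Schwarz[of f g] by simp

lemma parallelogram:
  assumes "f \<in> X" "g \<in> X"
  shows "sqn (\<lambda>x. f x + g x) + sqn (\<lambda>x. f x - g x) = 2 * sqn f + 2 * sqn g"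
  using assms by (simp add: ips mems)

lemma sqn_add_le:
  assumes "f \<in> X" "g \<in> X"
  shows "sqn (\<lambda>x. f x + g x) \<le> 2 * sqn f + 2 * sqn g"
  using parallelogram[OF assms] ip_nonneg[OF diff_mem[OF assms]] by simp

lemma sqn_diff_triangle:
  assumes "f \<in> X" "g \<in> X" "h \<in> X"
  shows "sqn (\<lambda>x. f x - h x) \<le> 2 * sqn (\<lambda>x. f x - g x) + 2 * sqn (\<lambda>x. g x - h x)"
  using sqn_add_le[of "\<lambda>x. f x - g x" "\<lambda>x. g x - h x"] assms by (simp add: mems)

lemma sqn_diff_commute: "f \<in> X \<Longrightarrow> g \<in> X \<Longrightarrow> sqn (\<lambda>x. f x - g x) = sqn (\<lambda>x. g x - f x)"
  by (simp add: ips mems)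

definition conv :: "(nat \<Rightarrow> 'a \<Rightarrow> complex) \<Rightarrow> ('a \<Rightarrow> complex) \<Rightarrow> bool" where
  "conv F f \<longleftrightarrow> (\<forall>n. F n \<in> X) \<and> f \<in> X \<and> (\<lambda>n. sqn (\<lambda>x. F n x - f x)) \<longlonglongrightarrow> 0"

lemma conv_ip:
  assumes "conv F f" "g \<in> X"
  shows "(\<lambda>n. ip (F n) g) \<longlonglongrightarrow> ip f g"
proof -
  have X: "F n \<in> X" "f \<in> X" for n using assms unfolding conv_def by auto
  have "(\<lambda>n. (cmod (ip (F n) g - ip f g))\<^sup>2) \<longlonglongrightarrow> 0"
  proof (rule tendsto_sandwich[OF _ _ tendsto_const])
    have "(cmod (ip (F n) g - ip f g))\<^sup>2 \<le> sqn (\<lambda>x. F n x - f x) * sqn g" for n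
      using Cauchy_Schwarz[OF diff_mem[OF X] assms(2), of n] ip_diff[OF X assms(2), of n] by simp
    then show "\<forall>\<^sub>F n in sequentially. (cmod (ip (F n) g - ip f g))\<^sup>2 \<le> sqn (\<lambda>x. F n x - f x) * sqn g"
      by simp
    show "(\<lambda>n. sqn (\<lambda>x. F n x - f x) * sqn g) \<longlonglongrightarrow> 0"
      using assms(1) unfolding conv_def by (auto intro!: tendsto_mult_left_zero)
  qed simp
  then have "(\<lambda>n. sqrt ((cmod (ip (F n) g - ip f g))\<^sup>2)) \<longlonglongrightarrow> sqrt 0"
    by (rule tendsto_real_sqrt)
  then have "(\<lambda>n. cmod (ip (F n) g - ip f g)) \<longlonglongrightarrow> 0" by simp
  then show ?thesis by (metis LIM_zero_cancel tendsto_norm_zero_cancel)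
qed

lemma conv_sqn:
  assumes "conv F f"
  shows "(\<lambda>n. sqn (F n)) \<longlonglongrightarrow> sqn f"
proof -
  have X: "F n \<in> X" "f \<in> X" for n using assms unfolding conv_def by auto
  have eq: "sqn (F n) = sqn (\<lambda>x. F n x - f x) + 2 * Re (ip (F n) f) - sqn f" for n
    using X Re_ip_sym[OF X(1)[of n] X(2)] by (simp add: ips mems)
  have "(\<lambda>n. Re (ip (F n) f)) \<longlonglongrightarrow> sqn f"
    using tendsto_Re[OF conv_ip[OF assms X(2)]] .
  then have "(\<lambda>n. sqn (\<lambda>x. F n x - f x) + 2 * Re (ip (F n) f) - sqn f) \<longlonglongrightarrow> 0 + 2 * sqn f - sqn f"
    using assms unfolding conv_def by (intro tendsto_add tendsto_diff tendsto_mult_left tendsto_const) auto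
  then show ?thesis unfolding eq by simp
qed

lemma conv_Cauchy:
  assumes "conv F f" "e > 0"
  shows "\<exists>N. \<forall>m\<ge>N. \<forall>n\<ge>N. sqn (\<lambda>x. F m x - F n x) < e"
proof -
  have X: "F n \<in> X" "f \<in> X" for n using assms unfolding conv_def by auto
  have "(\<lambda>n. sqn (\<lambda>x. F n x - f x)) \<longlonglongrightarrow> 0" using assms unfolding conv_def by auto
  then have "\<forall>\<^sub>F n in sequentially. sqn (\<lambda>x. F n x - f x) < e / 4"
    using assms(2) by (intro order_tendstoD) auto
  then obtain N where N: "\<And>n. n \<ge> N \<Longrightarrow> sqn (\<lambda>x. F n x - f x) < e / 4"
    unfolding eventually_sequentially by blast
  have "sqn (\<lambda>x. F m x - F n x) < e" if "m \<ge> N" "n \<ge> N" for m n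
    using sqn_diff_triangle[OF X(1)[of m] X(2) X(1)[of n]] N[OF that(1)] N[OF that(2)]
      sqn_diff_commute[OF X(1)[of n] X(2)] by linarith
  then show ?thesis by blast
qed

lemma complete_conv:
  assumes "\<And>n. F n \<in> X"
    and "\<And>e. e > 0 \<Longrightarrow> \<exists>N. \<forall>m\<ge>N. \<forall>n\<ge>N. sqn (\<lambda>x. F m x - F n x) < e"
  obtains f where "conv F f"
  using complete[OF assms] assms(1) unfolding conv_def by blast

definition subspace_of :: "('a \<Rightarrow> complex) set \<Rightarrow> bool" where
  "subspace_of S \<longleftrightarrow> S \<subseteq> X \<and> (\<lambda>_. 0) \<in> S \<and> (\<forall>f\<in>S. \<forall>g\<in>S. \<forall>c. (\<lambda>x. c * f x + g x) \<in> S)"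

text \<open>\<open>S\<close> is not assumed closed, so the projection appears as the limit m of a
  minimizing sequence in \<open>S\<close>. The parallelogram law, applied to two members and their
  midpoint, makes the sequence Cauchy. Orthogonality of the remainder holds because moving a member
  along s cannot bring the distance below the infimum d.\<close>

lemma approx_projection:
  assumes S: "subspace_of S" and x: "x \<in> X"
  obtains F m where "\<And>n. F n \<in> S" "conv F m" "\<And>s. s \<in> S \<Longrightarrow> ip (\<lambda>z. x z - m z) s = 0"
proof -
  have SX: "s \<in> X" if "s \<in> S" for s using S that unfolding subspace_of_def by blast
  have Slin: "(\<lambda>x. c * f x + g x) \<in> S" if "f \<in> S" "g \<in> S" for c f g
    using S that unfolding subspace_of_def by blast
  have S0: "(\<lambda>_. 0) \<in> S" using S unfolding subspace_of_def by blast
  define d where "d = Inf ((\<lambda>s. sqn (\<lambda>z. x z - s z)) ` S)"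
  have bdd: "bdd_below ((\<lambda>s. sqn (\<lambda>z. x z - s z)) ` S)"
    using ip_nonneg diff_mem[OF x SX] by (intro bdd_belowI2[of _ 0]) auto
  have dle: "d \<le> sqn (\<lambda>z. x z - s z)" if "s \<in> S" for s
    unfolding d_def using bdd that by (intro cInf_lower) auto
  have "\<exists>s\<in>S. sqn (\<lambda>z. x z - s z) < d + 1 / Suc n" for n
    using cInf_lessD[of "(\<lambda>s. sqn (\<lambda>z. x z - s z)) ` S" "d + 1 / Suc n"] S0
    unfolding d_def by auto
  then obtain F where F: "\<And>n. F n \<in> S" "\<And>n. sqn (\<lambda>z. x z - F n z) < d + 1 / Suc n" by metis
  have FX: "F n \<in> X" for n using F SX by blast
  have est: "sqn (\<lambda>z. F m z - F n z) \<le> 2 / Suc m + 2 / Suc n" for m n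
  proof -
    let ?f = "\<lambda>z. x z - F m z" and ?g = "\<lambda>z. x z - F n z"
    let ?h = "\<lambda>z. (1/2) * F m z + (1/2) * F n z"
    have h: "?h \<in> S"
      using Slin[OF F(1)[of m] Slin[OF F(1)[of n] S0, of "1/2"], of "1/2"] by simp
    have "sqn (\<lambda>z. ?f z + ?g z) = sqn (\<lambda>z. 2 * (x z - ?h z))"
      by (simp add: algebra_simps)
    also have "\<dots> = 4 * sqn (\<lambda>z. x z - ?h z)"
      using diff_mem[OF x SX[OF h]] scale_mem[OF diff_mem[OF x SX[OF h]], of 2]
        ip_scale[of "\<lambda>z. x z - ?h z" _ 2] ip_scale_right[of "\<lambda>z. x z - ?h z" _ 2] by simp
    finally have "sqn (\<lambda>z. ?f z + ?g z) \<ge> 4 * d" using dle[OF h] by simp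
    moreover have "sqn (\<lambda>z. ?f z - ?g z) = sqn (\<lambda>z. F m z - F n z)"
      using sqn_diff_commute[OF FX FX] by (simp add: algebra_simps)
    ultimately show ?thesis
      using parallelogram[OF diff_mem[OF x FX] diff_mem[OF x FX], of m n] F(2)[of m] F(2)[of n]
      by simp
  qed
  obtain m where m: "conv F m"
  proof (rule complete_conv[of F])
    fix e :: real assume e: "e > 0"
    obtain N where N: "4 / e < real N" using reals_Archimedean2 by blast
    have "2 / Suc k < e / 2" if "k \<ge> N" for k
    proof -
      have "4 / e < Suc k" using N that by linarith
      then show ?thesis using e by (simp add: field_simps)
    qed
    then have "\<forall>m\<ge>N. \<forall>n\<ge>N. sqn (\<lambda>x. F m x - F n x) < e"
      using est by (smt (verit) field_sum_of_halves)
    then show "\<exists>N. \<forall>m\<ge>N. \<forall>n\<ge>N. sqn (\<lambda>x. F m x - F n x) < e" by blast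
  qed (use FX in auto)
  have mX: "m \<in> X" using m unfolding conv_def by blast
  have "ip (\<lambda>z. x z - m z) s = 0" if s: "s \<in> S" for s
  proof -
    \<comment> \<open>c only has to dominate \<open>sqn s\<close>; the added 1 permits division by c
      when s has norm 0.\<close>
    define c where "c = sqn s + 1"
    have c: "c > 0" "sqn s \<le> c" using ip_nonneg[OF SX[OF s]] unfolding c_def by auto
    let ?b = "\<lambda>n. ip (\<lambda>z. x z - F n z) s"
    have "(cmod (?b n))\<^sup>2 \<le> c * (1 / Suc n)" for n
    proof -
      have h: "(\<lambda>z. (of_real (1/c) * ?b n) * s z + F n z) \<in> S"
        using s F(1) by (intro Slin)
      have "d \<le> sqn (\<lambda>z. x z - ((of_real (1/c) * ?b n) * s z + F n z))" by (rule dle[OF h])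
      also have "(\<lambda>z. x z - ((of_real (1/c) * ?b n) * s z + F n z)) =
          (\<lambda>z. (x z - F n z) - (of_real (1/c) * ?b n) * s z)" by (auto simp: algebra_simps)
      also have "sqn \<dots> = sqn (\<lambda>z. x z - F n z) - 2 * (1/c) * (cmod (?b n))\<^sup>2
          + (1/c)\<^sup>2 * (cmod (?b n))\<^sup>2 * sqn s"
        by (rule sqn_sub_scale[OF diff_mem[OF x FX] SX[OF s]])
      also have "\<dots> \<le> d + 1 / Suc n - 2 * (1/c) * (cmod (?b n))\<^sup>2 + (1/c) * (cmod (?b n))\<^sup>2"
      proof -
        have "(1/c)\<^sup>2 * (cmod (?b n))\<^sup>2 * sqn s \<le> (1/c)\<^sup>2 * (cmod (?b n))\<^sup>2 * c"
          using c by (intro mult_left_mono) auto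
        also have "\<dots> = (1/c) * (cmod (?b n))\<^sup>2" using c by (simp add: power2_eq_square)
        finally show ?thesis using F(2)[of n] by linarith
      qed
      finally have "(1/c) * (cmod (?b n))\<^sup>2 \<le> 1 / Suc n" by simp
      then show ?thesis using c by (simp add: field_simps)
    qed
    moreover have "(\<lambda>n. c * (1 / Suc n)) \<longlonglongrightarrow> 0"
      using tendsto_mult_right_zero[OF LIMSEQ_inverse_real_of_nat] by (simp add: field_simps)
    ultimately have "(\<lambda>n. (cmod (?b n))\<^sup>2) \<longlonglongrightarrow> 0"
      using tendsto_sandwich[of "\<lambda>_. 0" "\<lambda>n. (cmod (?b n))\<^sup>2" sequentially
          "\<lambda>n. c * (1 / Suc n)" 0] by simp
    moreover have "(\<lambda>n. (cmod (?b n))\<^sup>2) \<longlonglongrightarrow> (cmod (ip (\<lambda>z. x z - m z) s))\<^sup>2"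
      using conv_ip[OF m SX[OF s]] x FX mX SX[OF s] by (simp add: ip_diff) (intro tendsto_intros)
    ultimately have "(cmod (ip (\<lambda>z. x z - m z) s))\<^sup>2 = 0" using LIMSEQ_unique by blast
    then show ?thesis by simp
  qed
  then show ?thesis using that F m by blast
qed

lemma closed_subspace_semi_hilbert:
  assumes S: "subspace_of S" and cl: "\<And>F f. (\<And>n. F n \<in> S) \<Longrightarrow> conv F f \<Longrightarrow> f \<in> S"
  shows "semi_hilbert S ip"
proof
  have SX: "s \<in> X" if "s \<in> S" for s using S that unfolding subspace_of_def by blast
  show "(\<lambda>_. 0) \<in> S" "\<And>c f g. f \<in> S \<Longrightarrow> g \<in> S \<Longrightarrow> (\<lambda>x. c * f x + g x) \<in> S"
    using S unfolding subspace_of_def by blast+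
  show "\<exists>f\<in>S. (\<lambda>n. sqn (\<lambda>x. F n x - f x)) \<longlonglongrightarrow> 0"
    if F: "\<And>n. F n \<in> S" "\<And>e. e > 0 \<Longrightarrow> \<exists>N. \<forall>m\<ge>N. \<forall>n\<ge>N. sqn (\<lambda>x. F m x - F n x) < e" for F
  proof -
    obtain f where f: "conv F f"
      by (rule complete_conv[of F]) (use F(1) SX in blast, use F(2) in blast, blast)
    then have "f \<in> S" using cl F(1) by blast
    with f show ?thesis unfolding conv_def by blast
  qed
  show "\<And>f g. f \<in> S \<Longrightarrow> g \<in> S \<Longrightarrow> ip g f = cnj (ip f g)" using ip_sym SX by blast
  show "\<And>c f g h. f \<in> S \<Longrightarrow> g \<in> S \<Longrightarrow> h \<in> S \<Longrightarrow>
      ip (\<lambda>x. c * f x + g x) h = c * ip f h + ip g h"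
    by (intro ip_lin SX)
  show "\<And>f. f \<in> S \<Longrightarrow> 0 \<le> sqn f" by (intro ip_nonneg SX)
qed

end

lemma semi_hilbert_polarization:
  assumes "semi_hilbert X ip" "semi_hilbert Y iq"
    and T: "\<And>f. f \<in> X \<Longrightarrow> T f \<in> Y"
    and lin: "\<And>c f g. f \<in> X \<Longrightarrow> g \<in> X \<Longrightarrow> T (\<lambda>x. c * f x + g x) = (\<lambda>y. c * T f y + T g y)"
    and iso: "\<And>f. f \<in> X \<Longrightarrow> Re (iq (T f) (T f)) = Re (ip f f)"
    and fg: "f \<in> X" "g \<in> X"
  shows "iq (T f) (T g) = ip f g"
proof -
  interpret X: semi_hilbert X ip by fact
  interpret Y: semi_hilbert Y iq by fact
  have *: "Re (c * iq (T f) (T g)) = Re (c * ip f g)" for c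
  proof -
    have "Re (iq (\<lambda>y. c * T f y + T g y) (\<lambda>y. c * T f y + T g y)) =
        Re (ip (\<lambda>y. c * f y + g y) (\<lambda>y. c * f y + g y))"
      using iso[OF X.lin_mem[OF fg, of c]] lin[OF fg, of c] by simp
    moreover have "iq (\<lambda>y. c * T f y + T g y) (\<lambda>y. c * T f y + T g y) =
        c * cnj c * iq (T f) (T f) + c * iq (T f) (T g) + cnj (c * iq (T f) (T g)) + iq (T g) (T g)"
      using fg T by (simp add: Y.ips Y.mems Y.ip_sym[of "T f" "T g"]) (simp add: algebra_simps)
    moreover have "ip (\<lambda>y. c * f y + g y) (\<lambda>y. c * f y + g y) =
        c * cnj c * ip f f + c * ip f g + cnj (c * ip f g) + ip g g"
      using fg by (simp add: X.ips X.mems X.ip_sym[of f g]) (simp add: algebra_simps)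
    moreover have "iq (T f) (T f) = ip f f" "iq (T g) (T g) = ip g g"
      using fg iso X.ip_self[of f] Y.ip_self[of "T f"] X.ip_self[of g] Y.ip_self[of "T g"] T by simp_all
    ultimately show ?thesis by simp
  qed
  show ?thesis using *[of 1] *[of "-\<i>"] by (simp add: complex_eq_iff)
qed

text \<open>The graph of the map that sends a finite combination of the first family to the
  combination of the second with the same coefficients. It is a relation because a function may be
  such a combination in several ways; equal Gram matrices make the outcomes agree up to a vector of
  norm 0.\<close>

inductive same_comb ::
  "('i \<Rightarrow> 'a \<Rightarrow> complex) \<Rightarrow> ('i \<Rightarrow> 'b \<Rightarrow> complex) \<Rightarrow> ('a \<Rightarrow> complex) \<Rightarrow> ('b \<Rightarrow> complex) \<Rightarrow> bool"
  for a b where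
  zero: "same_comb a b (\<lambda>_. 0) (\<lambda>_. 0)"
| step: "same_comb a b x y \<Longrightarrow> same_comb a b (\<lambda>t. c * a i t + x t) (\<lambda>t. c * b i t + y t)"

lemma same_comb_lin:
  assumes "same_comb a b x y" "same_comb a b x' y'"
  shows "same_comb a b (\<lambda>t. c * x t + x' t) (\<lambda>t. c * y t + y' t)"
  using assms(1)
proof induction
  case zero
  then show ?case using assms(2) by simp
next
  case (step x y d i)
  show ?case using same_comb.step[OF step.IH, of "c * d" i] by (simp add: algebra_simps)
qed

text \<open>The last conclusion expresses that \<open>y\<close> lies in the closed span of the second family.\<close>

lemma isometry_transfer:
  assumes "semi_hilbert X ip" "semi_hilbert Y iq"
    and a: "\<And>i. a i \<in> X" and b: "\<And>i. b i \<in> Y"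
    and gram: "\<And>i j. ip (a i) (a j) = iq (b i) (b j)"
    and total: "\<And>x. x \<in> X \<Longrightarrow> (\<And>i. ip x (a i) = 0) \<Longrightarrow> Re (ip x x) = 0"
    and x: "x \<in> X"
  obtains y where "y \<in> Y" "\<And>i. iq y (b i) = ip x (a i)" "Re (iq y y) = Re (ip x x)"
    "\<And>z. z \<in> Y \<Longrightarrow> (\<And>i. iq z (b i) = 0) \<Longrightarrow> iq y z = 0"
proof -
  interpret X: semi_hilbert X ip by fact
  interpret Y: semi_hilbert Y iq by fact
  have sX: "s \<in> X" and sY: "t \<in> Y" if "same_comb a b s t" for s t
    using that by induction (auto simp: a b X.mems Y.mems)
  have g1: "ip s (a j) = iq t (b j)" if "same_comb a b s t" for s t j
    using that by induction (auto simp: a b X.ips Y.ips X.mems Y.mems gram sX sY)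
  have g2: "ip s' s = iq t' t" if "same_comb a b s t" "same_comb a b s' t'" for s t s' t'
    using that by induction (auto simp: a b X.ips Y.ips X.mems Y.mems g1 sX sY)
  define S where "S = {s. \<exists>t. same_comb a b s t}"
  have aS: "a i \<in> S" for i
    using same_comb.step[OF same_comb.zero, of a b 1 i] unfolding S_def by auto
  have "X.subspace_of S"
    unfolding X.subspace_of_def S_def using sX same_comb.zero same_comb_lin by blast
  then obtain F m where F: "\<And>n. F n \<in> S" "X.conv F m"
    "\<And>s. s \<in> S \<Longrightarrow> ip (\<lambda>z. x z - m z) s = 0"
    using X.approx_projection[OF _ x] by metis
  have mX: "m \<in> X" using F(2) unfolding X.conv_def by blast
  have FX: "F n \<in> X" for n using F(2) unfolding X.conv_def by blast
  \<comment> \<open>By totality x and its projection m differ by a null vector, so m may replace x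
    in every inner product although the two functions need not be equal.\<close>
  have "X.sqn (\<lambda>z. x z - m z) = 0"
    using total[OF X.diff_mem[OF x mX]] F(3) aS by blast
  then have null: "ip (\<lambda>z. x z - m z) h = 0" if "h \<in> X" for h
    using X.ip_eq_0_of_sqn_0 X.diff_mem x mX that by blast
  have xm: "ip x h = ip m h" if "h \<in> X" for h
    using null[OF that] X.ip_diff[OF x mX that] by simp
  have xm2: "ip x x = ip m m"
    using xm[OF x] xm[OF mX] X.ip_sym[OF x mX] X.ip_sym[OF mX mX] by simp
  obtain G where G: "\<And>n. same_comb a b (F n) (G n)" using F(1) unfolding S_def mem_Collect_eq by metis
  have GY: "G n \<in> Y" for n using G sY by blast
  have diff: "same_comb a b (\<lambda>z. F m z - F n z) (\<lambda>z. G m z - G n z)" for m n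
    using same_comb_lin[OF G G, of "-1" n m] by simp
  obtain y where y: "Y.conv G y"
  proof (rule Y.complete_conv[of G])
    fix e :: real assume "e > 0"
    then show "\<exists>N. \<forall>m\<ge>N. \<forall>n\<ge>N. Re (iq (\<lambda>x. G m x - G n x) (\<lambda>x. G m x - G n x)) < e"
      using X.conv_Cauchy[OF F(2)] g2[OF diff diff] by simp
  qed (use GY in auto)
  have yY: "y \<in> Y" using y unfolding Y.conv_def by blast
  show ?thesis
  proof (rule that[OF yY])
    show "iq y (b i) = ip x (a i)" for i
      using X.conv_ip[OF F(2) a[of i]] Y.conv_ip[OF y b[of i]] g1[OF G] xm[OF a]
      by (simp add: LIMSEQ_unique)
    show "Re (iq y y) = Re (ip x x)"
      using X.conv_sqn[OF F(2)] Y.conv_sqn[OF y] g2[OF G G] xm2 by (simp add: LIMSEQ_unique)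
    show "iq y z = 0" if z: "z \<in> Y" "\<And>i. iq z (b i) = 0" for z
    proof -
      have z': "iq (b i) z = 0" for i using z(2)[of i] Y.ip_sym[OF z(1) b] by simp
      have "iq t z = 0" if "same_comb a b s t" for s t
        using that by induction (auto simp: b Y.ips Y.mems sY z(1) z')
      then have "(\<lambda>n. iq (G n) z) = (\<lambda>_. 0)" using G by blast
      then show ?thesis using Y.conv_ip[OF y z(1)] LIMSEQ_unique[OF _ tendsto_const] by metis
    qed
  qed
qed

section \<open>Square integrable functions\<close>

text \<open>Stated for an arbitrary measure: counting measure on the naturals gives the coefficient
  space of \<open>H2\<close>, a Clark measure gives the domain of the Clark transform, and
  completeness is proved once for both.\<close>

definition sqint :: "'a measure \<Rightarrow> ('a \<Rightarrow> complex) set" where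
  "sqint M = {f \<in> borel_measurable M. integrable M (\<lambda>x. (cmod (f x))\<^sup>2)}"

definition sqip :: "'a measure \<Rightarrow> ('a \<Rightarrow> complex) \<Rightarrow> ('a \<Rightarrow> complex) \<Rightarrow> complex" where
  "sqip M f g = (\<integral>x. f x * cnj (g x) \<partial>M)"

lemma sqintD:
  assumes "f \<in> sqint M"
  shows "f \<in> borel_measurable M" "integrable M (\<lambda>x. (cmod (f x))\<^sup>2)"
  using assms unfolding sqint_def by auto

lemma cmod_sq_lin_le: "(cmod (c * a + b))\<^sup>2 \<le> 2 * (cmod c)\<^sup>2 * (cmod a)\<^sup>2 + 2 * (cmod b)\<^sup>2"
proof -
  have "cmod (c * a + b) \<le> cmod c * cmod a + cmod b"
    by (metis norm_mult norm_triangle_ineq)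
  then have "(cmod (c * a + b))\<^sup>2 \<le> (cmod c * cmod a + cmod b)\<^sup>2"
    by (simp add: power_mono)
  also have "\<dots> \<le> 2 * (cmod c * cmod a)\<^sup>2 + 2 * (cmod b)\<^sup>2"
    using sum_squares_bound[of "cmod c * cmod a" "cmod b"] by (simp add: power2_sum)
  finally show ?thesis by (simp add: power_mult_distrib)
qed

lemma sqint_lin:
  assumes "f \<in> sqint M" "g \<in> sqint M"
  shows "(\<lambda>x. c * f x + g x) \<in> sqint M"
proof -
  note [measurable] = sqintD(1)[OF assms(1)] sqintD(1)[OF assms(2)]
  have "integrable M (\<lambda>x. 2 * (cmod c)\<^sup>2 * (cmod (f x))\<^sup>2 + 2 * (cmod (g x))\<^sup>2)"
    using sqintD(2)[OF assms(1)] sqintD(2)[OF assms(2)] by auto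
  then have "integrable M (\<lambda>x. (cmod (c * f x + g x))\<^sup>2)"
    by (rule Bochner_Integration.integrable_bound) (auto intro: cmod_sq_lin_le)
  then show ?thesis unfolding sqint_def by simp
qed

lemma integrable_sqint_mult:
  assumes "f \<in> sqint M" "g \<in> sqint M"
  shows "integrable M (\<lambda>x. f x * g x)"
proof -
  note [measurable] = sqintD(1)[OF assms(1)] sqintD(1)[OF assms(2)]
  have "integrable M (\<lambda>x. (cmod (f x))\<^sup>2 + (cmod (g x))\<^sup>2)"
    using sqintD(2)[OF assms(1)] sqintD(2)[OF assms(2)] by auto
  then show ?thesis
  proof (rule Bochner_Integration.integrable_bound)
    have "cmod (f x * g x) \<le> (cmod (f x))\<^sup>2 + (cmod (g x))\<^sup>2" for x
      using sum_squares_bound[of "cmod (f x)" "cmod (g x)"]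
        mult_nonneg_nonneg[OF norm_ge_zero[of "f x"] norm_ge_zero[of "g x"]]
      unfolding norm_mult by linarith
    then show "AE x in M. norm (f x * g x) \<le> norm ((cmod (f x))\<^sup>2 + (cmod (g x))\<^sup>2)"
      by simp
  qed simp
qed

lemma borel_measurable_cnj [measurable]: "cnj \<in> borel_measurable borel"
  by (intro borel_measurable_continuous_onI continuous_intros)

lemma sqint_cnj: "f \<in> sqint M \<Longrightarrow> (\<lambda>x. cnj (f x)) \<in> sqint M"
  unfolding sqint_def by (auto intro: measurable_compose[OF _ borel_measurable_cnj])

lemma integrable_sqip: "f \<in> sqint M \<Longrightarrow> g \<in> sqint M \<Longrightarrow> integrable M (\<lambda>x. f x * cnj (g x))"
  using integrable_sqint_mult sqint_cnj by blast

lemma sqip_self: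
  assumes "f \<in> sqint M"
  shows "sqip M f f = of_real (\<integral>x. (cmod (f x))\<^sup>2 \<partial>M)"
  unfolding sqip_def by (simp flip: complex_norm_square of_real_power)

lemma sqint_norm_eq:
  assumes "f \<in> sqint M"
  shows "(\<integral>\<^sup>+x. ennreal ((cmod (f x))\<^sup>2) \<partial>M) = ennreal (Re (sqip M f f))"
  using nn_integral_eq_integral[OF sqintD(2)[OF assms]] sqip_self[OF assms] by simp

lemma sqip_zero_iff_AE:
  assumes "f \<in> sqint M"
  shows "Re (sqip M f f) = 0 \<longleftrightarrow> (AE x in M. f x = 0)"
  using integral_nonneg_eq_0_iff_AE[OF sqintD(2)[OF assms]] sqip_self[OF assms] by simp

text \<open>Riesz--Fischer. Weighting the squares of the increments of a rapidly converging subsequence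
  by \<open>2 ^ n\<close> makes their sum integrable, so almost everywhere the increments are dominated by a
  geometric series.\<close>

lemma sqint_complete:
  assumes F: "\<And>n::nat. F n \<in> sqint M"
    and C: "\<And>e. e > 0 \<Longrightarrow> \<exists>N. \<forall>m\<ge>N. \<forall>n\<ge>N.
      Re (sqip M (\<lambda>x. F m x - F n x) (\<lambda>x. F m x - F n x)) < e"
  shows "\<exists>f\<in>sqint M. (\<lambda>n. Re (sqip M (\<lambda>x. F n x - f x) (\<lambda>x. F n x - f x))) \<longlonglongrightarrow> 0"
proof -
  let ?N = "\<lambda>m n. Re (sqip M (\<lambda>x. F m x - F n x) (\<lambda>x. F m x - F n x))"
  note [measurable] = sqintD(1)[OF F]
  have dF: "(\<lambda>x. F m x - F n x) \<in> sqint M" for m n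
    using sqint_lin[OF F F, of "-1" n m] by simp
  \<comment> \<open>Beyond k j the squared distances are below (1/4)^j, which leaves room for the
    weight 2^j: the weighted terms are still below (1/2)^j. The maximum with the successor makes k
    strictly increasing.\<close>
  define k where "k = rec_nat (SOME K. \<forall>m\<ge>K. \<forall>n\<ge>K. ?N m n < 1)
    (\<lambda>j kj. max (Suc kj) (SOME K. \<forall>m\<ge>K. \<forall>n\<ge>K. ?N m n < (1/4) ^ Suc j))"
  have k0: "k 0 = (SOME K. \<forall>m\<ge>K. \<forall>n\<ge>K. ?N m n < 1)" unfolding k_def by simp
  have kS: "k (Suc j) = max (Suc (k j)) (SOME K. \<forall>m\<ge>K. \<forall>n\<ge>K. ?N m n < (1/4) ^ Suc j)" for j
    unfolding k_def by simp
  have kC: "?N m n < (1/4) ^ j" if "m \<ge> k j" "n \<ge> k j" for m n j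
  proof (cases j)
    case 0
    then show ?thesis using someI_ex[OF C[of 1]] that k0 by simp
  next
    case (Suc i)
    then show ?thesis using someI_ex[OF C[of "(1/4) ^ Suc i"]] that kS[of i] by simp
  qed
  have k_mono: "strict_mono k" using kS by (intro strict_monoI_Suc) (simp add: less_max_iff_disj)
  define d where "d = (\<lambda>j x. F (k (Suc j)) x - F (k j) x)"
  have d_meas [measurable]: "d j \<in> borel_measurable M" for j unfolding d_def by simp
  have d_int: "(\<integral>\<^sup>+x. ennreal ((cmod (d j x))\<^sup>2) \<partial>M) \<le> ennreal ((1/4) ^ j)" for j
    unfolding d_def using sqint_norm_eq[OF dF] kC[of j "k (Suc j)" "k j"] k_mono
    by (simp add: strict_mono_less_eq ennreal_leI less_imp_le)
  have "(\<integral>\<^sup>+x. (\<Sum>j. ennreal (2 ^ j * (cmod (d j x))\<^sup>2)) \<partial>M) =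
      (\<Sum>j. (\<integral>\<^sup>+x. ennreal (2 ^ j * (cmod (d j x))\<^sup>2) \<partial>M))"
    by (rule nn_integral_suminf) simp
  also have "\<dots> \<le> (\<Sum>j. ennreal ((1/2) ^ j))"
  proof (rule suminf_le)
    fix j
    have "(\<integral>\<^sup>+x. ennreal (2 ^ j * (cmod (d j x))\<^sup>2) \<partial>M) =
        ennreal (2 ^ j) * (\<integral>\<^sup>+x. ennreal ((cmod (d j x))\<^sup>2) \<partial>M)"
      by (simp add: ennreal_mult nn_integral_cmult)
    also have "\<dots> \<le> ennreal (2 ^ j) * ennreal ((1/4) ^ j)" by (intro mult_left_mono d_int) simp
    also have "\<dots> = ennreal ((2 * (1/4)) ^ j)" by (simp flip: ennreal_mult power_mult_distrib)
    finally show "(\<integral>\<^sup>+x. ennreal (2 ^ j * (cmod (d j x))\<^sup>2) \<partial>M) \<le> ennreal ((1/2) ^ j)" by simp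
  qed auto
  also have "\<dots> = ennreal (\<Sum>j. (1/2) ^ j)" by (rule suminf_ennreal2) (auto intro: summable_geometric)
  also have "\<dots> < \<infinity>" by simp
  finally have "AE x in M. (\<Sum>j. ennreal (2 ^ j * (cmod (d j x))\<^sup>2)) \<noteq> \<infinity>"
    by (intro nn_integral_PInf_AE) auto
  then have "AE x in M. convergent (\<lambda>j. F (k j) x)"
  proof eventually_elim
    fix x assume "(\<Sum>j. ennreal (2 ^ j * (cmod (d j x))\<^sup>2)) \<noteq> \<infinity>"
    then have s: "summable (\<lambda>j. 2 ^ j * (cmod (d j x))\<^sup>2)"
      by (intro summable_suminf_not_top) auto
    have "summable (\<lambda>j. cmod (d j x))"
    proof (rule summable_comparison_test')
      show "summable (\<lambda>j. 2 ^ j * (cmod (d j x))\<^sup>2 + (1/2) ^ j)"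
        by (intro summable_add s summable_geometric) simp
      show "norm (cmod (d j x)) \<le> 2 ^ j * (cmod (d j x))\<^sup>2 + (1/2) ^ j" if "j \<ge> 0" for j
      proof -
        let ?a = "cmod (d j x)" and ?p = "2 ^ j :: real"
        \<comment> \<open>A square yields a \<le> p a^2 + 1/p for p = 2^j, which trades summability
          of the weighted squares for summability of the increments themselves.\<close>
        have "0 \<le> (?p * ?a - 1)\<^sup>2 + ?p * ?a * 1" by simp
        then have "?p * ?a \<le> ?p * ?p * ?a\<^sup>2 + 1" by (simp add: power2_eq_square algebra_simps)
        then have "?a \<le> (?p * ?p * ?a\<^sup>2 + 1) / ?p" by (simp add: field_simps)
        also have "\<dots> = ?p * ?a\<^sup>2 + (1/2) ^ j" by (simp add: field_simps)
        finally show ?thesis by simp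
      qed
    qed
    then have "summable (\<lambda>j. d j x)" by (rule summable_norm_cancel)
    then have "convergent (\<lambda>n. \<Sum>j<n. d j x)" by (simp add: summable_iff_convergent)
    then have "convergent (\<lambda>n. (\<Sum>j<n. d j x) + F (k 0) x)"
      by (intro convergent_add convergent_const)
    moreover have "(\<Sum>j<n. d j x) + F (k 0) x = F (k n) x" for n
      unfolding d_def using sum_lessThan_telescope[of "\<lambda>j. F (k j) x" n] by simp
    ultimately show "convergent (\<lambda>j. F (k j) x)" by simp
  qed
  then have lim: "AE x in M. (\<lambda>j. F (k j) x) \<longlonglongrightarrow> lim (\<lambda>j. F (k j) x)"
    by eventually_elim (simp add: convergent_LIMSEQ_iff)
  define f where "f = (\<lambda>x. lim (\<lambda>j. F (k j) x))"
  have f_meas [measurable]: "f \<in> borel_measurable M" unfolding f_def by measurable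
  \<comment> \<open>Fatou's lemma replaces the pointwise limit by members of the subsequence, for
    which the Cauchy estimate is available.\<close>
  have bound: "(\<integral>\<^sup>+x. ennreal ((cmod (F n x - f x))\<^sup>2) \<partial>M) \<le> ennreal ((1/4) ^ j)"
    if n: "n \<ge> k j" for n j
  proof -
    have "(\<integral>\<^sup>+x. ennreal ((cmod (F n x - f x))\<^sup>2) \<partial>M) =
        (\<integral>\<^sup>+x. liminf (\<lambda>i. ennreal ((cmod (F n x - F (k i) x))\<^sup>2)) \<partial>M)"
    proof (rule nn_integral_cong_AE)
      show "AE x in M. ennreal ((cmod (F n x - f x))\<^sup>2) =
        liminf (\<lambda>i. ennreal ((cmod (F n x - F (k i) x))\<^sup>2))"
        using lim
      proof eventually_elim
        fix x assume "(\<lambda>j. F (k j) x) \<longlonglongrightarrow> lim (\<lambda>j. F (k j) x)"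
        then have "(\<lambda>i. ennreal ((cmod (F n x - F (k i) x))\<^sup>2)) \<longlonglongrightarrow> ennreal ((cmod (F n x - f x))\<^sup>2)"
          unfolding f_def by (intro tendsto_intros)
        then show "ennreal ((cmod (F n x - f x))\<^sup>2) =
            liminf (\<lambda>i. ennreal ((cmod (F n x - F (k i) x))\<^sup>2))"
          using lim_imp_Liminf[OF trivial_limit_sequentially] by metis
      qed
    qed
    also have "\<dots> \<le> liminf (\<lambda>i. \<integral>\<^sup>+x. ennreal ((cmod (F n x - F (k i) x))\<^sup>2) \<partial>M)"
      by (rule nn_integral_liminf) simp
    also have "\<dots> \<le> liminf (\<lambda>i. ennreal ((1/4) ^ j))"
    proof (rule Liminf_mono)
      have "(\<integral>\<^sup>+x. ennreal ((cmod (F n x - F (k i) x))\<^sup>2) \<partial>M) \<le> ennreal ((1/4) ^ j)" if "i \<ge> j" for i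
        using sqint_norm_eq[OF dF] kC[of j n "k i"] n k_mono that
        by (simp add: strict_mono_less_eq ennreal_leI less_imp_le)
      then show "\<forall>\<^sub>F i in sequentially.
          (\<integral>\<^sup>+x. ennreal ((cmod (F n x - F (k i) x))\<^sup>2) \<partial>M) \<le> ennreal ((1/4) ^ j)"
        unfolding eventually_sequentially by blast
    qed
    also have "\<dots> = ennreal ((1/4) ^ j)" by (simp add: Liminf_const)
    finally show ?thesis .
  qed
  have dsq: "(\<lambda>x. F n x - f x) \<in> sqint M" if "n \<ge> k 0" for n
    unfolding sqint_def using le_less_trans[OF bound[OF that] ennreal_less_top]
    by (auto intro!: integrableI_bounded)
  have "f \<in> sqint M"
    using sqint_lin[OF dsq[of "k 0"] F[of "k 0"], of "-1"] by simp
  moreover have "(\<lambda>n. Re (sqip M (\<lambda>x. F n x - f x) (\<lambda>x. F n x - f x))) \<longlonglongrightarrow> 0"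
  proof (rule LIMSEQ_I)
    fix r :: real assume r: "r > 0"
    obtain j where j: "(1/4::real) ^ j < r" using real_arch_pow_inv[OF r, of "1/4"] by auto
    have "norm (Re (sqip M (\<lambda>x. F n x - f x) (\<lambda>x. F n x - f x)) - 0) < r" if n: "n \<ge> k j" for n
    proof -
      have n0: "n \<ge> k 0" using n k_mono by (meson le_trans strict_mono_less_eq zero_le)
      have "ennreal (Re (sqip M (\<lambda>x. F n x - f x) (\<lambda>x. F n x - f x))) \<le> ennreal ((1/4) ^ j)"
        using bound[OF n] sqint_norm_eq[OF dsq[OF n0]] by simp
      then have "Re (sqip M (\<lambda>x. F n x - f x) (\<lambda>x. F n x - f x)) \<le> (1/4) ^ j"
        by (simp add: ennreal_le_iff)
      moreover have "0 \<le> Re (sqip M (\<lambda>x. F n x - f x) (\<lambda>x. F n x - f x))"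
        using sqip_self[OF dsq[OF n0]] by simp
      ultimately show ?thesis using j by simp
    qed
    then show "\<exists>no. \<forall>n\<ge>no. norm (Re (sqip M (\<lambda>x. F n x - f x) (\<lambda>x. F n x - f x)) - 0) < r" by blast
  qed
  ultimately show ?thesis by blast
qed

lemma semi_hilbert_sqint: "semi_hilbert (sqint M) (sqip M)"
proof
  show "(\<lambda>_. 0) \<in> sqint M" unfolding sqint_def by simp
  show "sqip M (\<lambda>x. c * f x + g x) h = c * sqip M f h + sqip M g h"
    if "f \<in> sqint M" "g \<in> sqint M" "h \<in> sqint M" for c f g h
  proof -
    have "sqip M (\<lambda>x. c * f x + g x) h = (\<integral>x. c * (f x * cnj (h x)) + g x * cnj (h x) \<partial>M)"
      unfolding sqip_def by (simp add: algebra_simps)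
    also have "\<dots> = c * sqip M f h + sqip M g h"
      unfolding sqip_def using integrable_sqip that by (subst Bochner_Integration.integral_add) auto
    finally show ?thesis .
  qed
  show "sqip M g f = cnj (sqip M f g)" for f g
  proof -
    have "cnj (sqip M f g) = (\<integral>x. cnj (f x * cnj (g x)) \<partial>M)"
      unfolding sqip_def by (rule Bochner_Integration.integral_cnj[symmetric])
    then show ?thesis unfolding sqip_def by (simp add: mult.commute)
  qed
  show "0 \<le> Re (sqip M f f)" if "f \<in> sqint M" for f using sqip_self[OF that] by simp
qed (use sqint_lin sqint_complete in blast)+

lemma sqint_cong_AE:
  assumes "f \<in> sqint M" "f' \<in> borel_measurable M" "AE x in M. f x = f' x"
  shows "f' \<in> sqint M"
proof -
  have "integrable M (\<lambda>x. (cmod (f' x))\<^sup>2) \<longleftrightarrow> integrable M (\<lambda>x. (cmod (f x))\<^sup>2)"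
    using assms sqintD(1)[OF assms(1)] by (intro integrable_cong_AE) auto
  then show ?thesis using assms sqintD(2)[OF assms(1)] unfolding sqint_def by simp
qed

lemma sqint_bounded_mult:
  assumes "f \<in> sqint M" "b \<in> borel_measurable M" "\<And>x. x \<in> space M \<Longrightarrow> cmod (b x) \<le> C"
  shows "(\<lambda>x. b x * f x) \<in> sqint M"
proof -
  note [measurable] = sqintD(1)[OF assms(1)] assms(2)
  have "integrable M (\<lambda>x. C\<^sup>2 * (cmod (f x))\<^sup>2)" using sqintD(2)[OF assms(1)] by simp
  then have "integrable M (\<lambda>x. (cmod (b x * f x))\<^sup>2)"
  proof (rule Bochner_Integration.integrable_bound)
    show "AE x in M. norm ((cmod (b x * f x))\<^sup>2) \<le> norm (C\<^sup>2 * (cmod (f x))\<^sup>2)"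
      using assms(3) by (intro AE_I2) (auto simp: norm_mult power_mult_distrib intro!: mult_right_mono power_mono)
  qed simp
  then show ?thesis unfolding sqint_def by simp
qed

lemma sqint_bounded:
  assumes "finite_measure M" "b \<in> borel_measurable M" "\<And>x. x \<in> space M \<Longrightarrow> cmod (b x) \<le> C"
  shows "b \<in> sqint M"
proof -
  interpret finite_measure M by fact
  have "(\<lambda>_. 1) \<in> sqint M" unfolding sqint_def by simp
  from sqint_bounded_mult[OF this assms(2,3)] show ?thesis by simp
qed

section \<open>The Hardy space as a sequence space\<close>

lemma taylor_sums:
  assumes "f holomorphic_on unit_disc" "z \<in> unit_disc"
  shows "(\<lambda>n. taylor_coeff f n * z ^ n) sums f z"
  using holomorphic_power_series[OF assms] unfolding taylor_coeff_def by simp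

lemma taylor_coeff_unique:
  assumes "\<And>z. z \<in> unit_disc \<Longrightarrow> (\<lambda>n. a n * z ^ n) sums f z"
  shows "taylor_coeff f = a"
proof
  fix n
  have "eventually (\<lambda>z. z \<in> unit_disc) (nhds (0::complex))"
    by (intro eventually_nhds_in_open) auto
  then have "\<forall>\<^sub>F z in nhds 0. (\<lambda>n. fps_nth (Abs_fps a) n * z ^ n) sums f z"
    by eventually_elim (use assms in simp)
  then have "f has_fps_expansion Abs_fps a" by (rule has_fps_expansionI)
  from fps_nth_fps_expansion[OF this, of n] show "taylor_coeff f n = a n"
    unfolding taylor_coeff_def by simp
qed

lemma holomorphic_of_sums:
  assumes "\<And>z. z \<in> unit_disc \<Longrightarrow> (\<lambda>n. a n * z ^ n) sums f z"
  shows "f holomorphic_on unit_disc"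
  using power_series_holomorphic[of 0 1 a f] assms by simp

lemma taylor_coeff_cong:
  assumes "f holomorphic_on unit_disc" "\<And>z. z \<in> unit_disc \<Longrightarrow> g z = f z"
  shows "taylor_coeff g = taylor_coeff f"
  using taylor_coeff_unique[of "taylor_coeff f" g] taylor_sums[OF assms(1)] assms(2) by simp

lemma taylor_coeff_at_0 [simp]: "taylor_coeff f 0 = f 0"
  unfolding taylor_coeff_def by simp

lemma taylor_coeff_lin:
  assumes "f holomorphic_on unit_disc" "g holomorphic_on unit_disc"
  shows "taylor_coeff (\<lambda>z. c * f z + g z) = (\<lambda>n. c * taylor_coeff f n + taylor_coeff g n)"
proof (rule taylor_coeff_unique)
  fix z assume "z \<in> unit_disc"
  then have "(\<lambda>n. c * (taylor_coeff f n * z ^ n) + taylor_coeff g n * z ^ n) sums (c * f z + g z)"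
    by (intro sums_add sums_mult taylor_sums assms)
  then show "(\<lambda>n. (c * taylor_coeff f n + taylor_coeff g n) * z ^ n) sums (c * f z + g z)"
    by (simp add: distrib_right mult.assoc)
qed

lemma powser_times_z:
  assumes "(\<lambda>n. a n * z ^ n) sums (s::complex)"
  shows "(\<lambda>n. (case n of 0 \<Rightarrow> 0 | Suc m \<Rightarrow> a m) * z ^ n) sums (z * s)"
proof -
  have "(\<lambda>n. z * (a n * z ^ n)) sums (z * s)" using assms by (rule sums_mult)
  then show ?thesis
    using sums_Suc_iff[of "\<lambda>n. (case n of 0 \<Rightarrow> 0 | Suc m \<Rightarrow> a m) * z ^ n" "z * s"]
    by (simp add: mult.left_commute)
qed

lemma taylor_coeff_times_z:
  assumes "f holomorphic_on unit_disc"
  shows "taylor_coeff (\<lambda>z. z * f z) = (\<lambda>n. case n of 0 \<Rightarrow> 0 | Suc m \<Rightarrow> taylor_coeff f m)"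
  by (intro taylor_coeff_unique powser_times_z taylor_sums assms)

abbreviation ell2 :: "(nat \<Rightarrow> complex) set" where
  "ell2 \<equiv> sqint (count_space UNIV)"

abbreviation ell2_ip :: "(nat \<Rightarrow> complex) \<Rightarrow> (nat \<Rightarrow> complex) \<Rightarrow> complex" where
  "ell2_ip \<equiv> sqip (count_space UNIV)"

lemma ell2_iff: "a \<in> ell2 \<longleftrightarrow> summable (\<lambda>n. (cmod (a n))\<^sup>2)"
  unfolding sqint_def by (simp add: integrable_count_space_nat_iff)

lemma ell2_ip_eq: "a \<in> ell2 \<Longrightarrow> b \<in> ell2 \<Longrightarrow> ell2_ip a b = (\<Sum>n. a n * cnj (b n))"
  unfolding sqip_def by (intro integral_count_space_nat integrable_sqip)

lemma ell2_sums: "a \<in> ell2 \<Longrightarrow> b \<in> ell2 \<Longrightarrow> (\<lambda>n. a n * cnj (b n)) sums ell2_ip a b"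
  unfolding sqip_def by (intro sums_integral_count_space_nat integrable_sqip)

lemma ell2_geometric: "cmod w < 1 \<Longrightarrow> (\<lambda>n. w ^ n) \<in> ell2"
proof -
  assume "cmod w < 1"
  then have "summable (\<lambda>n. ((cmod w)\<^sup>2) ^ n)"
    by (intro summable_geometric) (simp add: abs_square_less_1)
  moreover have "((cmod w)\<^sup>2) ^ n = (cmod (w ^ n))\<^sup>2" for n
    by (simp add: norm_power mult.commute flip: power_mult)
  ultimately show ?thesis unfolding ell2_iff by simp
qed

lemma H2_iff:
  "f \<in> H2 \<longleftrightarrow> f holomorphic_on unit_disc \<and> (\<forall>z. z \<notin> unit_disc \<longrightarrow> f z = 0) \<and> taylor_coeff f \<in> ell2"
  unfolding H2_def ell2_iff by simp

lemma H2D: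
  assumes "f \<in> H2"
  shows "f holomorphic_on unit_disc" "z \<notin> unit_disc \<Longrightarrow> f z = 0" "taylor_coeff f \<in> ell2"
    "z \<in> unit_disc \<Longrightarrow> (\<lambda>n. taylor_coeff f n * z ^ n) sums f z"
  using assms taylor_sums unfolding H2_iff by auto

lemma h2_inner_eq: "f \<in> H2 \<Longrightarrow> g \<in> H2 \<Longrightarrow> h2_inner f g = ell2_ip (taylor_coeff f) (taylor_coeff g)"
  unfolding h2_inner_def by (rule ell2_ip_eq[symmetric]) (auto simp: H2_iff)

lemma H2_of_sums:
  assumes "\<And>z. z \<in> unit_disc \<Longrightarrow> (\<lambda>n. a n * z ^ n) sums f z" "\<And>z. z \<notin> unit_disc \<Longrightarrow> f z = 0"
    and "a \<in> ell2"
  shows "f \<in> H2" "taylor_coeff f = a"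
  using assms holomorphic_of_sums[OF assms(1)] taylor_coeff_unique[OF assms(1)]
  unfolding H2_iff by auto

lemma H2_of_ell2:
  assumes "a \<in> ell2"
  obtains f where "f \<in> H2" "taylor_coeff f = a"
proof -
  let ?f = "\<lambda>z. if z \<in> unit_disc then \<Sum>n. a n * z ^ n else 0"
  have "(\<lambda>n. a n * z ^ n) sums ?f z" if z: "z \<in> unit_disc" for z
  proof -
    \<comment> \<open>The power series at z is the pairing of a with the geometric sequence of cnj
      z; it converges because both sequences are square summable.\<close>
    have "(\<lambda>n. a n * cnj (cnj z ^ n)) sums ell2_ip a (\<lambda>n. cnj z ^ n)"
      using z by (intro ell2_sums assms ell2_geometric) simp
    then show ?thesis using z by (simp add: sums_iff)
  qed
  from H2_of_sums[OF this _ assms] show ?thesis using that by simp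
qed

lemma H2_lin:
  assumes "f \<in> H2" "g \<in> H2"
  shows "(\<lambda>z. c * f z + g z) \<in> H2" "taylor_coeff (\<lambda>z. c * f z + g z) = (\<lambda>n. c * taylor_coeff f n + taylor_coeff g n)"
proof -
  show *: "taylor_coeff (\<lambda>z. c * f z + g z) = (\<lambda>n. c * taylor_coeff f n + taylor_coeff g n)"
    using assms by (intro taylor_coeff_lin H2D)
  show "(\<lambda>z. c * f z + g z) \<in> H2"
    using assms sqint_lin[of "taylor_coeff f" _ "taylor_coeff g" c]
    unfolding H2_iff * by (auto intro!: holomorphic_intros)
qed

lemma zero_H2: "(\<lambda>_. 0) \<in> H2" "taylor_coeff (\<lambda>_. 0) = (\<lambda>_. 0)"
  using H2_of_sums[of "\<lambda>_. 0" "\<lambda>_. 0"] by (simp_all add: ell2_iff)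

lemma H2_diff:
  assumes "f \<in> H2" "g \<in> H2"
  shows "(\<lambda>z. f z - g z) \<in> H2" "taylor_coeff (\<lambda>z. f z - g z) = (\<lambda>n. taylor_coeff f n - taylor_coeff g n)"
  using H2_lin[OF assms(2,1), of "-1"] by simp_all

interpretation ell2: semi_hilbert ell2 ell2_ip
  by (rule semi_hilbert_sqint)

lemma semi_hilbert_H2: "semi_hilbert H2 h2_inner"
proof
  show "h2_inner (\<lambda>x. c * f x + g x) h = c * h2_inner f h + h2_inner g h"
    if "f \<in> H2" "g \<in> H2" "h \<in> H2" for c f g h
    using that H2_lin[OF that(1,2), of c] by (simp add: h2_inner_eq ell2.ip_lin H2D(3))
  show "h2_inner g f = cnj (h2_inner f g)" if "f \<in> H2" "g \<in> H2" for f g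
    using that by (simp add: h2_inner_eq H2D(3) ell2.ip_sym[of "taylor_coeff f"])
  show "0 \<le> Re (h2_inner f f)" if "f \<in> H2" for f
    using that ell2.ip_nonneg by (simp add: h2_inner_eq H2D(3))
  fix F :: "nat \<Rightarrow> complex \<Rightarrow> complex"
  assume F: "\<And>n. F n \<in> H2" and C: "\<And>e. e > 0 \<Longrightarrow> \<exists>N. \<forall>m\<ge>N. \<forall>n\<ge>N.
    Re (h2_inner (\<lambda>x. F m x - F n x) (\<lambda>x. F m x - F n x)) < e"
  obtain a where a: "ell2.conv (\<lambda>n. taylor_coeff (F n)) a"
    using ell2.complete_conv[of "\<lambda>n. taylor_coeff (F n)"] C F
    by (auto simp: h2_inner_eq H2_diff H2D(3))
  then obtain f where f: "f \<in> H2" "taylor_coeff f = a"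
    using H2_of_ell2 unfolding ell2.conv_def by metis
  show "\<exists>f\<in>H2. (\<lambda>n. Re (h2_inner (\<lambda>x. F n x - f x) (\<lambda>x. F n x - f x))) \<longlonglongrightarrow> 0"
    using a f F unfolding ell2.conv_def by (intro bexI[of _ f]) (auto simp: h2_inner_eq H2_diff)
qed (use H2_lin zero_H2 in auto)

interpretation H2: semi_hilbert H2 h2_inner
  by (rule semi_hilbert_H2)

text \<open>The Szego kernel, which reproduces values at w. \<open>kern 0\<close> is the constant 1
  on the disc and stands in for the constant function, since elements of \<open>H2\<close> vanish
  off the disc.\<close>

definition kern :: "complex \<Rightarrow> complex \<Rightarrow> complex" where
  "kern w = (\<lambda>z. if z \<in> unit_disc then 1 / (1 - cnj w * z) else 0)"

lemma kern_H2:
  assumes "w \<in> unit_disc"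
  shows "kern w \<in> H2" "taylor_coeff (kern w) = (\<lambda>n. cnj w ^ n)"
proof -
  have s: "(\<lambda>n. cnj w ^ n * z ^ n) sums kern w z" if "z \<in> unit_disc" for z
  proof -
    have "cmod (cnj w * z) < 1"
      using that assms mult_strict_mono'[of "cmod w" 1 "cmod z" 1] by (simp add: norm_mult)
    from geometric_sums[OF this] show ?thesis
      using that unfolding kern_def by (simp add: power_mult_distrib)
  qed
  have "(\<lambda>n. cnj w ^ n) \<in> ell2" using assms by (intro ell2_geometric) simp
  from H2_of_sums[OF s _ this] show "kern w \<in> H2" "taylor_coeff (kern w) = (\<lambda>n. cnj w ^ n)"
    by (simp_all add: kern_def)
qed

lemma h2_inner_kern:
  assumes "f \<in> H2" "w \<in> unit_disc"
  shows "h2_inner f (kern w) = f w"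
  using H2D(4)[OF assms] unfolding h2_inner_def kern_H2[OF assms(2)] by (simp add: sums_iff)

text \<open>Evaluation at a point of the disc is the inner product with a kernel, so Cauchy-Schwarz
  makes a vector of norm 0 vanish there; off the disc it vanishes by convention.\<close>

lemma H2_definite:
  assumes "f \<in> H2" "Re (h2_inner f f) = 0"
  shows "f = (\<lambda>_. 0)"
proof
  fix w show "f w = 0"
    using H2D(2)[OF assms(1)] h2_inner_kern[OF assms(1)] H2.ip_eq_0_of_sqn_0[OF assms(1) kern_H2(1) assms(2)]
    by metis
qed

lemma times_z_H2:
  assumes "f \<in> H2"
  shows "(\<lambda>z. z * f z) \<in> H2"
    "taylor_coeff (\<lambda>z. z * f z) = (\<lambda>n. case n of 0 \<Rightarrow> 0 | Suc m \<Rightarrow> taylor_coeff f m)"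
proof -
  show *: "taylor_coeff (\<lambda>z. z * f z) = (\<lambda>n. case n of 0 \<Rightarrow> 0 | Suc m \<Rightarrow> taylor_coeff f m)"
    using assms by (intro taylor_coeff_times_z H2D)
  have "(\<lambda>n. case n of 0 \<Rightarrow> 0 | Suc m \<Rightarrow> taylor_coeff f m) \<in> ell2"
    using H2D(3)[OF assms] unfolding ell2_iff by (subst summable_Suc_iff[symmetric]) simp
  then show "(\<lambda>z. z * f z) \<in> H2"
    using assms unfolding H2_iff * by (auto intro!: holomorphic_intros)
qed

text \<open>Applied to an arbitrary f, \<open>k0_conj\<close> is the backward shift (f - f(0))/z. In
  this role it serves as the adjoint of multiplication by z on \<open>H2\<close>.\<close>

lemma k0_conj_sums:
  assumes "f holomorphic_on unit_disc" "z \<in> unit_disc"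
  shows "(\<lambda>n. taylor_coeff f (Suc n) * z ^ n) sums k0_conj f z"
proof (cases "z = 0")
  case True
  have "(\<lambda>n. taylor_coeff f (Suc n) * 0 ^ n) sums taylor_coeff f (Suc 0)"
    using powser_sums_zero[of "\<lambda>n. taylor_coeff f (Suc n)"] by simp
  then show ?thesis using True assms by (simp add: k0_conj_def taylor_coeff_def)
next
  case False
  have "(\<lambda>n. taylor_coeff f (Suc n) * z ^ Suc n) sums (f z - f 0)"
    using taylor_sums[OF assms] sums_Suc_iff[of "\<lambda>n. taylor_coeff f n * z ^ n" "f z - f 0"] by simp
  then have "(\<lambda>n. inverse z * (taylor_coeff f (Suc n) * z ^ Suc n)) sums (inverse z * (f z - f 0))"
    by (rule sums_mult)
  then show ?thesis using False assms(2) by (simp add: k0_conj_def field_simps)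
qed

lemma k0_conj_times_z: "z \<in> unit_disc \<Longrightarrow> z * k0_conj f z = f z - f 0"
  unfolding k0_conj_def by auto

lemma k0_conj_H2:
  assumes "f holomorphic_on unit_disc" "summable (\<lambda>n. (cmod (taylor_coeff f n))\<^sup>2)"
  shows "k0_conj f \<in> H2" "taylor_coeff (k0_conj f) = (\<lambda>n. taylor_coeff f (Suc n))"
proof -
  have "(\<lambda>n. taylor_coeff f (Suc n)) \<in> ell2"
    using assms(2) unfolding ell2_iff by (subst (asm) summable_Suc_iff[symmetric]) simp
  from H2_of_sums[OF k0_conj_sums[OF assms(1)] _ this]
  show "k0_conj f \<in> H2" "taylor_coeff (k0_conj f) = (\<lambda>n. taylor_coeff f (Suc n))"
    by (simp_all add: k0_conj_def)
qed

lemma h2_inner_times_z: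
  assumes "f \<in> H2" "g \<in> H2"
  shows "h2_inner (\<lambda>z. z * f z) g = h2_inner f (k0_conj g)"
proof -
  have g: "k0_conj g \<in> H2" "taylor_coeff (k0_conj g) = (\<lambda>n. taylor_coeff g (Suc n))"
    using assms(2) by (intro k0_conj_H2; simp add: H2_def)+
  have s: "(\<lambda>n. taylor_coeff f n * cnj (taylor_coeff g (Suc n))) sums h2_inner f (k0_conj g)"
    using ell2_sums[OF H2D(3)[OF assms(1)] H2D(3)[OF g(1)]] h2_inner_eq[OF assms(1) g(1)] g(2) by simp
  then have "(\<lambda>n. (case n of 0 \<Rightarrow> 0 | Suc m \<Rightarrow> taylor_coeff f m) * cnj (taylor_coeff g n)) sums h2_inner f (k0_conj g)"
    using sums_Suc_iff[of "\<lambda>n. (case n of 0 \<Rightarrow> 0 | Suc m \<Rightarrow> taylor_coeff f m) * cnj (taylor_coeff g n)"]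
    by simp
  then show ?thesis
    unfolding h2_inner_def[of "\<lambda>z. z * f z"] times_z_H2[OF assms(1)] by (simp add: sums_iff)
qed

lemma h2_inner_times_z_both:
  assumes "f \<in> H2" "g \<in> H2"
  shows "h2_inner (\<lambda>z. z * f z) (\<lambda>z. z * g z) = h2_inner f g"
proof -
  have "k0_conj (\<lambda>z. z * g z) = g"
  proof (intro ext)
    fix z show "k0_conj (\<lambda>z. z * g z) z = g z"
    proof (cases "z = 0")
      case True
      have "(g has_field_derivative deriv g 0) (at 0)"
        using H2D(1)[OF assms(2)] holomorphic_derivI[of g unit_disc 0] by simp
      then have "((\<lambda>z. z * g z) has_field_derivative g 0) (at 0)"
        by (auto intro!: derivative_eq_intros)
      then show ?thesis using True by (simp add: k0_conj_def DERIV_imp_deriv)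
    qed (use H2D(2)[OF assms(2)] in \<open>auto simp: k0_conj_def\<close>)
  qed
  then show ?thesis using h2_inner_times_z[OF assms(1) times_z_H2(1)[OF assms(2)]] by simp
qed

section \<open>Means over circles and inner functions\<close>

text \<open>Normalized arc length, carried by the parameter interval instead of the circle: it is on
  the real line that weak limits of measures are extracted in
  \<open>herglotz_exists\<close>.\<close>

definition arclen :: "real measure" where
  "arclen = uniform_measure lborel {0..2 * pi}"

lemma prob_space_arclen: "prob_space arclen"
  unfolding arclen_def by (intro prob_space_uniform_measure) auto

interpretation arclen: prob_space arclen
  by (rule prob_space_arclen)

lemma sets_arclen [measurable_cong, simp]: "sets arclen = sets borel"
  unfolding arclen_def by simp

lemma space_arclen [simp]: "space arclen = UNIV"
  unfolding arclen_def by simp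

lemma AE_arclen: "(AE t in lborel. P t) \<Longrightarrow> (AE t in arclen. P t)"
  unfolding arclen_def by (rule AE_uniform_measureI) auto

lemma arclen_density: "arclen = density lborel (\<lambda>t. ennreal (indicator {0..2 * pi} t / (2 * pi)))"
  unfolding arclen_def uniform_measure_def
  by (intro arg_cong[of _ _ "density lborel"] ext) (auto simp: divide_ennreal[symmetric] split: split_indicator)

lemma arclen_integral:
  fixes f :: "real \<Rightarrow> complex"
  assumes "f \<in> borel_measurable borel"
  shows "(\<integral>t. f t \<partial>arclen) = (\<integral>t. indicator {0..2 * pi} t *\<^sub>R f t \<partial>lborel) / (2 * pi)"
proof -
  have "(\<integral>t. f t \<partial>arclen) = (\<integral>t. (indicator {0..2 * pi} t / (2 * pi)) *\<^sub>R f t \<partial>lborel)"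
    unfolding arclen_density using assms by (intro integral_density) auto
  also have "\<dots> = (\<integral>t. (indicator {0..2 * pi} t *\<^sub>R f t) / (2 * pi) \<partial>lborel)"
    by (intro Bochner_Integration.integral_cong) (auto simp: scaleR_conv_of_real)
  finally show ?thesis by simp
qed

lemma continuous_cis [continuous_intros]:
  "continuous_on A f \<Longrightarrow> continuous_on A (\<lambda>x. cis (f x))"
  unfolding cis_conv_exp by (intro continuous_intros)

lemma borel_measurable_cis [measurable]: "cis \<in> borel_measurable borel"
  by (intro borel_measurable_continuous_onI continuous_intros)

lemma arclen_cis: "(\<integral>t. cis (of_int k * t) \<partial>arclen) = (if k = 0 then 1 else 0)"
proof (cases "k = 0")
  case True
  then show ?thesis using arclen.prob_space by simp
next
  case False
  have "(\<integral>t. indicator {0..2 * pi} t *\<^sub>R cis (of_int k * t) \<partial>lborel) =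
      cis (of_int k * (2 * pi)) / (\<i> * of_int k) - cis (of_int k * 0) / (\<i> * of_int k)"
  proof (rule integral_FTC_atLeastAtMost)
    fix x :: real
    have d: "((\<lambda>t. cis (of_int k * t)) has_vector_derivative of_int k * \<i> * cis (of_int k * x)) (at x within {0..2*pi})"
      unfolding cis_conv_exp of_real_mult
      by (rule has_vector_derivative_real_field[where f = "\<lambda>z. exp (\<i> * (of_real (of_int k) * z))"])
        (auto intro!: derivative_eq_intros simp: algebra_simps)
    then show "((\<lambda>t. cis (of_int k * t) / (\<i> * of_int k)) has_vector_derivative cis (of_int k * x)) (at x within {0..2*pi})"
      using has_vector_derivative_divide[OF d, of "\<i> * of_int k"] False by simp
  qed (auto intro!: continuous_intros)
  also have "cis (of_int k * (2 * pi)) = 1"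
    by (metis cis_multiple_2pi mult.commute Ints_of_int)
  finally show ?thesis using False by (subst arclen_integral) auto
qed

lemma powser_abs_summable:
  assumes "f holomorphic_on unit_disc" "0 \<le> r" "r < 1"
  shows "summable (\<lambda>n. cmod (taylor_coeff f n) * r ^ n)"
proof -
  have "summable (\<lambda>n. taylor_coeff f n * (of_real ((1 + r) / 2)) ^ n)"
    using taylor_sums[OF assms(1), of "of_real ((1 + r) / 2)"] assms(2,3)
    by (auto simp: sums_iff norm_divide simp del: of_real_divide of_real_add)
  from powser_insidea[OF this, of "of_real r"] show ?thesis
    using assms(2,3) by (simp add: norm_mult norm_power norm_divide del: of_real_divide of_real_add)
qed

lemma circle_mem: "0 \<le> r \<Longrightarrow> r < 1 \<Longrightarrow> of_real r * cis t \<in> unit_disc"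
  by (simp add: norm_mult)

lemma circle_measurable:
  assumes "f holomorphic_on unit_disc" "0 \<le> r" "r < 1"
  shows "(\<lambda>t. f (of_real r * cis t)) \<in> borel_measurable borel"
proof -
  have "continuous_on UNIV (\<lambda>t. f (of_real r * cis t))"
    using circle_mem[OF assms(2,3)]
    by (intro continuous_on_compose2[OF holomorphic_on_imp_continuous_on[OF assms(1)]] continuous_intros) auto
  then show ?thesis by (rule borel_measurable_continuous_onI)
qed

lemma circle_bounded:
  assumes "f holomorphic_on unit_disc" "0 \<le> r" "r < 1"
  obtains B where "\<And>t. cmod (f (of_real r * cis t)) \<le> B"
proof -
  have "continuous_on (cball 0 r) f"
    using assms(3) by (intro continuous_on_subset[OF holomorphic_on_imp_continuous_on[OF assms(1)]]) auto
  then have "bounded (f ` cball 0 r)"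
    by (intro compact_imp_bounded compact_continuous_image) auto
  then obtain B where "\<And>z. z \<in> cball 0 r \<Longrightarrow> cmod (f z) \<le> B"
    unfolding bounded_iff by blast
  then show ?thesis using assms(2) by (intro that[of B]) (auto simp: norm_mult)
qed

text \<open>On a circle of radius r < 1 the Taylor series is dominated by a convergent numerical
  series, so it may be integrated term by term against any bounded g. An exponential g gives Fourier
  coefficients, a conjugated holomorphic g gives Parseval.\<close>

lemma circle_mean_mult:
  assumes f: "f holomorphic_on unit_disc" and r: "0 \<le> r" "r < 1"
    and g [measurable]: "g \<in> borel_measurable borel" and B: "\<And>t. cmod (g t) \<le> B"
  shows "(\<lambda>n. taylor_coeff f n * of_real r ^ n * (\<integral>t. cis (of_int (int n) * t) * g t \<partial>arclen)) sums
    (\<integral>t. f (of_real r * cis t) * g t \<partial>arclen)"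
proof -
  let ?h = "\<lambda>n t. taylor_coeff f n * of_real r ^ n * (cis (of_int (int n) * t) * g t)"
  have B0: "B \<ge> 0" using B[of 0] norm_ge_zero order_trans by blast
  have bd: "cmod (?h n t) \<le> cmod (taylor_coeff f n) * r ^ n * B" for n t
    using B[of t] r by (simp add: norm_mult norm_power mult_left_mono)
  have int: "integrable arclen (?h n)" for n
    using bd by (intro arclen.integrable_const_bound[of _ "cmod (taylor_coeff f n) * r ^ n * B"]) auto
  have sm: "summable (\<lambda>n. cmod (taylor_coeff f n) * r ^ n * B)"
    by (intro summable_mult2 powser_abs_summable f r)
  have pt: "(\<Sum>n. ?h n t) = f (of_real r * cis t) * g t" for t
  proof -
    have "(\<lambda>n. taylor_coeff f n * (of_real r * cis t) ^ n * g t) sums (f (of_real r * cis t) * g t)"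
      by (intro sums_mult2 taylor_sums f circle_mem r)
    moreover have "taylor_coeff f n * (of_real r * cis t) ^ n * g t = ?h n t" for n
      by (simp add: power_mult_distrib Complex.DeMoivre mult.assoc)
    ultimately show ?thesis by (simp add: sums_iff)
  qed
  have "(\<lambda>n. \<integral>t. ?h n t \<partial>arclen) sums (\<integral>t. (\<Sum>n. ?h n t) \<partial>arclen)"
  proof (rule sums_integral)
    show "AE t in arclen. summable (\<lambda>n. norm (?h n t))"
      using bd by (intro AE_I2 summable_comparison_test'[OF sm, of 0]) auto
    show "summable (\<lambda>n. \<integral>t. norm (?h n t) \<partial>arclen)"
    proof (rule summable_comparison_test'[OF sm, of 0])
      fix n
      have "(\<integral>t. norm (?h n t) \<partial>arclen) \<le> cmod (taylor_coeff f n) * r ^ n * B"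
        using bd int[of n] by (intro arclen.integral_le_const) (auto simp: integrable_norm)
      then show "norm (\<integral>t. norm (?h n t) \<partial>arclen) \<le> cmod (taylor_coeff f n) * r ^ n * B"
        by simp
    qed
  qed (rule int)
  then show ?thesis unfolding pt by simp
qed

lemma circle_fourier:
  assumes f: "f holomorphic_on unit_disc" and r: "0 \<le> r" "r < 1"
  shows "(\<integral>t. f (of_real r * cis t) * cis (- (of_int k * t)) \<partial>arclen) =
    (if k \<ge> 0 then taylor_coeff f (nat k) * of_real r ^ nat k else 0)"
proof -
  let ?a = "\<lambda>n. taylor_coeff f n * of_real r ^ n * (\<integral>t. cis (of_int (int n) * t) * cis (- (of_int k * t)) \<partial>arclen)"
  have s: "?a sums (\<integral>t. f (of_real r * cis t) * cis (- (of_int k * t)) \<partial>arclen)"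
    by (rule circle_mean_mult[OF f r, where B = 1]) auto
  have c: "(\<integral>t. cis (of_int (int n) * t) * cis (- (of_int k * t)) \<partial>arclen) = (if int n = k then 1 else 0)" for n
    using arclen_cis[of "int n - k"] by (simp add: cis_mult algebra_simps)
  have "?a = (\<lambda>n. if n = nat k then (if k \<ge> 0 then taylor_coeff f n * of_real r ^ n else 0) else 0)"
    unfolding c by (intro ext) (use nat_int in force)
  with s show ?thesis
    using sums_unique2[OF s] sums_single[of "nat k" "\<lambda>n. if k \<ge> 0 then taylor_coeff f n * of_real r ^ n else 0"]
    by simp
qed

lemma circle_parseval:
  assumes f: "f holomorphic_on unit_disc" and g: "g holomorphic_on unit_disc" and r: "0 \<le> r" "r < 1"
  shows "(\<lambda>n. taylor_coeff f n * cnj (taylor_coeff g n) * of_real (r ^ (2 * n))) sums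
    (\<integral>t. f (of_real r * cis t) * cnj (g (of_real r * cis t)) \<partial>arclen)"
proof -
  obtain B where B: "\<And>t. cmod (g (of_real r * cis t)) \<le> B" by (rule circle_bounded[OF g r]) blast
  note [measurable] = circle_measurable[OF g r]
  have c: "(\<integral>t. cis (of_int (int n) * t) * cnj (g (of_real r * cis t)) \<partial>arclen) =
      cnj (taylor_coeff g n * of_real r ^ n)" for n
  proof -
    have "(\<integral>t. cis (of_int (int n) * t) * cnj (g (of_real r * cis t)) \<partial>arclen) =
        (\<integral>t. cnj (g (of_real r * cis t) * cis (- (of_int (int n) * t))) \<partial>arclen)"
      by (simp add: cis_cnj mult.commute)
    also have "\<dots> = cnj (\<integral>t. g (of_real r * cis t) * cis (- (of_int (int n) * t)) \<partial>arclen)"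
      by (rule Bochner_Integration.integral_cnj)
    also have "\<dots> = cnj (taylor_coeff g n * of_real r ^ n)"
      using circle_fourier[OF g r, of "int n"] by simp
    finally show ?thesis .
  qed
  have "(\<lambda>n. taylor_coeff f n * of_real r ^ n * (\<integral>t. cis (of_int (int n) * t) * cnj (g (of_real r * cis t)) \<partial>arclen)) sums
      (\<integral>t. f (of_real r * cis t) * cnj (g (of_real r * cis t)) \<partial>arclen)"
    using B by (intro circle_mean_mult[OF f r, where B = B])
      (auto intro: measurable_compose[OF _ borel_measurable_cnj])
  then show ?thesis
    unfolding c by (simp add: mult_ac power_mult power2_eq_square power_mult_distrib)
qed

lemma circle_mean_sq:
  assumes "f holomorphic_on unit_disc" "0 \<le> r" "r < 1"
  shows "(\<lambda>n. (cmod (taylor_coeff f n))\<^sup>2 * r ^ (2 * n)) sums (\<integral>t. (cmod (f (of_real r * cis t)))\<^sup>2 \<partial>arclen)"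
proof -
  have "(\<lambda>n. Re (taylor_coeff f n * cnj (taylor_coeff f n) * of_real (r ^ (2 * n)))) sums
    Re (\<integral>t. f (of_real r * cis t) * cnj (f (of_real r * cis t)) \<partial>arclen)"
    by (intro sums_Re circle_parseval assms)
  then show ?thesis
    by (simp flip: complex_norm_square of_real_power of_real_mult)
qed

lemma h2_sqn_sums:
  assumes "f \<in> H2"
  shows "(\<lambda>n. (cmod (taylor_coeff f n))\<^sup>2) sums Re (h2_inner f f)"
  using sums_Re[OF ell2_sums[OF H2D(3)[OF assms] H2D(3)[OF assms]]] h2_inner_eq[OF assms assms]
  by (simp flip: complex_norm_square of_real_power)

text \<open>A sequence in place of the limit r -> 1, because dominated convergence and the
  extraction of weak limits are used for sequences.\<close>

definition radius :: "nat \<Rightarrow> real" where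
  "radius k = 1 - 1 / Suc (Suc k)"

lemma radius: "0 \<le> radius k" "radius k < 1" "0 < radius k"
  unfolding radius_def by (auto simp: field_simps)

lemma radius_tendsto: "radius \<longlonglongrightarrow> 1"
proof -
  have "(\<lambda>k. 1 - inverse (real (Suc (Suc k)))) \<longlonglongrightarrow> 1 - 0"
    by (intro tendsto_intros LIMSEQ_Suc[OF LIMSEQ_inverse_real_of_nat])
  then show ?thesis unfolding radius_def by (simp add: inverse_eq_divide)
qed

lemma radius_at_left: "filterlim radius (at_left 1) sequentially"
  using radius_tendsto radius(2) by (intro tendsto_imp_filterlim_at_left) auto

text \<open>For fixed n the factor r^(2n) tends to 1 and never exceeds 1, so the series of squared
  coefficients dominates and Tannery's theorem passes to the limit under the sum.\<close>

lemma circle_mean_sq_tendsto: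
  assumes f: "f \<in> H2"
  shows "(\<lambda>k. \<integral>t. (cmod (f (of_real (radius k) * cis t)))\<^sup>2 \<partial>arclen) \<longlonglongrightarrow> Re (h2_inner f f)"
proof -
  let ?a = "\<lambda>n k. (cmod (taylor_coeff f n))\<^sup>2 * radius k ^ (2 * n)"
  have "(\<lambda>k. \<Sum>n. ?a n k) \<longlonglongrightarrow> (\<Sum>n. (cmod (taylor_coeff f n))\<^sup>2)"
  proof (rule conjunct2[OF conjunct2[OF tannerys_theorem]])
    show "summable (\<lambda>n. (cmod (taylor_coeff f n))\<^sup>2)" using f unfolding H2_def by simp
    show "(\<lambda>k. ?a n k) \<longlonglongrightarrow> (cmod (taylor_coeff f n))\<^sup>2" for n
      using tendsto_mult[OF tendsto_const tendsto_power[OF radius_tendsto, of "2 * n"]] by simp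
    have "norm (?a n k) \<le> (cmod (taylor_coeff f n))\<^sup>2" for n k
      using radius[of k] by (auto simp: power_le_one intro!: mult_left_le)
    then show "\<forall>\<^sub>F (n, k) in sequentially \<times>\<^sub>F sequentially. norm (?a n k) \<le> (cmod (taylor_coeff f n))\<^sup>2"
      by (simp add: case_prod_unfold)
  qed simp
  then show ?thesis
    using circle_mean_sq[OF H2D(1)[OF f] radius(1,2)] h2_sqn_sums[OF f] by (simp add: sums_iff)
qed

text \<open>Parseval on smaller circles turns the pointwise bound into a bound for sums of squared
  coefficients. Only finitely many coefficients are kept while the radius tends to 1, so membership
  of the product in \<open>H2\<close> is an outcome of the estimate.\<close>

lemma bounded_mult_H2:
  assumes \<phi>: "\<phi> holomorphic_on unit_disc" "\<And>z. z \<in> unit_disc \<Longrightarrow> cmod (\<phi> z) \<le> M" and f: "f \<in> H2"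
  shows "(\<lambda>z. \<phi> z * f z) \<in> H2"
    "Re (h2_inner (\<lambda>z. \<phi> z * f z) (\<lambda>z. \<phi> z * f z)) \<le> M\<^sup>2 * Re (h2_inner f f)"
proof -
  let ?g = "\<lambda>z. \<phi> z * f z" and ?S = "M\<^sup>2 * Re (h2_inner f f)"
  have g: "?g holomorphic_on unit_disc" by (intro holomorphic_intros \<phi> H2D f)
  have le: "(\<Sum>n<N. (cmod (taylor_coeff ?g n))\<^sup>2) \<le> ?S" for N
  proof (rule LIMSEQ_le_const2)
    have "(\<lambda>k. \<Sum>n<N. (cmod (taylor_coeff ?g n))\<^sup>2 * radius k ^ (2 * n)) \<longlonglongrightarrow>
        (\<Sum>n<N. (cmod (taylor_coeff ?g n))\<^sup>2 * 1 ^ (2 * n))"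
      by (intro tendsto_intros radius_tendsto)
    then show "(\<lambda>k. \<Sum>n<N. (cmod (taylor_coeff ?g n))\<^sup>2 * radius k ^ (2 * n)) \<longlonglongrightarrow>
        (\<Sum>n<N. (cmod (taylor_coeff ?g n))\<^sup>2)" by simp
    have "(\<Sum>n<N. (cmod (taylor_coeff ?g n))\<^sup>2 * radius k ^ (2 * n)) \<le> ?S" for k
    proof -
      note sg = circle_mean_sq[OF g radius(1,2)[of k]]
      note sf = circle_mean_sq[OF H2D(1)[OF f] radius(1,2)[of k]]
      let ?I = "\<lambda>f. \<integral>t. (cmod (f (of_real (radius k) * cis t)))\<^sup>2 \<partial>arclen"
      have int: "integrable arclen (\<lambda>t. (cmod (h (of_real (radius k) * cis t)))\<^sup>2)"
        if h: "h holomorphic_on unit_disc" for h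
      proof -
        obtain B where B: "\<And>t. cmod (h (of_real (radius k) * cis t)) \<le> B"
          by (rule circle_bounded[OF h radius(1,2)[of k]]) blast
        note [measurable] = circle_measurable[OF h radius(1,2)[of k]]
        show ?thesis
          using B by (intro arclen.integrable_const_bound[of _ "B\<^sup>2"]) (auto intro!: power_mono)
      qed
      have "(\<Sum>n<N. (cmod (taylor_coeff ?g n))\<^sup>2 * radius k ^ (2 * n)) \<le> ?I ?g"
        using sum_le_suminf[OF sums_summable[OF sg], of "{..<N}"] sums_unique[OF sg] radius(1)[of k] by simp
      also have "\<dots> \<le> (\<integral>t. M\<^sup>2 * (cmod (f (of_real (radius k) * cis t)))\<^sup>2 \<partial>arclen)"
      proof (rule integral_mono)
        show "integrable arclen (\<lambda>t. M\<^sup>2 * (cmod (f (of_real (radius k) * cis t)))\<^sup>2)"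
          using int[OF H2D(1)[OF f]] by simp
        show "(cmod (?g (of_real (radius k) * cis t)))\<^sup>2 \<le> M\<^sup>2 * (cmod (f (of_real (radius k) * cis t)))\<^sup>2" for t
          using \<phi>(2)[OF circle_mem[OF radius(1,2), of k t]]
          by (auto simp: norm_mult power_mult_distrib intro!: mult_right_mono power_mono)
      qed (rule int[OF g])
      also have "\<dots> = M\<^sup>2 * ?I f" by simp
      also have "?I f \<le> Re (h2_inner f f)"
      proof (rule sums_le[OF _ sf h2_sqn_sums[OF f]])
        show "(cmod (taylor_coeff f n))\<^sup>2 * radius k ^ (2 * n) \<le> (cmod (taylor_coeff f n))\<^sup>2" for n
          using radius[of k] by (auto simp: power_le_one intro!: mult_left_le)
      qed
      finally show ?thesis by (simp add: mult_left_mono)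
    qed
    then show "\<exists>K. \<forall>k\<ge>K. (\<Sum>n<N. (cmod (taylor_coeff ?g n))\<^sup>2 * radius k ^ (2 * n)) \<le> ?S" by blast
  qed
  have sm: "summable (\<lambda>n. (cmod (taylor_coeff ?g n))\<^sup>2)"
    by (rule summableI_nonneg_bounded[OF _ le]) simp
  then show H: "?g \<in> H2" unfolding H2_def using g H2D(2)[OF f] by auto
  show "Re (h2_inner ?g ?g) \<le> ?S"
    using suminf_le_const[OF sm le] h2_sqn_sums[OF H] by (simp add: sums_iff)
qed

lemma kern_bounded:
  assumes "w \<in> unit_disc"
  shows "cmod (kern w z) \<le> 1 / (1 - cmod w)"
proof (cases "z \<in> unit_disc")
  case True
  have "cmod w * cmod z \<le> cmod w * 1" using True by (intro mult_left_mono) auto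
  then have "1 - cmod w \<le> cmod (1 - cnj w * z)"
    using norm_triangle_ineq2[of 1 "cnj w * z"] by (simp add: norm_mult)
  then show ?thesis using True assms by (simp add: kern_def norm_divide frac_le)
qed (use assms in \<open>simp add: kern_def\<close>)

section \<open>Inner functions as isometric multipliers of the Hardy space\<close>

locale nonconstant_inner =
  fixes u :: "complex \<Rightarrow> complex"
  assumes inner: "inner_function u" and nonconstant: "\<not> u constant_on unit_disc"
begin

lemma u_holo: "u holomorphic_on unit_disc"
  using inner unfolding inner_function_def by simp

lemma u_mult_H2: "f \<in> H2 \<Longrightarrow> (\<lambda>z. u z * f z) \<in> H2"
  and u_mult_bound: "\<exists>M. \<forall>f\<in>H2. H2.sqn (\<lambda>z. u z * f z) \<le> M * H2.sqn f"
proof -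
  obtain M where M: "\<And>z. z \<in> unit_disc \<Longrightarrow> cmod (u z) \<le> M"
    using inner unfolding inner_function_def bounded_iff by blast
  note * = bounded_mult_H2[OF u_holo M]
  show "f \<in> H2 \<Longrightarrow> (\<lambda>z. u z * f z) \<in> H2" using *(1) by blast
  show "\<exists>M. \<forall>f\<in>H2. H2.sqn (\<lambda>z. u z * f z) \<le> M * H2.sqn f" using *(2) by blast
qed

text \<open>For bounded \<open>g\<close> the means of \<open>\<bar>u g\<bar>\<^sup>2 - \<bar>g\<bar>\<^sup>2\<close> over circles of radius tending to 1 tend to 0 by
  dominated convergence, because the radial limits of \<open>u\<close> are unimodular.\<close>

lemma u_isometry_bounded:
  assumes g: "g \<in> H2" and C: "\<And>z. z \<in> unit_disc \<Longrightarrow> cmod (g z) \<le> C"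
  shows "H2.sqn (\<lambda>z. u z * g z) = H2.sqn g"
proof -
  obtain M where M: "\<And>z. z \<in> unit_disc \<Longrightarrow> cmod (u z) \<le> M"
    using inner unfolding inner_function_def bounded_iff by blast
  let ?z = "\<lambda>k t. of_real (radius k) * cis t"
  let ?D = "\<lambda>k t. (cmod (u (?z k t) * g (?z k t)))\<^sup>2 - (cmod (g (?z k t)))\<^sup>2"
  have zin: "?z k t \<in> unit_disc" for k t using circle_mem[OF radius(1,2)] .
  note [measurable] = circle_measurable[OF u_holo radius(1,2)] circle_measurable[OF H2D(1)[OF g] radius(1,2)]
  have C0: "C \<ge> 0" using order_trans[OF norm_ge_zero C[of 0]] by simp
  have M0: "M \<ge> 0" using order_trans[OF norm_ge_zero M[of 0]] by simp
  have Deq: "?D k t = ((cmod (u (?z k t)))\<^sup>2 - 1) * (cmod (g (?z k t)))\<^sup>2" for k t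
    by (simp add: norm_mult power_mult_distrib algebra_simps)
  have Dbd: "\<bar>(cmod (u (?z k t)))\<^sup>2 - 1\<bar> \<le> M\<^sup>2 + 1" for k t
    using power_mono[OF M[OF zin[of k t]] norm_ge_zero, of 2] zero_le_power2[of "cmod (u (?z k t))"]
    unfolding abs_le_iff by linarith
  have gbd: "(cmod (g (?z k t)))\<^sup>2 \<le> C\<^sup>2" for k t
    using C[OF zin] by (intro power_mono) auto
  have "(\<lambda>k. \<integral>t. ?D k t \<partial>arclen) \<longlonglongrightarrow> (\<integral>t. 0 \<partial>arclen)"
  proof (rule integral_dominated_convergence[where w = "\<lambda>_. (M\<^sup>2 + 1) * C\<^sup>2"])
    have "AE t in arclen. \<exists>l. ((\<lambda>r. u (of_real r * cis t)) \<longlongrightarrow> l) (at_left (1::real)) \<and> cmod l = 1"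
      using inner unfolding inner_function_def by (intro AE_arclen) simp
    then show "AE t in arclen. (\<lambda>k. ?D k t) \<longlonglongrightarrow> 0"
    proof eventually_elim
      fix t assume "\<exists>l. ((\<lambda>r. u (of_real r * cis t)) \<longlongrightarrow> l) (at_left (1::real)) \<and> cmod l = 1"
      then obtain l where l: "((\<lambda>r. u (of_real r * cis t)) \<longlongrightarrow> l) (at_left 1)" "cmod l = 1" by blast
      have "(\<lambda>k. u (?z k t)) \<longlonglongrightarrow> l" using filterlim_compose[OF l(1) radius_at_left] .
      then have "(\<lambda>k. (cmod (u (?z k t)))\<^sup>2 - 1) \<longlonglongrightarrow> (cmod l)\<^sup>2 - 1" by (intro tendsto_intros)
      then have z: "(\<lambda>k. (cmod (u (?z k t)))\<^sup>2 - 1) \<longlonglongrightarrow> 0" using l(2) by simp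
      show "(\<lambda>k. ?D k t) \<longlonglongrightarrow> 0"
      proof (rule Lim_null_comparison)
        show "\<forall>\<^sub>F k in sequentially. norm (?D k t) \<le> \<bar>(cmod (u (?z k t)))\<^sup>2 - 1\<bar> * C\<^sup>2"
          unfolding Deq using gbd by (simp add: abs_mult mult_left_mono)
        show "(\<lambda>k. \<bar>(cmod (u (?z k t)))\<^sup>2 - 1\<bar> * C\<^sup>2) \<longlonglongrightarrow> 0"
          using tendsto_rabs_zero[OF z] by (rule tendsto_mult_left_zero)
      qed
    qed
    show "AE t in arclen. norm (?D k t) \<le> (M\<^sup>2 + 1) * C\<^sup>2" for k
      unfolding Deq using Dbd gbd M0 by (intro AE_I2) (auto simp: abs_mult intro!: mult_mono)
  qed auto
  moreover have "(\<lambda>k. \<integral>t. ?D k t \<partial>arclen) \<longlonglongrightarrow> H2.sqn (\<lambda>z. u z * g z) - H2.sqn g"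
  proof -
    have i2: "integrable arclen (\<lambda>t. (cmod (g (?z k t)))\<^sup>2)" for k
      using gbd by (intro arclen.integrable_const_bound[of _ "C\<^sup>2"]) auto
    have "integrable arclen (\<lambda>t. (cmod (u (?z k t) * g (?z k t)))\<^sup>2)" for k
    proof (rule arclen.integrable_const_bound[of _ "(M * C)\<^sup>2"])
      show "AE t in arclen. norm ((cmod (u (?z k t) * g (?z k t)))\<^sup>2) \<le> (M * C)\<^sup>2"
        using M[OF zin] C[OF zin] M0
        by (intro AE_I2) (auto simp: norm_mult intro!: power_mono mult_mono)
    qed measurable
    then have "(\<integral>t. ?D k t \<partial>arclen) = (\<integral>t. (cmod (u (?z k t) * g (?z k t)))\<^sup>2 \<partial>arclen) - (\<integral>t. (cmod (g (?z k t)))\<^sup>2 \<partial>arclen)" for k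
      using i2 by (rule Bochner_Integration.integral_diff)
    then show ?thesis
      using tendsto_diff[OF circle_mean_sq_tendsto[OF u_mult_H2[OF g]] circle_mean_sq_tendsto[OF g]] by simp
  qed
  ultimately show ?thesis using LIMSEQ_unique by fastforce
qed

text \<open>Approximation by bounded functions, for which the identity is known. They are dense
  because the Szego kernels are bounded and a function orthogonal to all of these vanishes;
  boundedness of multiplication by u carries the norms to the limit.\<close>

lemma u_isometry:
  assumes g: "g \<in> H2"
  shows "H2.sqn (\<lambda>z. u z * g z) = H2.sqn g"
proof -
  define S where "S = {g \<in> H2. \<exists>C. \<forall>z\<in>unit_disc. cmod (g z) \<le> C}"
  have "(\<lambda>x. c * f x + h x) \<in> S" if "f \<in> S" "h \<in> S" for c f h
  proof -
    obtain C D where "\<forall>z\<in>unit_disc. cmod (f z) \<le> C" "\<forall>z\<in>unit_disc. cmod (h z) \<le> D"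
      using \<open>f \<in> S\<close> \<open>h \<in> S\<close> unfolding S_def by auto
    then have "\<forall>z\<in>unit_disc. cmod (c * f z + h z) \<le> cmod c * C + D"
      by (metis add_mono mult_left_mono norm_ge_zero norm_mult norm_triangle_le)
    then show ?thesis using that H2_lin(1) unfolding S_def by blast
  qed
  then have "H2.subspace_of S" unfolding H2.subspace_of_def using zero_H2 by (auto simp: S_def)
  then obtain F m where F: "\<And>n. F n \<in> S" "H2.conv F m" "\<And>s. s \<in> S \<Longrightarrow> h2_inner (\<lambda>z. g z - m z) s = 0"
    using H2.approx_projection[OF _ g] by metis
  have m: "m \<in> H2" using F(2) unfolding H2.conv_def by simp
  have "kern w \<in> S" if "w \<in> unit_disc" for w
    using kern_bounded[OF that] kern_H2(1)[OF that] unfolding S_def by auto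
  then have "g w - m w = 0" if "w \<in> unit_disc" for w
    using F(3) h2_inner_kern[OF H2_diff(1)[OF g m] that] that by simp
  then have "m z = g z" for z using H2D(2)[OF g, of z] H2D(2)[OF m, of z] by (cases "z \<in> unit_disc") auto
  then have "m = g" by blast
  then have Fg: "H2.conv F g" using F(2) by simp
  then have FH: "F n \<in> H2" for n unfolding H2.conv_def by simp
  obtain M where M: "\<And>f. f \<in> H2 \<Longrightarrow> H2.sqn (\<lambda>z. u z * f z) \<le> M * H2.sqn f" using u_mult_bound by blast
  have "H2.conv (\<lambda>n z. u z * F n z) (\<lambda>z. u z * g z)"
    unfolding H2.conv_def
  proof (intro conjI allI)
    show "(\<lambda>n. H2.sqn (\<lambda>x. u x * F n x - u x * g x)) \<longlonglongrightarrow> 0"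
    proof (rule tendsto_sandwich[of "\<lambda>_. 0" _ _ "\<lambda>n. M * H2.sqn (\<lambda>x. F n x - g x)"])
      show "\<forall>\<^sub>F n in sequentially. 0 \<le> H2.sqn (\<lambda>x. u x * F n x - u x * g x)"
        using H2.ip_nonneg u_mult_H2 FH g H2_diff(1) by (intro always_eventually allI) blast
      show "\<forall>\<^sub>F n in sequentially. H2.sqn (\<lambda>x. u x * F n x - u x * g x) \<le> M * H2.sqn (\<lambda>x. F n x - g x)"
        using M[OF H2_diff(1)[OF FH g]] by (intro always_eventually allI) (simp add: right_diff_distrib)
      show "(\<lambda>n. M * H2.sqn (\<lambda>x. F n x - g x)) \<longlonglongrightarrow> 0"
        using Fg unfolding H2.conv_def by (auto intro: tendsto_mult_right_zero)
    qed simp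
  qed (use u_mult_H2 FH g in auto)
  moreover have "H2.sqn (\<lambda>z. u z * F n z) = H2.sqn (F n)" for n
    using u_isometry_bounded F(1)[of n] unfolding S_def by blast
  ultimately show ?thesis
    using H2.conv_sqn[of "\<lambda>n z. u z * F n z"] H2.conv_sqn[OF Fg] LIMSEQ_unique by fastforce
qed

lemma u_inner:
  assumes "f \<in> H2" "g \<in> H2"
  shows "h2_inner (\<lambda>z. u z * f z) (\<lambda>z. u z * g z) = h2_inner f g"
  using semi_hilbert_polarization[OF semi_hilbert_H2 semi_hilbert_H2, of "\<lambda>f z. u z * f z"]
    assms u_mult_H2 u_isometry by (simp add: algebra_simps)

text \<open>\<open>inner_function\<close> only provides some bound for u. By the isometry all powers
  of u have the same norm, and this norm controls their values u(w)^n at w, which excludes |u(w)| >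
  1.\<close>

lemma u_le_1:
  assumes w: "w \<in> unit_disc"
  shows "cmod (u w) \<le> 1"
proof (rule ccontr)
  assume "\<not> ?thesis"
  then have gt: "cmod (u w) ^ 2 > 1" by (simp add: one_less_power)
  define p where "p n = (\<lambda>z. u z ^ n * kern 0 z)" for n
  have p: "p n \<in> H2 \<and> H2.sqn (p n) = H2.sqn (kern 0)" for n
  proof (induction n)
    case 0
    then show ?case using kern_H2(1)[of 0] unfolding p_def by simp
  next
    case (Suc n)
    have "p (Suc n) = (\<lambda>z. u z * p n z)" unfolding p_def by (auto simp: mult_ac)
    then show ?case using u_mult_H2 u_isometry Suc by simp
  qed
  have "(cmod (u w) ^ 2) ^ n \<le> H2.sqn (kern 0) * H2.sqn (kern w)" for n
  proof -
    have "h2_inner (p n) (kern w) = u w ^ n"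
      using h2_inner_kern p w unfolding p_def kern_def by simp
    then show ?thesis
      using H2.Cauchy_Schwarz[of "p n" "kern w"] p kern_H2(1)[OF w]
      by (simp add: norm_power mult.commute flip: power_mult)
  qed
  moreover obtain n where "H2.sqn (kern 0) * H2.sqn (kern w) < (cmod (u w) ^ 2) ^ n"
    using real_arch_pow[OF gt] by blast
  ultimately show False by (meson not_le)
qed

text \<open>The maximum principle rules out equality. Strictness keeps denominators such as 1 -
  \<alpha> cnj (u 0) and 1 - cnj \<beta> u nonzero for unimodular parameters.\<close>

lemma u_lt_1:
  assumes w: "w \<in> unit_disc"
  shows "cmod (u w) < 1"
proof (rule ccontr)
  assume "\<not> ?thesis"
  then have "cmod (u z) \<le> cmod (u w)" if "z \<in> unit_disc" for z using u_le_1[OF that] by simp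
  then have "u constant_on unit_disc"
    by (intro maximum_modulus_principle[OF u_holo _ _ _ _ w]) auto
  then show False using nonconstant by simp
qed

end

section \<open>Model spaces and perturbed shifts\<close>

lemma H2_eqI:
  assumes "f \<in> H2" "g \<in> H2" "\<And>z. z \<in> unit_disc \<Longrightarrow> f z = g z"
  shows "f = g"
proof
  fix z show "f z = g z"
    using assms(3) H2D(2)[OF assms(1)] H2D(2)[OF assms(2)] by (cases "z \<in> unit_disc") auto
qed

lemma H2_eqI_taylor:
  assumes "f \<in> H2" "g \<in> H2" "taylor_coeff f = taylor_coeff g"
  shows "f = g"
  using assms H2D(4)[of f] H2D(4)[of g] by (intro H2_eqI) (auto intro: sums_unique2)

lemma k0_conj_mem_H2: "f \<in> H2 \<Longrightarrow> k0_conj f \<in> H2"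
  using k0_conj_H2(1)[of f] unfolding H2_def by simp

lemma times_z_k0_conj:
  assumes "f \<in> H2" "f 0 = 0"
  shows "(\<lambda>z. z * k0_conj f z) = f"
  using assms k0_conj_times_z[of _ f] by (intro H2_eqI times_z_H2 k0_conj_mem_H2) auto

lemma kern_0_inner: "f \<in> H2 \<Longrightarrow> h2_inner f (kern 0) = f 0" "f \<in> H2 \<Longrightarrow> h2_inner (kern 0) f = cnj (f 0)"
  using h2_inner_kern[of f 0] H2.ip_sym[of f "kern 0"] kern_H2(1)[of 0] by auto

lemma one_minus_cnj_mult_nz:
  assumes "cmod a < 1" "cmod b \<le> 1"
  shows "1 - cnj a * b \<noteq> 0"
proof
  assume "1 - cnj a * b = 0"
  then have "cmod (cnj a * b) = 1" by (metis eq_iff_diff_eq_0 norm_one)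
  moreover have "cmod a * cmod b \<le> cmod a * 1" using assms by (intro mult_left_mono) auto
  ultimately show False using assms(1) by (simp add: norm_mult)
qed

context nonconstant_inner
begin

abbreviation K :: "(complex \<Rightarrow> complex) set" where
  "K \<equiv> model_space u"

lemma K_H2: "f \<in> K \<Longrightarrow> f \<in> H2"
  unfolding model_space_def by simp

lemma K_orth: "f \<in> K \<Longrightarrow> g \<in> H2 \<Longrightarrow> h2_inner f (\<lambda>z. u z * g z) = 0"
  unfolding model_space_def by simp

lemma K_orth': "f \<in> K \<Longrightarrow> g \<in> H2 \<Longrightarrow> h2_inner (\<lambda>z. u z * g z) f = 0"
  using K_orth[of f g] H2.ip_sym[of f "\<lambda>z. u z * g z"] K_H2 u_mult_H2 by simp

lemma K_I: "f \<in> H2 \<Longrightarrow> (\<And>g. g \<in> H2 \<Longrightarrow> h2_inner f (\<lambda>z. u z * g z) = 0) \<Longrightarrow> f \<in> K"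
  unfolding model_space_def by simp

lemma semi_hilbert_K: "semi_hilbert K h2_inner"
proof (rule H2.closed_subspace_semi_hilbert)
  show "H2.subspace_of K"
    unfolding H2.subspace_of_def
  proof (intro conjI ballI allI)
    show "K \<subseteq> H2" using K_H2 by blast
    show "(\<lambda>_. 0) \<in> K" using zero_H2(1) H2.ip_zero u_mult_H2 by (intro K_I) auto
    show "(\<lambda>x. c * f x + g x) \<in> K" if "f \<in> K" "g \<in> K" for f g c
      using that K_H2 K_orth u_mult_H2 by (intro K_I H2_lin) (auto simp: H2.ip_lin)
  qed
  show "f \<in> K" if F: "\<And>n. F n \<in> K" "H2.conv F f" for F f
  proof (rule K_I)
    show "f \<in> H2" using F(2) unfolding H2.conv_def by simp
    show "h2_inner f (\<lambda>z. u z * g z) = 0" if "g \<in> H2" for g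
      using H2.conv_ip[OF F(2) u_mult_H2[OF that]] K_orth[OF F(1) that]
      by (simp add: LIMSEQ_const_iff)
  qed
qed

end

sublocale nonconstant_inner \<subseteq> K: semi_hilbert "model_space u" h2_inner
  by (rule semi_hilbert_K)

context nonconstant_inner
begin

text \<open>The reproducing kernel of the model space: the Szego kernel minus its component in u
  \<open>H2\<close>. Written through \<open>kern\<close>, its membership and inner products follow
  from those of the Szego kernel.\<close>

definition ku :: "complex \<Rightarrow> complex \<Rightarrow> complex" where
  "ku w = (\<lambda>z. kern w z - cnj (u w) * (u z * kern w z))"

lemma ku_eval: "z \<in> unit_disc \<Longrightarrow> ku w z = (1 - cnj (u w) * u z) / (1 - cnj w * z)"
  unfolding ku_def kern_def by (simp add: diff_divide_distrib)

lemma ku_K: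
  assumes w: "w \<in> unit_disc"
  shows "ku w \<in> K"
proof (rule K_I)
  note k = kern_H2(1)[OF w] u_mult_H2[OF kern_H2(1)[OF w]]
  show "ku w \<in> H2" unfolding ku_def by (intro H2_diff H2.scale_mem k)
  fix g assume g: "g \<in> H2"
  have "h2_inner (kern w) (\<lambda>z. u z * g z) = cnj (u w * g w)"
    using h2_inner_kern[OF u_mult_H2[OF g] w] H2.ip_sym[OF u_mult_H2[OF g] k(1)] by simp
  moreover have "h2_inner (\<lambda>z. u z * kern w z) (\<lambda>z. u z * g z) = cnj (g w)"
    using u_inner[OF k(1) g] h2_inner_kern[OF g w] H2.ip_sym[OF g k(1)] by simp
  ultimately show "h2_inner (ku w) (\<lambda>z. u z * g z) = 0"
    unfolding ku_def using k g u_mult_H2 by (simp add: H2.ips H2.mems)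
qed

lemma ku_inner:
  assumes "f \<in> K" "w \<in> unit_disc"
  shows "h2_inner f (ku w) = f w"
  unfolding ku_def
  using assms K_H2 kern_H2(1) u_mult_H2 K_orth h2_inner_kern by (simp add: H2.ips H2.mems)

lemma K_eqI:
  assumes "f \<in> K" "g \<in> K" "\<And>h. h \<in> K \<Longrightarrow> h2_inner f h = h2_inner g h"
  shows "f = g"
  using assms(3)[OF ku_K] ku_inner assms(1,2) by (intro H2_eqI K_H2) auto

lemma K_definite: "f \<in> K \<Longrightarrow> Re (h2_inner f f) = 0 \<Longrightarrow> f = (\<lambda>_. 0)"
  using H2_definite K_H2 by blast

text \<open>u with its values off the disc reset to 0, as the product of u with the constant
  function. The values of u off the disc are arbitrary, so u itself need not be an element of
  \<open>H2\<close>.\<close>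

definition u1 :: "complex \<Rightarrow> complex" where
  "u1 = (\<lambda>z. u z * kern 0 z)"

lemma u1_eval: "z \<in> unit_disc \<Longrightarrow> u1 z = u z"
  unfolding u1_def kern_def by simp

lemma u1_H2: "u1 \<in> H2"
  unfolding u1_def using kern_H2(1) u_mult_H2 by simp

lemma taylor_u1: "taylor_coeff u1 = taylor_coeff u"
  by (rule taylor_coeff_cong[OF u_holo u1_eval])

lemma u1_orth: "f \<in> K \<Longrightarrow> h2_inner f u1 = 0" "f \<in> K \<Longrightarrow> h2_inner u1 f = 0"
  unfolding u1_def using K_orth K_orth' kern_H2(1) by auto

lemma u1_sqn: "h2_inner u1 u1 = 1"
  unfolding u1_def using u_inner[of "kern 0" "kern 0"] kern_H2(1)[of 0] kern_0_inner(1)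
  by (simp add: kern_def)

lemma kt_H2: "k0_conj u \<in> H2" and kt_eq: "k0_conj u1 = k0_conj u"
proof -
  have s: "summable (\<lambda>n. (cmod (taylor_coeff u n))\<^sup>2)"
    using u1_H2 taylor_u1 unfolding H2_def by simp
  show k: "k0_conj u \<in> H2" using k0_conj_H2(1)[OF u_holo s] .
  show "k0_conj u1 = k0_conj u"
    using k0_conj_H2(2)[OF u_holo s] k0_conj_H2(2)[OF H2D(1)[OF u1_H2]] s taylor_u1
    by (intro H2_eqI_taylor k k0_conj_mem_H2 u1_H2) simp
qed

text \<open>For g in the model space this number is the coefficient of zg along u, and u is the only
  direction in which zg leaves that space.\<close>

lemma inner_kt: "g \<in> H2 \<Longrightarrow> h2_inner g (k0_conj u) = h2_inner (\<lambda>z. z * g z) u1"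
  using h2_inner_times_z[OF _ u1_H2] kt_eq by simp

text \<open>u \<open>H2\<close> is invariant under multiplication by z, so its orthogonal complement
  is invariant under the adjoint, the backward shift.\<close>

lemma bshift_K:
  assumes "f \<in> K"
  shows "k0_conj f \<in> K"
proof (rule K_I[OF k0_conj_mem_H2[OF K_H2[OF assms]]])
  fix g assume g: "g \<in> H2"
  have "h2_inner (\<lambda>z. u z * g z) (k0_conj f) = h2_inner (\<lambda>z. u z * (z * g z)) f"
    using h2_inner_times_z[OF u_mult_H2[OF g] K_H2[OF assms]] by (simp add: mult.left_commute)
  also have "\<dots> = 0" using K_orth'[OF assms times_z_H2(1)[OF g]] .
  finally show "h2_inner (k0_conj f) (\<lambda>z. u z * g z) = 0"
    using H2.ip_sym[OF u_mult_H2[OF g] k0_conj_mem_H2[OF K_H2[OF assms]]] by simp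
qed

lemma kt_K: "k0_conj u \<in> K"
proof (rule K_I[OF kt_H2])
  fix g assume g: "g \<in> H2"
  have "h2_inner (\<lambda>z. u z * g z) (k0_conj u) = h2_inner (\<lambda>z. u z * (z * g z)) u1"
    using inner_kt[OF u_mult_H2[OF g]] by (simp add: mult.left_commute)
  also have "\<dots> = h2_inner (\<lambda>z. z * g z) (kern 0)"
    unfolding u1_def by (intro u_inner times_z_H2 g kern_H2) simp
  also have "\<dots> = 0" using kern_0_inner(1)[OF times_z_H2(1)[OF g]] by simp
  finally show "h2_inner (k0_conj u) (\<lambda>z. u z * g z) = 0"
    using H2.ip_sym[OF u_mult_H2[OF g] kt_H2] by simp
qed

lemma kt_sqn: "h2_inner (k0_conj u) (k0_conj u) = 1 - u 0 * cnj (u 0)"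
proof -
  have "(\<lambda>z. z * k0_conj u z) = (\<lambda>z. u1 z - u 0 * kern 0 z)"
    using k0_conj_times_z[of _ u] u1_eval
    by (intro H2_eqI H2_diff H2.scale_mem times_z_H2 kt_H2 u1_H2 kern_H2) (auto simp: kern_def)
  then have "h2_inner (k0_conj u) (k0_conj u) = h2_inner (\<lambda>z. u1 z - u 0 * kern 0 z) u1"
    using inner_kt[OF kt_H2] by simp
  also have "\<dots> = 1 - u 0 * cnj (u 0)"
    using u1_H2 kern_H2(1)[of 0] u1_sqn kern_0_inner(2)[OF u1_H2] u1_eval[of 0]
    by (simp add: H2.ips H2.mems)
  finally show ?thesis .
qed

lemma u0_lt_1: "(cmod (u 0))\<^sup>2 < 1"
  using u_lt_1[of 0] by (simp add: abs_square_less_1)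

lemma kt_sqn_pos: "Re (h2_inner (k0_conj u) (k0_conj u)) > 0"
  unfolding kt_sqn using u0_lt_1 by (simp flip: complex_norm_square of_real_power)

lemma k0_eq: "k0 u = ku 0"
  by (intro ext) (auto simp: k0_def ku_def kern_def)

lemma ku_0_at_0: "ku 0 0 \<noteq> 0"
  using u0_lt_1 complex_norm_square[of "u 0"] by (auto simp: ku_eval mult.commute simp flip: of_real_power)

lemma K_nonzero: "\<exists>f\<in>K. f \<noteq> (\<lambda>_. 0)"
  using ku_K[of 0] ku_0_at_0 by force

lemma denom_nz: "cmod \<alpha> \<le> 1 \<Longrightarrow> 1 - \<alpha> * cnj (u 0) \<noteq> 0"
  using one_minus_cnj_mult_nz[OF u_lt_1[of 0], of \<alpha>] by (simp add: mult.commute)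

text \<open>zg is orthogonal to zu \<open>H2\<close>, because multiplication by z is isometric and g
  is orthogonal to u \<open>H2\<close>. Splitting h into h(0) and a multiple of z shows that u
  \<open>H2\<close> is the span of u plus zu \<open>H2\<close>, so the projection only has to remove
  the component along u.\<close>

lemma compressed_shift_eq:
  assumes g: "g \<in> K"
  shows "compressed_shift u g = (\<lambda>z. z * g z - h2_inner g (k0_conj u) * u1 z)"
    and "compressed_shift u g \<in> K"
proof -
  let ?G = "\<lambda>z. z * g z - h2_inner g (k0_conj u) * u1 z"
  note zg = times_z_H2(1)[OF K_H2[OF g]]
  have G: "?G \<in> K"
  proof (rule K_I)
    show "?G \<in> H2" by (intro H2_diff H2.scale_mem zg u1_H2)
    fix h assume h: "h \<in> H2"
    have hd: "(\<lambda>z. u z * h z) = (\<lambda>z. h 0 * u1 z + u z * (z * k0_conj h z))"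
    proof (intro H2_eqI H2_lin u1_H2 u_mult_H2 times_z_H2 k0_conj_mem_H2 h)
      fix z assume z: "z \<in> unit_disc"
      have "u z * h z = u z * (h 0 + z * k0_conj h z)" using k0_conj_times_z[OF z, of h] by simp
      then show "u z * h z = h 0 * u1 z + u z * (z * k0_conj h z)"
        using u1_eval[OF z] by (simp add: algebra_simps)
    qed
    have "h2_inner (\<lambda>z. z * g z) (\<lambda>z. z * (u z * k0_conj h z)) = h2_inner g (\<lambda>z. u z * k0_conj h z)"
      by (intro h2_inner_times_z_both K_H2 g u_mult_H2 k0_conj_mem_H2 h)
    also have "\<dots> = 0" by (intro K_orth g k0_conj_mem_H2 h)
    finally have "h2_inner (\<lambda>z. z * g z) (\<lambda>z. u z * (z * k0_conj h z)) = 0"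
      by (simp add: mult.left_commute)
    then have "h2_inner (\<lambda>z. z * g z) (\<lambda>z. u z * h z) = cnj (h 0) * h2_inner g (k0_conj u)"
      unfolding hd using zg u1_H2 u_mult_H2[OF times_z_H2(1)[OF k0_conj_mem_H2[OF h]]] inner_kt[OF K_H2[OF g]]
      by (simp add: H2.ips H2.mems)
    moreover have "h2_inner u1 (\<lambda>z. u z * h z) = cnj (h 0)"
      unfolding u1_def using u_inner[of "kern 0" h] kern_H2(1)[of 0] h kern_0_inner(2)[OF h] by simp
    ultimately show "h2_inner ?G (\<lambda>z. u z * h z) = 0"
      using zg u1_H2 u_mult_H2[OF h] by (simp add: H2.ips H2.mems)
  qed
  have GH: "?G \<in> H2" using G K_H2 by blast
  have "orth_proj K (\<lambda>z. z * g z) = ?G"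
    unfolding orth_proj_def
  proof (rule the_equality)
    have "h2_inner (\<lambda>z. z * g z - ?G z) h = 0" if "h \<in> K" for h
      using u1_orth(2)[OF that] u1_H2 K_H2[OF that] by (simp add: H2.ips)
    then show "?G \<in> K \<and> (\<forall>h\<in>K. h2_inner (\<lambda>z. z * g z - ?G z) h = 0)" using G by blast
    fix G' assume G': "G' \<in> K \<and> (\<forall>h\<in>K. h2_inner (\<lambda>z. z * g z - G' z) h = 0)"
    show "G' = ?G"
    proof (rule K_eqI)
      fix h assume h: "h \<in> K"
      have "h2_inner (\<lambda>z. z * g z) h = h2_inner G' h"
        using G' h H2.ip_diff[OF zg, of G' h] K_H2[of G'] K_H2[OF h] by simp
      then show "h2_inner G' h = h2_inner ?G h"
        using u1_orth(2)[OF h] zg u1_H2 K_H2[OF h] by (simp add: H2.ips H2.mems)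
    qed (use G G' in auto)
  qed
  then show "compressed_shift u g = ?G" "compressed_shift u g \<in> K"
    unfolding compressed_shift_def using G by auto
qed

text \<open>The projection term -u of the compressed shift merges with the rank one term: \<alpha>
  (1 - cnj (u 0) u) - (1 - \<alpha> cnj (u 0)) u = \<alpha> - u. One correction of zg thus covers
  every \<alpha> in the closed disc.\<close>

definition pshift :: "complex \<Rightarrow> (complex \<Rightarrow> complex) \<Rightarrow> (complex \<Rightarrow> complex)" where
  "pshift \<alpha> g = (\<lambda>z. z * g z +
     (h2_inner g (k0_conj u) / (1 - \<alpha> * cnj (u 0))) * (\<alpha> * kern 0 z - u1 z))"

lemma pshift_vector_H2: "(\<lambda>z. \<alpha> * kern 0 z - u1 z) \<in> H2"
  by (intro H2_diff H2.scale_mem kern_H2 u1_H2) simp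

lemma pshift_H2: "g \<in> H2 \<Longrightarrow> pshift \<alpha> g \<in> H2"
  unfolding pshift_def by (intro H2.add_mem H2.scale_mem times_z_H2 pshift_vector_H2)

lemma pshift_alt:
  assumes "g \<in> K" "cmod \<alpha> \<le> 1"
  shows "pshift \<alpha> g = (\<lambda>z. compressed_shift u g z +
    (\<alpha> / (1 - \<alpha> * cnj (u 0)) * h2_inner g (k0_conj u)) * ku 0 z)"
proof (rule H2_eqI)
  show "pshift \<alpha> g \<in> H2" using pshift_H2 K_H2 assms(1) by blast
  show "(\<lambda>z. compressed_shift u g z + (\<alpha> / (1 - \<alpha> * cnj (u 0)) * h2_inner g (k0_conj u)) * ku 0 z) \<in> H2"
    using compressed_shift_eq(2)[OF assms(1)] K_H2 ku_K by (intro H2.add_mem H2.scale_mem) auto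
  fix z :: complex assume z: "z \<in> unit_disc"
  show "pshift \<alpha> g z = compressed_shift u g z + (\<alpha> / (1 - \<alpha> * cnj (u 0)) * h2_inner g (k0_conj u)) * ku 0 z"
    unfolding compressed_shift_eq(1)[OF assms(1)] pshift_def ku_eval[OF z]
    using denom_nz[OF assms(2)] u1_eval[OF z] z by (simp add: kern_def field_simps)
qed

lemma pshift_K:
  assumes "g \<in> K" "cmod \<alpha> \<le> 1"
  shows "pshift \<alpha> g \<in> K"
  unfolding pshift_alt[OF assms]
  by (intro K.add_mem K.scale_mem compressed_shift_eq(2) assms ku_K) simp

lemma perturbed_shift_eq:
  assumes "cmod \<alpha> \<le> 1"
  shows "perturbed_shift u \<alpha> = (\<lambda>g. if g \<in> K then Some (pshift \<alpha> g) else None)"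
  unfolding perturbed_shift_def rank_one_def k0_eq
  by (intro ext) (auto simp: pshift_alt[OF _ assms] mult.assoc)

lemma pshift_lin:
  assumes "f \<in> K" "g \<in> K"
  shows "pshift \<alpha> (\<lambda>z. c * f z + g z) = (\<lambda>z. c * pshift \<alpha> f z + pshift \<alpha> g z)"
  unfolding pshift_def K.ip_lin[OF assms kt_K]
  by (intro ext) (simp add: algebra_simps add_divide_distrib)

text \<open>This computes the defect operator, the identity minus adjoint times operator, as a
  multiple of the rank one operator of \<open>k0_conj u\<close> with itself. The factor 1 -
  |\<alpha>|^2 makes it vanish for unimodular \<alpha> and have rank exactly one inside the
  disc.\<close>

lemma pshift_inner:
  assumes f: "f \<in> K" and g: "g \<in> K" and \<alpha>: "cmod \<alpha> \<le> 1"
  shows "h2_inner (pshift \<alpha> f) (pshift \<alpha> g) = h2_inner f g -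
    of_real ((1 - (cmod \<alpha>)\<^sup>2) / (cmod (1 - \<alpha> * cnj (u 0)))\<^sup>2) *
      h2_inner f (k0_conj u) * cnj (h2_inner g (k0_conj u))"
proof -
  define d where "d = 1 - \<alpha> * cnj (u 0)"
  define v where "v = (\<lambda>z. \<alpha> * kern 0 z - u1 z)"
  let ?s = "h2_inner f (k0_conj u)" and ?t = "h2_inner g (k0_conj u)"
  have "d \<noteq> 0" unfolding d_def by (rule denom_nz[OF \<alpha>])
  then have d0: "d \<noteq> 0" "cnj d \<noteq> 0" by auto
  note zf = times_z_H2(1)[OF K_H2[OF f]] and zg = times_z_H2(1)[OF K_H2[OF g]]
  note k0 = kern_H2(1)[of 0, simplified] 
  have v: "v \<in> H2" unfolding v_def by (rule pshift_vector_H2)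
  have zv: "h2_inner (\<lambda>z. z * h z) v = - h2_inner h (k0_conj u)" if h: "h \<in> K" for h
    unfolding v_def using times_z_H2(1)[OF K_H2[OF h]] k0 u1_H2 inner_kt[OF K_H2[OF h]]
      kern_0_inner(1)[OF times_z_H2(1)[OF K_H2[OF h]]] by (simp add: H2.ips H2.mems)
  have vz: "h2_inner v (\<lambda>z. z * g z) = - cnj ?t"
    using zv[OF g] H2.ip_sym[OF zg v] by simp
  have vv: "h2_inner v v = \<alpha> * cnj \<alpha> + 1 - \<alpha> * cnj (u 0) - cnj \<alpha> * u 0"
    unfolding v_def using k0 u1_H2 u1_sqn kern_0_inner[OF u1_H2] kern_0_inner(1)[OF k0] u1_eval[of 0]
    by (simp add: H2.ips H2.mems kern_def algebra_simps)
  have dd: "d + cnj d = 2 - \<alpha> * cnj (u 0) - cnj \<alpha> * u 0"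
    unfolding d_def by simp
  have "h2_inner (pshift \<alpha> f) (pshift \<alpha> g) =
      h2_inner f g - cnj (?t / d) * ?s - (?s / d) * cnj ?t + (?s / d) * cnj (?t / d) * h2_inner v v"
  proof -
    define a where "a = ?s / d"
    define b where "b = ?t / d"
    have "pshift \<alpha> f = (\<lambda>z. z * f z + a * v z)" "pshift \<alpha> g = (\<lambda>z. z * g z + b * v z)"
      unfolding pshift_def a_def b_def v_def d_def by (rule refl)+
    then show ?thesis
      using zf zg v zv[OF f] vz h2_inner_times_z_both[OF K_H2[OF f] K_H2[OF g]]
      by (simp add: H2.ips H2.mems flip: a_def b_def del: complex_cnj_divide)
        (simp add: algebra_simps)
  qed
  also have "\<dots> = h2_inner f g - ?s * cnj ?t * (d + cnj d - h2_inner v v) / (d * cnj d)"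
    using d0 by (simp add: field_simps)
  also have "d + cnj d - h2_inner v v = 1 - \<alpha> * cnj \<alpha>" unfolding vv dd by simp
  finally show ?thesis
    unfolding d_def[symmetric] by (simp add: complex_norm_square[unfolded of_real_power] mult_ac)
qed

text \<open>For f with f(0) = 0 the backward shift gives a preimage orthogonal to
  \<open>k0_conj u\<close>, where the correction term is absent; one preimage therefore serves all
  \<alpha>. It links functions vanishing at 0 with the kernel of the defect operator.\<close>

lemma pshift_bshift:
  assumes "f \<in> K" "f 0 = 0"
  shows "h2_inner (k0_conj f) (k0_conj u) = 0" "pshift \<alpha> (k0_conj f) = f"
proof -
  show *: "h2_inner (k0_conj f) (k0_conj u) = 0"
    using inner_kt[OF K_H2[OF bshift_K[OF assms(1)]]] times_z_k0_conj[OF K_H2[OF assms(1)] assms(2)] u1_orth(1) assms(1)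
    by simp
  show "pshift \<alpha> (k0_conj f) = f"
    unfolding pshift_def * using times_z_k0_conj[OF K_H2[OF assms(1)] assms(2)] assms(1) by simp
qed

text \<open>The adjoint of \<open>pshift\<close>: multiplication by z turns into the backward shift,
  and the rank one term exchanges its two vectors, with the scalar conjugated.\<close>

definition pshift_adj :: "complex \<Rightarrow> (complex \<Rightarrow> complex) \<Rightarrow> (complex \<Rightarrow> complex)" where
  "pshift_adj \<alpha> f = (\<lambda>z. cnj (h2_inner (\<lambda>z. \<alpha> * kern 0 z - u1 z) f / (1 - \<alpha> * cnj (u 0))) *
     k0_conj u z + k0_conj f z)"

lemma pshift_adj_K: "f \<in> K \<Longrightarrow> pshift_adj \<alpha> f \<in> K"
  unfolding pshift_adj_def by (intro K.lin_mem kt_K bshift_K)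

lemma pshift_adj_inner:
  assumes "f \<in> K" "g \<in> K"
  shows "h2_inner (pshift \<alpha> g) f = h2_inner g (pshift_adj \<alpha> f)"
proof -
  define v where "v = (\<lambda>z. \<alpha> * kern 0 z - u1 z)"
  define d where "d = 1 - \<alpha> * cnj (u 0)"
  note f = K_H2[OF assms(1)] and g = K_H2[OF assms(2)]
  have v: "v \<in> H2" unfolding v_def by (rule pshift_vector_H2)
  have "h2_inner (pshift \<alpha> g) f =
      h2_inner g (k0_conj f) + (h2_inner g (k0_conj u) / d) * h2_inner v f"
  proof -
    define e where "e = h2_inner g (k0_conj u) / d"
    have "pshift \<alpha> g = (\<lambda>z. z * g z + e * v z)" unfolding pshift_def e_def v_def d_def ..
    then show ?thesis
      using f g v times_z_H2(1)[OF g] h2_inner_times_z[OF g f]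
      by (simp add: H2.ip_add H2.ip_scale H2.scale_mem flip: e_def)
  qed
  also have "\<dots> = h2_inner g (pshift_adj \<alpha> f)"
    unfolding pshift_adj_def v_def[symmetric] d_def[symmetric]
    using g kt_H2 k0_conj_mem_H2[OF f]
    by (simp add: H2.ip_add_right H2.ip_scale_right H2.scale_mem del: complex_cnj_divide)
  finally show ?thesis .
qed

lemma op_adjoint_pshift:
  assumes "cmod \<alpha> \<le> 1"
  shows "op_adjoint K (perturbed_shift u \<alpha>) = (\<lambda>f. if f \<in> K then Some (pshift_adj \<alpha> f) else None)"
proof
  fix f
  have dom: "dom (perturbed_shift u \<alpha>) = K" unfolding perturbed_shift_eq[OF assms] by (auto split: if_splits)
  let ?P = "\<lambda>h. h \<in> K \<and> (\<forall>g\<in>K. h2_inner (the (perturbed_shift u \<alpha> g)) f = h2_inner g h)"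
  show "op_adjoint K (perturbed_shift u \<alpha>) f = (if f \<in> K then Some (pshift_adj \<alpha> f) else None)"
  proof (cases "f \<in> K")
    case True
    have P: "?P (pshift_adj \<alpha> f)"
      using pshift_adj_K[OF True] pshift_adj_inner[OF True] by (simp add: perturbed_shift_eq[OF assms])
    have "(THE h. ?P h) = pshift_adj \<alpha> f"
    proof (rule the_equality[of ?P, OF P])
      fix h assume h: "?P h"
      show "h = pshift_adj \<alpha> f"
      proof (rule K_eqI)
        fix g assume g: "g \<in> K"
        then have "h2_inner g h = h2_inner g (pshift_adj \<alpha> f)" using h P by metis
        then show "h2_inner h g = h2_inner (pshift_adj \<alpha> f) g"
          using h P g K.ip_sym by metis
      qed (use h P in auto)
    qed
    then show ?thesis using True P unfolding op_adjoint_def dom by auto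
  qed (simp add: op_adjoint_def)
qed

text \<open>A bounded operator commuting with \<open>S\<^sub>\<alpha>\<close>, \<open>\<bar>\<alpha>\<bar> < 1\<close>, together with its adjoint leaves the
  kernels of the defect operators \<open>I - S\<^sub>\<alpha>\<^sup>*S\<^sub>\<alpha>\<close> and \<open>I - S\<^sub>\<alpha>S\<^sub>\<alpha>\<^sup>*\<close> invariant. So \<open>k\<^sub>0\<close> is an eigenvector,
  and the eigenvalue propagates along the vectors \<open>S\<^sub>u\<^sup>n k\<^sub>0\<close>, which span.\<close>

lemma commuting_pair_scalar:
  assumes \<alpha>: "cmod \<alpha> < 1"
    and R: "\<And>f. f \<in> K \<Longrightarrow> R f \<in> K" and R': "\<And>f. f \<in> K \<Longrightarrow> R' f \<in> K"
    and adj: "\<And>f g. f \<in> K \<Longrightarrow> g \<in> K \<Longrightarrow> h2_inner (R f) g = h2_inner f (R' g)"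
    and comm: "\<And>f. f \<in> K \<Longrightarrow> R (pshift \<alpha> f) = pshift \<alpha> (R f)"
    and comm': "\<And>f. f \<in> K \<Longrightarrow> R' (pshift \<alpha> f) = pshift \<alpha> (R' f)"
  shows "\<exists>c. \<forall>f\<in>K. R f = (\<lambda>z. c * f z)"
proof -
  define \<delta> where "\<delta> = (1 - (cmod \<alpha>)\<^sup>2) / (cmod (1 - \<alpha> * cnj (u 0)))\<^sup>2"
  have \<alpha>1: "cmod \<alpha> \<le> 1" using \<alpha> by simp
  have \<delta>: "\<delta> \<noteq> 0" unfolding \<delta>_def using denom_nz[OF \<alpha>1] \<alpha> abs_square_less_1[of "cmod \<alpha>"] by auto
  have adj': "h2_inner (R' f) g = h2_inner f (R g)" if "f \<in> K" "g \<in> K" for f g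
    using adj[OF that(2,1)] K.ip_sym[OF that(2) R'[OF that(1)]] K.ip_sym[OF R[OF that(2)] that(1)]
    by simp
  \<comment> \<open>Write S for \<open>pshift \<alpha>\<close> and k for \<open>k0_conj u\<close>.
    Moving T across S twice gives <STf, Sk> = <Tf, k>, whereas the defect formula gives <Tf, k>
    minus a nonzero multiple of itself. T and T' are kept general so that R and R' can exchange
    roles.\<close>
  have inv: "h2_inner (T f) (k0_conj u) = 0"
    if T: "\<And>f. f \<in> K \<Longrightarrow> T f \<in> K" and T': "\<And>f. f \<in> K \<Longrightarrow> T' f \<in> K"
      and a: "\<And>f g. f \<in> K \<Longrightarrow> g \<in> K \<Longrightarrow> h2_inner (T f) g = h2_inner f (T' g)"
      and c: "\<And>f. f \<in> K \<Longrightarrow> T (pshift \<alpha> f) = pshift \<alpha> (T f)"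
      and c': "\<And>f. f \<in> K \<Longrightarrow> T' (pshift \<alpha> f) = pshift \<alpha> (T' f)"
      and f: "f \<in> K" "h2_inner f (k0_conj u) = 0" for T T' f
  proof -
    let ?g = "k0_conj u"
    have "h2_inner (pshift \<alpha> (T f)) (pshift \<alpha> ?g) = h2_inner (pshift \<alpha> f) (T' (pshift \<alpha> ?g))"
      using c[OF f(1)] a[OF pshift_K[OF f(1) \<alpha>1] pshift_K[OF kt_K \<alpha>1]] by simp
    also have "\<dots> = h2_inner (pshift \<alpha> f) (pshift \<alpha> (T' ?g))" using c'[OF kt_K] by simp
    also have "\<dots> = h2_inner f (T' ?g)"
      using pshift_inner[OF f(1) T'[OF kt_K] \<alpha>1] f(2) by simp
    also have "\<dots> = h2_inner (T f) ?g" using a[OF f(1) kt_K] by simp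
    finally have "of_real \<delta> * h2_inner (T f) ?g * cnj (h2_inner ?g ?g) = 0"
      using pshift_inner[OF T[OF f(1)] kt_K \<alpha>1] unfolding \<delta>_def by simp
    then show ?thesis using \<delta> kt_sqn_pos by auto
  qed
  \<comment> \<open>Functions vanishing at 0 are images under \<open>pshift \<alpha>\<close> of the
    subspace just treated, and on that subspace \<open>pshift \<alpha>\<close> is multiplication by
    z.\<close>
  have inv0: "T f 0 = 0"
    if T: "\<And>f. f \<in> K \<Longrightarrow> T f \<in> K" and T': "\<And>f. f \<in> K \<Longrightarrow> T' f \<in> K"
      and a: "\<And>f g. f \<in> K \<Longrightarrow> g \<in> K \<Longrightarrow> h2_inner (T f) g = h2_inner f (T' g)"
      and c: "\<And>f. f \<in> K \<Longrightarrow> T (pshift \<alpha> f) = pshift \<alpha> (T f)"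
      and c': "\<And>f. f \<in> K \<Longrightarrow> T' (pshift \<alpha> f) = pshift \<alpha> (T' f)"
      and f: "f \<in> K" "f 0 = 0" for T T' f
  proof -
    note b = bshift_K[OF f(1)] pshift_bshift(1)[OF f] pshift_bshift(2)[OF f, of \<alpha>]
    have "T f 0 = pshift \<alpha> (T (k0_conj f)) 0" using c[OF b(1)] b(3) by simp
    also have "\<dots> = 0"
      using inv[of T T', OF T T' a c c' b(1,2)] by (simp add: pshift_def)
    finally show ?thesis .
  qed
  note ku0 = ku_K[of 0, simplified]
  define c where "c = R (ku 0) 0 / ku 0 0"
  have Rk: "R (ku 0) = (\<lambda>z. c * ku 0 z)"
  proof -
    \<comment> \<open>c is chosen so that this difference vanishes at 0, that is, is orthogonal to
      \<open>ku 0\<close>. Since R' preserves vanishing at 0, the difference is also orthogonal to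
      the image of \<open>ku 0\<close> under R, hence to itself.\<close>
    let ?g = "\<lambda>z. R (ku 0) z - c * ku 0 z"
    have g: "?g \<in> K" by (intro K.diff_mem K.scale_mem R ku0)
    have g0: "?g 0 = 0" unfolding c_def using ku_0_at_0 by simp
    have "h2_inner (ku 0) (R' ?g) = 0"
      using inv0[of R' R, OF R' R adj' comm' comm g g0] ku_inner[OF R'[OF g], of 0]
        K.ip_sym[OF R'[OF g] ku0] by simp
    moreover have "h2_inner (ku 0) ?g = 0"
      using g0 ku_inner[OF g, of 0] K.ip_sym[OF g ku0] by simp
    ultimately have "h2_inner ?g ?g = 0"
      using adj[OF ku0 g] R[OF ku0] ku0 g by (simp add: K.ip_diff[of "R (ku 0)"] K.ip_scale K.scale_mem)
    then have "?g = (\<lambda>_. 0)" using K_definite[OF g] by simp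
    then show ?thesis by (simp add: fun_eq_iff)
  qed
  have Rlin: "R (\<lambda>z. a * f z + g z) = (\<lambda>z. a * R f z + R g z)" if "f \<in> K" "g \<in> K" for a f g
    using that by (intro K_eqI) (auto simp: adj K.ip_lin R R' K.lin_mem)
  define p where "p n = (compressed_shift u ^^ n) (ku 0)" for n
  have p: "p n \<in> K" for n
    unfolding p_def by (induction n) (use ku0 compressed_shift_eq(2) in auto)
  have pS: "p (Suc n) = compressed_shift u (p n)" for n unfolding p_def by simp
  have Rp: "R (p n) = (\<lambda>z. c * p n z)" for n
  proof (induction n)
    case 0
    then show ?case using Rk unfolding p_def by simp
  next
    case (Suc n)
    define e where "e = \<alpha> / (1 - \<alpha> * cnj (u 0)) * h2_inner (p n) (k0_conj u)"
    have alt: "p (Suc n) = (\<lambda>z. (- e) * ku 0 z + pshift \<alpha> (p n) z)"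
      unfolding pS pshift_alt[OF p \<alpha>1] e_def by simp
    have "pshift \<alpha> (\<lambda>z. c * p n z) = (\<lambda>z. c * pshift \<alpha> (p n) z)"
      using pshift_lin[OF p[of n] K.zero_mem, of \<alpha> c] by (simp add: pshift_def h2_inner_def zero_H2(2))
    then show ?case
      unfolding alt using Rlin[OF ku0 pshift_K[OF p \<alpha>1], of "-e" n] Rk comm[OF p[of n]] Suc
      by (simp add: algebra_simps)
  qed
  \<comment> \<open>The adjoint of the compressed shift is the backward shift, so pairing with its
    iterates on \<open>ku 0\<close> reads off Taylor coefficients. These determine R' f at once, in
    place of a density argument for the span.\<close>
  have coeff: "h2_inner f (p n) = taylor_coeff f n" if "f \<in> K" for f n
    using that
  proof (induction n arbitrary: f)
    case 0
    then show ?case using ku_inner[of f 0] unfolding p_def by simp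
  next
    case (Suc n)
    have H: "f \<in> H2" "p n \<in> H2" using Suc.prems p K_H2 by auto
    have "h2_inner f (p (Suc n)) = h2_inner f (\<lambda>z. z * p n z)"
      unfolding pS compressed_shift_eq(1)[OF p]
      using H times_z_H2(1) u1_H2 u1_orth(1)[OF Suc.prems] by (simp add: H2.ips H2.mems)
    also have "\<dots> = h2_inner (k0_conj f) (p n)"
      using h2_inner_times_z[OF H(2,1)] H2.ip_sym H times_z_H2(1) k0_conj_mem_H2 by metis
    also have "\<dots> = taylor_coeff (k0_conj f) n" by (intro Suc.IH bshift_K Suc.prems)
    also have "\<dots> = taylor_coeff f (Suc n)"
      using k0_conj_H2(2)[of f] H(1) unfolding H2_def by simp
    finally show ?case .
  qed
  have R'c: "R' f = (\<lambda>z. cnj c * f z)" if f: "f \<in> K" for f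
  proof (rule H2_eqI_taylor)
    show "taylor_coeff (R' f) = taylor_coeff (\<lambda>z. cnj c * f z)"
      using coeff[OF R'[OF f]] coeff[OF K.scale_mem[OF f, of "cnj c"]] adj'[OF f p] Rp p f
      by (intro ext) (metis K.ip_scale K.ip_scale_right)
  qed (use f K_H2 R' K.scale_mem in blast)+
  have "R f = (\<lambda>z. c * f z)" if f: "f \<in> K" for f
    using f by (intro K_eqI R K.scale_mem) (auto simp: adj R'c K.ip_scale K.ip_scale_right)
  then show ?thesis by blast
qed

end

section \<open>Measures on the circle and their moments\<close>

lemma circle_cnj_mult: "\<zeta> \<in> unit_circle \<Longrightarrow> \<zeta> * cnj \<zeta> = 1" "\<zeta> \<in> unit_circle \<Longrightarrow> cnj \<zeta> * \<zeta> = 1"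
  by (simp_all add: complex_norm_square[symmetric] mult.commute[of "cnj \<zeta>"])

locale circle_measure = finite_measure \<mu> for \<mu> :: "complex measure" +
  assumes sets_circle [measurable_cong]: "sets \<mu> = sets borel_circle"
begin

lemma space_circle: "space \<mu> = unit_circle"
  using sets_eq_imp_space_eq[OF sets_circle] by (simp add: space_restrict_space)

lemma measurable_of_continuous:
  fixes g :: "complex \<Rightarrow> 'b :: topological_space"
  assumes "continuous_on unit_circle g"
  shows "g \<in> borel_measurable \<mu>"
  using borel_measurable_continuous_on_restrict[OF assms] measurable_cong_sets[OF sets_circle refl] by blast

lemma integrable_bounded:
  fixes g :: "complex \<Rightarrow> complex"
  assumes "g \<in> borel_measurable \<mu>" "\<And>\<zeta>. \<zeta> \<in> unit_circle \<Longrightarrow> cmod (g \<zeta>) \<le> B"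
  shows "integrable \<mu> g"
  using assms space_circle by (intro integrable_const_bound[of _ B] AE_I2) auto

lemma integrable_continuous:
  fixes g :: "complex \<Rightarrow> complex"
  assumes "continuous_on unit_circle g"
  shows "integrable \<mu> g"
proof -
  have "bounded (g ` unit_circle)"
    using assms by (intro compact_imp_bounded compact_continuous_image) auto
  then obtain B where "\<forall>x\<in>unit_circle. cmod (g x) \<le> B" unfolding bounded_iff by blast
  then show ?thesis using measurable_of_continuous[OF assms] by (intro integrable_bounded[of g B]) auto
qed

lemma integrable_mult_bounded:
  fixes g y :: "complex \<Rightarrow> complex"
  assumes "integrable \<mu> y" "g \<in> borel_measurable \<mu>" "\<And>\<zeta>. \<zeta> \<in> unit_circle \<Longrightarrow> cmod (g \<zeta>) \<le> B"
  shows "integrable \<mu> (\<lambda>\<zeta>. g \<zeta> * y \<zeta>)"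
proof (rule Bochner_Integration.integrable_bound)
  show "integrable \<mu> (\<lambda>\<zeta>. of_real B * y \<zeta>)" using assms(1) by simp
  show "AE \<zeta> in \<mu>. norm (g \<zeta> * y \<zeta>) \<le> norm (of_real B * y \<zeta>)"
  proof (rule AE_I2)
    fix \<zeta> assume "\<zeta> \<in> space \<mu>"
    then have "cmod (g \<zeta>) \<le> B" using assms(3) space_circle by simp
    then show "norm (g \<zeta> * y \<zeta>) \<le> norm (of_real B * y \<zeta>)"
      by (simp add: norm_mult mult_right_mono)
  qed
qed (use assms in measurable)

lemma integral_cong_circle:
  assumes "\<And>\<zeta>. \<zeta> \<in> unit_circle \<Longrightarrow> f \<zeta> = g \<zeta>"
  shows "(\<integral>\<zeta>. f \<zeta> \<partial>\<mu>) = (\<integral>\<zeta>. g \<zeta> \<partial>\<mu>)"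
  using assms space_circle by (intro Bochner_Integration.integral_cong) auto

text \<open>Expanding the kernel as a geometric series, dominated by |z|^n |y|, identifies the
  Taylor coefficients of a Cauchy transform with moments against powers of cnj \<zeta>.\<close>

lemma Cauchy_transform_sums:
  assumes y: "integrable \<mu> y" and z: "z \<in> unit_disc"
  shows "(\<lambda>n. (\<integral>\<zeta>. cnj \<zeta> ^ n * y \<zeta> \<partial>\<mu>) * z ^ n) sums (\<integral>\<zeta>. y \<zeta> / (1 - cnj \<zeta> * z) \<partial>\<mu>)"
proof -
  let ?h = "\<lambda>n \<zeta>. z ^ n * (cnj \<zeta> ^ n * y \<zeta>)"
  have int: "integrable \<mu> (\<lambda>\<zeta>. cnj \<zeta> ^ n * y \<zeta>)" for n
    using y by (intro integrable_mult_bounded[of _ _ 1] measurable_of_continuous continuous_intros)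
      (auto simp: norm_power)
  have gs: "summable (\<lambda>n. cmod z ^ n)" using z by (intro summable_geometric) simp
  have nb: "norm (?h n \<zeta>) = cmod z ^ n * cmod (y \<zeta>)" if "\<zeta> \<in> unit_circle" for n \<zeta>
    using that by (simp add: norm_mult norm_power)
  have "(\<lambda>n. \<integral>\<zeta>. ?h n \<zeta> \<partial>\<mu>) sums (\<integral>\<zeta>. (\<Sum>n. ?h n \<zeta>) \<partial>\<mu>)"
  proof (rule sums_integral)
    show "integrable \<mu> (?h n)" for n using int by simp
    show "AE \<zeta> in \<mu>. summable (\<lambda>n. norm (?h n \<zeta>))"
    proof (rule AE_I2)
      fix \<zeta> assume "\<zeta> \<in> space \<mu>"
      then show "summable (\<lambda>n. norm (?h n \<zeta>))"
        using nb space_circle summable_mult2[OF gs, of "cmod (y \<zeta>)"] by simp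
    qed
    have "(\<integral>\<zeta>. norm (?h n \<zeta>) \<partial>\<mu>) = cmod z ^ n * (\<integral>\<zeta>. cmod (y \<zeta>) \<partial>\<mu>)" for n
      using integral_cong_circle[OF nb[where n = n]] by simp
    then show "summable (\<lambda>n. \<integral>\<zeta>. norm (?h n \<zeta>) \<partial>\<mu>)" using summable_mult2[OF gs] by simp
  qed
  moreover have "(\<integral>\<zeta>. (\<Sum>n. ?h n \<zeta>) \<partial>\<mu>) = (\<integral>\<zeta>. y \<zeta> / (1 - cnj \<zeta> * z) \<partial>\<mu>)"
  proof (rule integral_cong_circle)
    fix \<zeta> assume "\<zeta> \<in> unit_circle"
    then have "cmod (cnj \<zeta> * z) < 1" using z by (simp add: norm_mult)
    from sums_mult2[OF geometric_sums[OF this], of "y \<zeta>"]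
    show "(\<Sum>n. ?h n \<zeta>) = y \<zeta> / (1 - cnj \<zeta> * z)"
      by (simp add: sums_iff power_mult_distrib mult_ac)
  qed
  ultimately show ?thesis by (simp add: mult.commute)
qed

end

text \<open>Test functions against which two measures integrate alike, in a form stable under
  multiplication by real polynomials.\<close>

definition same_moments :: "complex measure \<Rightarrow> complex measure \<Rightarrow> (complex \<Rightarrow> complex) \<Rightarrow> bool" where
  "same_moments \<mu> \<nu> \<psi> \<longleftrightarrow> continuous_on unit_circle \<psi> \<and>
     (\<forall>m n. (\<integral>\<zeta>. \<zeta> ^ m * cnj \<zeta> ^ n * \<psi> \<zeta> \<partial>\<mu>) = (\<integral>\<zeta>. \<zeta> ^ m * cnj \<zeta> ^ n * \<psi> \<zeta> \<partial>\<nu>))"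

lemma same_moments_lin:
  assumes "circle_measure \<mu>" "circle_measure \<nu>" "same_moments \<mu> \<nu> \<psi>" "same_moments \<mu> \<nu> \<psi>'"
  shows "same_moments \<mu> \<nu> (\<lambda>\<zeta>. c * \<psi> \<zeta> + \<psi>' \<zeta>)"
proof -
  interpret \<mu>: circle_measure \<mu> by fact
  interpret \<nu>: circle_measure \<nu> by fact
  have c: "continuous_on unit_circle \<psi>" "continuous_on unit_circle \<psi>'"
    using assms unfolding same_moments_def by auto
  have i: "integrable M (\<lambda>\<zeta>. \<zeta> ^ m * cnj \<zeta> ^ n * \<psi> \<zeta>)" "integrable M (\<lambda>\<zeta>. \<zeta> ^ m * cnj \<zeta> ^ n * \<psi>' \<zeta>)"
    if "circle_measure M" for m n M
    using c by (auto intro!: circle_measure.integrable_continuous[OF that] continuous_intros)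
  have "(\<integral>\<zeta>. \<zeta> ^ m * cnj \<zeta> ^ n * (c * \<psi> \<zeta> + \<psi>' \<zeta>) \<partial>M) =
      c * (\<integral>\<zeta>. \<zeta> ^ m * cnj \<zeta> ^ n * \<psi> \<zeta> \<partial>M) + (\<integral>\<zeta>. \<zeta> ^ m * cnj \<zeta> ^ n * \<psi>' \<zeta> \<partial>M)"
    if "circle_measure M" for m n M
    using Bochner_Integration.integral_add[OF integrable_mult_right[OF i(1)[OF that, of m n], of c] i(2)[OF that, of m n]]
    by (simp add: algebra_simps)
  then show ?thesis
    using assms c unfolding same_moments_def by (auto intro!: continuous_intros)
qed

lemma same_moments_shift:
  assumes "same_moments \<mu> \<nu> \<psi>"
  shows "same_moments \<mu> \<nu> (\<lambda>\<zeta>. \<zeta> * \<psi> \<zeta>)" "same_moments \<mu> \<nu> (\<lambda>\<zeta>. cnj \<zeta> * \<psi> \<zeta>)"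
proof -
  have c: "continuous_on unit_circle \<psi>" using assms unfolding same_moments_def by auto
  have e: "(\<integral>\<zeta>. \<zeta> ^ m * cnj \<zeta> ^ n * \<psi> \<zeta> \<partial>\<mu>) = (\<integral>\<zeta>. \<zeta> ^ m * cnj \<zeta> ^ n * \<psi> \<zeta> \<partial>\<nu>)" for m n
    using assms unfolding same_moments_def by auto
  show "same_moments \<mu> \<nu> (\<lambda>\<zeta>. \<zeta> * \<psi> \<zeta>)" "same_moments \<mu> \<nu> (\<lambda>\<zeta>. cnj \<zeta> * \<psi> \<zeta>)"
    unfolding same_moments_def using c e[of "Suc _"] e[of _ "Suc _"]
    by (auto intro!: continuous_intros simp: mult_ac)
qed

text \<open>\<psi> stays arbitrary in the induction, so that a product of polynomials is handled by
  applying the two induction hypotheses one after the other.\<close>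

lemma same_moments_real_polynomial:
  assumes "circle_measure \<mu>" "circle_measure \<nu>" "real_polynomial_function p" "same_moments \<mu> \<nu> \<psi>"
  shows "same_moments \<mu> \<nu> (\<lambda>\<zeta>. of_real (p \<zeta>) * \<psi> \<zeta>)"
  using assms(3,4)
proof (induction arbitrary: \<psi>)
  case (linear f)
  interpret f: bounded_linear f by fact
  \<comment> \<open>Every real-linear real functional on the plane has the form a \<zeta> + cnj a
    cnj \<zeta>; its values at 1 and i determine a.\<close>
  define a where "a = (of_real (f 1) - \<i> * of_real (f \<i>)) / 2"
  have f: "of_real (f \<zeta>) = a * \<zeta> + cnj a * cnj \<zeta>" for \<zeta>
  proof -
    have "f \<zeta> = f (Re \<zeta> *\<^sub>R 1 + Im \<zeta> *\<^sub>R \<i>)"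
      by (rule arg_cong[of _ _ f]) (simp add: complex_eq_iff)
    also have "\<dots> = Re \<zeta> * f 1 + Im \<zeta> * f \<i>" by (simp only: f.add f.scaleR real_scaleR_def)
    finally show ?thesis unfolding a_def by (simp add: complex_eq_iff field_simps)
  qed
  have z: "same_moments \<mu> \<nu> (\<lambda>_. 0)" unfolding same_moments_def by simp
  note s = same_moments_shift[OF linear.prems]
  have "same_moments \<mu> \<nu> (\<lambda>\<zeta>. a * (\<zeta> * \<psi> \<zeta>) + (cnj a * (cnj \<zeta> * \<psi> \<zeta>) + 0))"
    by (intro same_moments_lin assms(1,2) s z)
  then show ?case unfolding f by (simp add: algebra_simps)
next
  case (const c)
  have z: "same_moments \<mu> \<nu> (\<lambda>_. 0)" unfolding same_moments_def by simp
  show ?case using same_moments_lin[OF assms(1,2) const z, of "of_real c"] by simp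
next
  case (add f g)
  show ?case using same_moments_lin[OF assms(1,2) add.IH(1)[OF add.prems] add.IH(2)[OF add.prems], of 1]
    by (simp add: algebra_simps)
next
  case (mult f g)
  show ?case using mult.IH(1)[OF mult.IH(2)[OF mult.prems]] by (simp add: mult_ac)
qed

text \<open>On the circle \<zeta>^m cnj \<zeta>^n collapses to one power of \<zeta> or of cnj
  \<zeta>, and for positive measures the moments of the second kind are conjugates of those of the
  first.\<close>

lemma same_moments_1:
  assumes "circle_measure \<mu>" "circle_measure \<nu>"
    and eq: "\<And>n. (\<integral>\<zeta>. \<zeta> ^ n \<partial>\<mu>) = (\<integral>\<zeta>. \<zeta> ^ n \<partial>\<nu>)"
  shows "same_moments \<mu> \<nu> (\<lambda>_. 1)"
  unfolding same_moments_def
proof (intro conjI allI)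
  interpret \<mu>: circle_measure \<mu> by fact
  interpret \<nu>: circle_measure \<nu> by fact
  fix m n :: nat
  have eq': "(\<integral>\<zeta>. cnj \<zeta> ^ n \<partial>\<mu>) = (\<integral>\<zeta>. cnj \<zeta> ^ n \<partial>\<nu>)" for n
    using arg_cong[OF eq[of n], of cnj] by (simp flip: Bochner_Integration.integral_cnj)
  show "(\<integral>\<zeta>. \<zeta> ^ m * cnj \<zeta> ^ n * 1 \<partial>\<mu>) = (\<integral>\<zeta>. \<zeta> ^ m * cnj \<zeta> ^ n * 1 \<partial>\<nu>)"
  proof (cases "n \<le> m")
    case True
    have "\<zeta> ^ m * cnj \<zeta> ^ n * 1 = \<zeta> ^ (m - n)" if "\<zeta> \<in> unit_circle" for \<zeta>
    proof -
      have "\<zeta> ^ m * cnj \<zeta> ^ n = \<zeta> ^ (m - n) * (\<zeta> * cnj \<zeta>) ^ n"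
        using True by (simp add: power_mult_distrib flip: mult.assoc power_add)
      then show ?thesis using circle_cnj_mult[OF that] by simp
    qed
    then show ?thesis using \<mu>.integral_cong_circle \<nu>.integral_cong_circle eq by (metis (no_types, lifting))
  next
    case False
    have "\<zeta> ^ m * cnj \<zeta> ^ n * 1 = cnj \<zeta> ^ (n - m)" if "\<zeta> \<in> unit_circle" for \<zeta>
    proof -
      have "\<zeta> ^ m * cnj \<zeta> ^ n = (\<zeta> * cnj \<zeta>) ^ m * cnj \<zeta> ^ (n - m)"
        using False by (simp add: power_mult_distrib mult.assoc flip: power_add)
      then show ?thesis using circle_cnj_mult[OF that] by simp
    qed
    then show ?thesis using \<mu>.integral_cong_circle \<nu>.integral_cong_circle eq' by (metis (no_types, lifting))
  qed
qed simp

text \<open>Stone-Weierstrass gives a real polynomial uniformly within e of g; replacing g by it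
  moves each integral by at most e times the total mass.\<close>

lemma circle_integral_eq_of_moments:
  fixes g :: "complex \<Rightarrow> real"
  assumes "circle_measure \<mu>" "circle_measure \<nu>"
    and eq: "\<And>n. (\<integral>\<zeta>. \<zeta> ^ n \<partial>\<mu>) = (\<integral>\<zeta>. \<zeta> ^ n \<partial>\<nu>)"
    and g: "continuous_on unit_circle g"
  shows "(\<integral>\<zeta>. g \<zeta> \<partial>\<mu>) = (\<integral>\<zeta>. g \<zeta> \<partial>\<nu>)"
proof -
  interpret \<mu>: circle_measure \<mu> by fact
  interpret \<nu>: circle_measure \<nu> by fact
  let ?C = "measure \<mu> unit_circle + measure \<nu> unit_circle"
  have le: "\<bar>(\<integral>\<zeta>. g \<zeta> \<partial>\<mu>) - (\<integral>\<zeta>. g \<zeta> \<partial>\<nu>)\<bar> \<le> e * ?C" if e: "e > 0" for e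
  proof -
    obtain p where p: "real_polynomial_function p" "\<And>x. x \<in> unit_circle \<Longrightarrow> \<bar>g x - p x\<bar> < e"
      using Stone_Weierstrass_real_polynomial_function[OF _ g e] by (metis compact_sphere)
    have pc: "continuous_on unit_circle p"
      using p(1) continuous_on_polymonial_function real_polynomial_function_eq by auto
    have "same_moments \<mu> \<nu> (\<lambda>\<zeta>. of_real (p \<zeta>) * 1)"
      by (intro same_moments_real_polynomial assms p same_moments_1)
    then have "(\<integral>\<zeta>. complex_of_real (p \<zeta>) \<partial>\<mu>) = (\<integral>\<zeta>. complex_of_real (p \<zeta>) \<partial>\<nu>)"
      unfolding same_moments_def by (metis (no_types, lifting) mult.right_neutral mult_1 power_0 Bochner_Integration.integral_cong)
    then have peq: "(\<integral>\<zeta>. p \<zeta> \<partial>\<mu>) = (\<integral>\<zeta>. p \<zeta> \<partial>\<nu>)" by simp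
    have "\<bar>(\<integral>\<zeta>. g \<zeta> \<partial>M) - (\<integral>\<zeta>. p \<zeta> \<partial>M)\<bar> \<le> e * measure M unit_circle" if "circle_measure M" for M
    proof -
      interpret M: circle_measure M by fact
      have i: "integrable M h" if "continuous_on unit_circle h" for h :: "complex \<Rightarrow> real"
        using M.integrable_continuous[of "\<lambda>x. of_real (h x)"] that
        by (simp add: continuous_on_of_real complex_of_real_integrable_eq)
      have "\<bar>(\<integral>\<zeta>. g \<zeta> \<partial>M) - (\<integral>\<zeta>. p \<zeta> \<partial>M)\<bar> = \<bar>\<integral>\<zeta>. g \<zeta> - p \<zeta> \<partial>M\<bar>"
        using i g pc by simp
      also have "\<dots> \<le> (\<integral>\<zeta>. \<bar>g \<zeta> - p \<zeta>\<bar> \<partial>M)" by (rule integral_abs_bound)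
      also have "\<dots> \<le> (\<integral>\<zeta>. e \<partial>M)"
        using p(2) M.space_circle by (intro integral_mono i continuous_intros g pc) (auto intro: less_imp_le)
      also have "\<dots> = e * measure M unit_circle" by (simp add: M.space_circle)
      finally show ?thesis .
    qed
    from this[OF assms(1)] this[OF assms(2)] peq show ?thesis by (simp add: distrib_left)
  qed
  have "\<bar>(\<integral>\<zeta>. g \<zeta> \<partial>\<mu>) - (\<integral>\<zeta>. g \<zeta> \<partial>\<nu>)\<bar> \<le> 0"
  proof (rule field_le_epsilon)
    fix e :: real assume e: "e > 0"
    have C: "?C \<ge> 0" by simp
    have "e / (c + 1) * c \<le> e" if "c \<ge> 0" for c :: real
      using e that by (simp add: field_simps)
    from this[OF C] have "e / (?C + 1) * ?C \<le> e" .
    with le[of "e / (?C + 1)"] e C show "\<bar>(\<integral>\<zeta>. g \<zeta> \<partial>\<mu>) - (\<integral>\<zeta>. g \<zeta> \<partial>\<nu>)\<bar> \<le> 0 + e"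
      by (smt (verit) divide_pos_pos)
  qed
  then show ?thesis by simp
qed

text \<open>The continuous tent functions tend to the indicator of C because a point off a closed
  set has positive distance to it. C is nonempty because \<open>infdist\<close> to the empty set is
  0 by convention, which would make every tent equal to 1.\<close>

lemma circle_measure_closed:
  assumes "circle_measure \<mu>" and C: "closed C" "C \<subseteq> unit_circle" "C \<noteq> {}"
  shows "(\<lambda>n. \<integral>\<zeta>. max 0 (1 - real n * infdist \<zeta> C) \<partial>\<mu>) \<longlonglongrightarrow> measure \<mu> C"
proof -
  interpret \<mu>: circle_measure \<mu> by fact
  have Cm: "C \<in> sets \<mu>"
    unfolding \<mu>.sets_circle sets_restrict_space using C by (auto intro!: image_eqI[of _ _ C])
  have "(\<lambda>n. \<integral>\<zeta>. max 0 (1 - real n * infdist \<zeta> C) \<partial>\<mu>) \<longlonglongrightarrow> (\<integral>\<zeta>. indicator C \<zeta> \<partial>\<mu>)"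
  proof (rule integral_dominated_convergence[where w = "\<lambda>_. 1"])
    show "AE \<zeta> in \<mu>. (\<lambda>n. max 0 (1 - real n * infdist \<zeta> C)) \<longlonglongrightarrow> indicator C \<zeta>"
    proof (rule AE_I2)
      fix \<zeta> :: complex
      show "(\<lambda>n. max 0 (1 - real n * infdist \<zeta> C)) \<longlonglongrightarrow> indicator C \<zeta>"
      proof (cases "\<zeta> \<in> C")
        case False
        then have d: "infdist \<zeta> C > 0" using C infdist_pos_not_in_closed by blast
        obtain N :: nat where N: "1 / infdist \<zeta> C < N" using reals_Archimedean2 by blast
        have "max 0 (1 - real n * infdist \<zeta> C) = 0" if "n \<ge> N" for n
        proof -
          have "1 / infdist \<zeta> C < n" using N that by linarith
          then show ?thesis using d by (simp add: field_simps)
        qed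
        then have "\<forall>\<^sub>F n in sequentially. max 0 (1 - real n * infdist \<zeta> C) = 0"
          unfolding eventually_sequentially by blast
        then show ?thesis using False by (simp add: tendsto_eventually)
      qed simp
    qed
    show "AE \<zeta> in \<mu>. norm (max 0 (1 - real n * infdist \<zeta> C)) \<le> 1" for n
      by (intro AE_I2) (simp add: infdist_nonneg)
    show "(\<lambda>\<zeta>. max 0 (1 - real n * infdist \<zeta> C)) \<in> borel_measurable \<mu>" for n
      by (intro \<mu>.measurable_of_continuous continuous_intros)
  qed (use Cm in auto)
  then show ?thesis using Cm by simp
qed

lemma sets_borel_circle:
  "sets borel_circle = sigma_sets unit_circle {C. closed C \<and> C \<subseteq> unit_circle}"
proof -
  have "sets borel_circle = (\<inter>) unit_circle ` sigma_sets UNIV (Collect closed)"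
    unfolding sets_restrict_space by (simp add: borel_eq_closed)
  also have "\<dots> = sigma_sets unit_circle ((\<inter>) unit_circle ` Collect closed)"
  proof (rule sigma_sets_Int)
    show "unit_circle \<in> sigma_sets UNIV (Collect closed)" by (intro sigma_sets.Basic) auto
  qed simp
  also have "(\<inter>) unit_circle ` Collect closed = {C. closed C \<and> C \<subseteq> unit_circle}"
    by (auto intro!: closed_Int)
  finally show ?thesis .
qed

lemma circle_measure_eqI:
  assumes "circle_measure \<mu>" "circle_measure \<nu>"
    and eq: "\<And>n. (\<integral>\<zeta>. \<zeta> ^ n \<partial>\<mu>) = (\<integral>\<zeta>. \<zeta> ^ n \<partial>\<nu>)"
  shows "\<mu> = \<nu>"
proof (rule measure_eqI_generator_eq[of "{C. closed C \<and> C \<subseteq> unit_circle}" unit_circle])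
  interpret \<mu>: circle_measure \<mu> by fact
  interpret \<nu>: circle_measure \<nu> by fact
  show "Int_stable {C. closed C \<and> C \<subseteq> unit_circle}" by (auto simp: Int_stable_def)
  show "sets \<mu> = sigma_sets unit_circle {C. closed C \<and> C \<subseteq> unit_circle}"
    "sets \<nu> = sigma_sets unit_circle {C. closed C \<and> C \<subseteq> unit_circle}"
    using \<mu>.sets_circle \<nu>.sets_circle sets_borel_circle by auto
  show "emeasure \<mu> C = emeasure \<nu> C" if "C \<in> {C. closed C \<and> C \<subseteq> unit_circle}" for C
  proof (cases "C = {}")
    case False
    have "continuous_on unit_circle (\<lambda>\<zeta>. max 0 (1 - real n * infdist \<zeta> C))" for n
      by (intro continuous_intros)
    then have "(\<integral>\<zeta>. max 0 (1 - real n * infdist \<zeta> C) \<partial>\<mu>) = (\<integral>\<zeta>. max 0 (1 - real n * infdist \<zeta> C) \<partial>\<nu>)" for n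
      using circle_integral_eq_of_moments[OF assms] by blast
    then have "measure \<mu> C = measure \<nu> C"
      using circle_measure_closed[OF assms(1), of C] circle_measure_closed[OF assms(2), of C] that False
        LIMSEQ_unique by simp
    then show ?thesis by (simp add: \<mu>.emeasure_eq_measure \<nu>.emeasure_eq_measure)
  qed simp
  show "range (\<lambda>_::nat. unit_circle) \<subseteq> {C. closed C \<and> C \<subseteq> unit_circle}"
    "(\<Union>i::nat. unit_circle) = unit_circle" by auto
  show "emeasure \<mu> unit_circle \<noteq> \<infinity>" for i :: nat by simp
qed auto

text \<open>Uniqueness is known for positive measures, so the positive and negative parts of f
  become densities. Vanishing moments of f mean that the two measures have the same moments and
  hence coincide.\<close>

lemma (in circle_measure) real_moments_zero:
  fixes f :: "complex \<Rightarrow> real"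
  assumes f: "integrable \<mu> f" and zero: "\<And>n. (\<integral>\<zeta>. \<zeta> ^ n * of_real (f \<zeta>) \<partial>\<mu>) = 0"
  shows "AE \<zeta> in \<mu>. f \<zeta> = 0"
proof -
  have [measurable]: "f \<in> borel_measurable \<mu>" using f by simp
  let ?d = "\<lambda>g. density \<mu> (\<lambda>\<zeta>. ennreal (g \<zeta>))"
  have cm: "circle_measure (?d g)" if g: "integrable \<mu> g" "\<And>\<zeta>. g \<zeta> \<ge> 0" for g
  proof -
    have [measurable]: "g \<in> borel_measurable \<mu>" using g by simp
    have "emeasure (?d g) (space (?d g)) = ennreal (\<integral>\<zeta>. g \<zeta> \<partial>\<mu>)"
      using g by (simp add: emeasure_density nn_integral_eq_integral cong: nn_integral_cong)
    then have "finite_measure (?d g)" by (intro finite_measureI) simp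
    then show ?thesis
      by (intro circle_measure.intro circle_measure_axioms.intro) (simp_all add: sets_circle)
  qed
  have mom: "(\<integral>\<zeta>. \<zeta> ^ n \<partial>?d g) = (\<integral>\<zeta>. \<zeta> ^ n * of_real (g \<zeta>) \<partial>\<mu>)"
    if g: "g \<in> borel_measurable \<mu>" "\<And>\<zeta>. g \<zeta> \<ge> 0" for g n
  proof -
    have "(\<lambda>\<zeta>. \<zeta> ^ n) \<in> borel_measurable \<mu>"
      by (intro measurable_of_continuous continuous_intros)
    then have "(\<integral>\<zeta>. \<zeta> ^ n \<partial>?d g) = (\<integral>\<zeta>. g \<zeta> *\<^sub>R \<zeta> ^ n \<partial>\<mu>)"
      using g by (intro integral_density) auto
    then show ?thesis by (simp add: scaleR_conv_of_real mult.commute)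
  qed
  let ?p = "\<lambda>\<zeta>. max 0 (f \<zeta>)" and ?n = "\<lambda>\<zeta>. max 0 (- f \<zeta>)"
  have ip: "integrable \<mu> ?p" "integrable \<mu> ?n" using f by (auto intro!: integrable_max)
  have ipz: "integrable \<mu> (\<lambda>\<zeta>. \<zeta> ^ n * complex_of_real (g \<zeta>))" if "integrable \<mu> g" for g n
    using that by (intro integrable_mult_bounded[of _ _ 1] measurable_of_continuous continuous_intros)
      (auto simp: norm_power complex_of_real_integrable_eq)
  have "?d ?p = ?d ?n"
  proof (rule circle_measure_eqI)
    fix n
    have "(\<integral>\<zeta>. \<zeta> ^ n * of_real (?p \<zeta>) \<partial>\<mu>) - (\<integral>\<zeta>. \<zeta> ^ n * of_real (?n \<zeta>) \<partial>\<mu>) =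
        (\<integral>\<zeta>. \<zeta> ^ n * of_real (?p \<zeta>) - \<zeta> ^ n * of_real (?n \<zeta>) \<partial>\<mu>)"
      by (rule Bochner_Integration.integral_diff[symmetric]) (intro ipz ip)+
    also have "\<dots> = (\<integral>\<zeta>. \<zeta> ^ n * of_real (f \<zeta>) \<partial>\<mu>)"
      by (intro Bochner_Integration.integral_cong) (auto simp: max_def)
    finally show "(\<integral>\<zeta>. \<zeta> ^ n \<partial>?d ?p) = (\<integral>\<zeta>. \<zeta> ^ n \<partial>?d ?n)"
      using zero[of n] mom[of ?p n] mom[of ?n n] by simp
  qed (intro cm ip; simp)+
  then have "AE \<zeta> in \<mu>. ennreal (?p \<zeta>) = ennreal (?n \<zeta>)"
    using ip by (subst (asm) density_unique_iff) (auto simp: sigma_finite_measure_axioms)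
  then show ?thesis by eventually_elim (auto simp: max_def split: if_splits)
qed

text \<open>The two families together give vanishing moments for both y and cnj y, hence for the
  real part of y. The imaginary part is the real part of -i y.\<close>

lemma (in circle_measure) moments_zero:
  fixes y :: "complex \<Rightarrow> complex"
  assumes y: "integrable \<mu> y" and z1: "\<And>n. (\<integral>\<zeta>. \<zeta> ^ n * y \<zeta> \<partial>\<mu>) = 0"
    and z2: "\<And>n. (\<integral>\<zeta>. cnj \<zeta> ^ n * y \<zeta> \<partial>\<mu>) = 0"
  shows "AE \<zeta> in \<mu>. y \<zeta> = 0"
proof -
  have Re_zero: "AE \<zeta> in \<mu>. Re (y \<zeta>) = 0"
    if y: "integrable \<mu> y" and z1: "\<And>n. (\<integral>\<zeta>. \<zeta> ^ n * y \<zeta> \<partial>\<mu>) = 0"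
    and z2: "\<And>n. (\<integral>\<zeta>. cnj \<zeta> ^ n * y \<zeta> \<partial>\<mu>) = 0" for y
  proof (rule real_moments_zero)
    show "integrable \<mu> (\<lambda>\<zeta>. Re (y \<zeta>))" using y by simp
    fix n
    have i: "integrable \<mu> (\<lambda>\<zeta>. \<zeta> ^ n * y \<zeta>)" "integrable \<mu> (\<lambda>\<zeta>. \<zeta> ^ n * cnj (y \<zeta>))"
      using y by (auto intro!: integrable_mult_bounded[of _ _ 1] measurable_of_continuous continuous_intros
        simp: norm_power)
    have "(\<integral>\<zeta>. \<zeta> ^ n * cnj (y \<zeta>) \<partial>\<mu>) = (\<integral>\<zeta>. cnj (cnj \<zeta> ^ n * y \<zeta>) \<partial>\<mu>)" by simp
    also have "\<dots> = cnj (\<integral>\<zeta>. cnj \<zeta> ^ n * y \<zeta> \<partial>\<mu>)" by (rule Bochner_Integration.integral_cnj)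
    finally have c: "(\<integral>\<zeta>. \<zeta> ^ n * cnj (y \<zeta>) \<partial>\<mu>) = 0" using z2 by simp
    have "(\<integral>\<zeta>. \<zeta> ^ n * of_real (Re (y \<zeta>)) \<partial>\<mu>) = (\<integral>\<zeta>. (\<zeta> ^ n * y \<zeta> + \<zeta> ^ n * cnj (y \<zeta>)) / 2 \<partial>\<mu>)"
      by (simp add: complex_add_cnj flip: distrib_left)
    also have "\<dots> = 0" using i z1 c by simp
    finally show "(\<integral>\<zeta>. \<zeta> ^ n * of_real (Re (y \<zeta>)) \<partial>\<mu>) = 0" .
  qed
  have "AE \<zeta> in \<mu>. Re (y \<zeta>) = 0" by (rule Re_zero[OF assms])
  moreover have "AE \<zeta> in \<mu>. Re (- \<i> * y \<zeta>) = 0"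
  proof (rule Re_zero)
    show "integrable \<mu> (\<lambda>\<zeta>. - \<i> * y \<zeta>)" using y by simp
    have "(\<integral>\<zeta>. \<zeta> ^ n * (- \<i> * y \<zeta>) \<partial>\<mu>) = (\<integral>\<zeta>. - \<i> * (\<zeta> ^ n * y \<zeta>) \<partial>\<mu>)"
      "(\<integral>\<zeta>. cnj \<zeta> ^ n * (- \<i> * y \<zeta>) \<partial>\<mu>) = (\<integral>\<zeta>. - \<i> * (cnj \<zeta> ^ n * y \<zeta>) \<partial>\<mu>)" for n
      by (simp_all add: mult_ac)
    then show "(\<integral>\<zeta>. \<zeta> ^ n * (- \<i> * y \<zeta>) \<partial>\<mu>) = 0" "(\<integral>\<zeta>. cnj \<zeta> ^ n * (- \<i> * y \<zeta>) \<partial>\<mu>) = 0" for n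
      using z1 z2 by (simp_all del: minus_mult_left)
  qed
  ultimately show ?thesis by eventually_elim (simp add: complex_eq_iff)
qed

section \<open>Herglotz representation and Clark measures\<close>

text \<open>Re f is half of f + cnj f, and the conjugate has only nonpositive frequencies, so for
  natural n it contributes just at n = 0.\<close>

lemma circle_Re_fourier:
  assumes f: "f holomorphic_on unit_disc" and r: "0 \<le> r" "r < 1"
  shows "(\<integral>t. complex_of_real (Re (f (of_real r * cis t))) * cis (- (real n * t)) \<partial>arclen) =
    (taylor_coeff f n * of_real r ^ n + (if n = 0 then cnj (f 0) else 0)) / 2"
proof -
  let ?f = "\<lambda>t. f (of_real r * cis t)"
  obtain B where B: "\<And>t. cmod (?f t) \<le> B" by (rule circle_bounded[OF f r]) blast
  note [measurable] = circle_measurable[OF f r]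
  have [measurable]: "(\<lambda>t. cnj (?f t)) \<in> borel_measurable borel"
    by (intro measurable_compose[OF _ borel_measurable_cnj]) measurable
  have i: "integrable arclen (\<lambda>t. ?f t * cis (- (real n * t)))"
    "integrable arclen (\<lambda>t. cnj (?f t) * cis (- (real n * t)))"
    using B by (auto intro!: arclen.integrable_const_bound[of _ B] simp: norm_mult)
  have "(\<integral>t. cnj (?f t) * cis (- (real n * t)) \<partial>arclen) = (\<integral>t. cnj (?f t * cis (- (of_int (- int n) * t))) \<partial>arclen)"
    by (simp add: cis_cnj)
  also have "\<dots> = cnj (\<integral>t. ?f t * cis (- (of_int (- int n) * t)) \<partial>arclen)"
    by (rule Bochner_Integration.integral_cnj)
  also have "\<dots> = (if n = 0 then cnj (f 0) else 0)"
    using circle_fourier[OF f r, of "- int n"] by simp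
  finally have c: "(\<integral>t. cnj (?f t) * cis (- (real n * t)) \<partial>arclen) = (if n = 0 then cnj (f 0) else 0)" .
  have "(\<integral>t. complex_of_real (Re (?f t)) * cis (- (real n * t)) \<partial>arclen) =
      (\<integral>t. (?f t * cis (- (real n * t)) + cnj (?f t) * cis (- (real n * t))) / 2 \<partial>arclen)"
    by (intro Bochner_Integration.integral_cong) (auto simp: complex_add_cnj simp flip: distrib_right)
  also have "\<dots> = (taylor_coeff f n * of_real r ^ n + (if n = 0 then cnj (f 0) else 0)) / 2"
    using i c circle_fourier[OF f r, of "int n"] by simp
  finally show ?thesis .
qed

text \<open>The Poisson integrals of \<open>\<mu>\<close> equal \<open>Re f\<close>, expressed through moments.\<close>

definition herglotz_moments :: "complex measure \<Rightarrow> (complex \<Rightarrow> complex) \<Rightarrow> bool" where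
  "herglotz_moments \<mu> f \<longleftrightarrow>
     (\<forall>n. (\<integral>\<zeta>. cnj \<zeta> ^ n \<partial>\<mu>) = (taylor_coeff f n + (if n = 0 then cnj (f 0) else 0)) / 2)"

text \<open>Division by Re f(0) turns the densities Re f on smaller circles into probability
  densities, so that a tight sequence of distributions on the line arises and a weak limit can be
  extracted. The limit is scaled back by Re f(0) and pushed to the circle by
  \<open>cis\<close>.\<close>

lemma herglotz_exists:
  assumes f: "f holomorphic_on unit_disc" and pos: "\<And>z. z \<in> unit_disc \<Longrightarrow> Re (f z) \<ge> 0"
    and pos0: "Re (f 0) > 0"
  obtains \<mu> where "circle_measure \<mu>" "herglotz_moments \<mu> f"
proof -
  define a where "a = Re (f 0)"
  have a: "a > 0" using pos0 unfolding a_def .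
  define p where "p k t = Re (f (of_real (radius k) * cis t)) / a" for k t
  define M where "M k = density arclen (\<lambda>t. ennreal (p k t))" for k
  have p_meas [measurable]: "p k \<in> borel_measurable borel" for k
    unfolding p_def using circle_measurable[OF f radius(1,2)[of k]] by measurable
  have p_nn: "p k t \<ge> 0" for k t
    unfolding p_def using pos[OF circle_mem[OF radius(1,2), of k t]] a by simp
  have p_int: "integrable arclen (p k)" for k
  proof -
    obtain B where B: "\<And>t. cmod (f (of_real (radius k) * cis t)) \<le> B"
      by (rule circle_bounded[OF f radius(1,2)[of k]]) blast
    have "\<bar>p k t\<bar> \<le> B / a" for t
      unfolding p_def using order_trans[OF abs_Re_le_cmod B[of t]] a by (simp add: divide_right_mono)
    then show ?thesis by (intro arclen.integrable_const_bound[of _ "B / a"]) auto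
  qed
  have mom: "(\<integral>t. cis (- (real n * t)) \<partial>M k) =
      (taylor_coeff f n * of_real (radius k) ^ n + (if n = 0 then cnj (f 0) else 0)) / 2 / a" for n k
  proof -
    have "(\<integral>t. cis (- (real n * t)) \<partial>M k) = (\<integral>t. p k t *\<^sub>R cis (- (real n * t)) \<partial>arclen)"
      unfolding M_def using p_nn by (intro integral_density) auto
    also have "\<dots> = (\<integral>t. complex_of_real (Re (f (of_real (radius k) * cis t))) * cis (- (real n * t)) / a \<partial>arclen)"
      unfolding p_def by (simp add: scaleR_conv_of_real)
    also have "\<dots> = (\<integral>t. complex_of_real (Re (f (of_real (radius k) * cis t))) * cis (- (real n * t)) \<partial>arclen) / a"
      by (rule integral_divide_zero)
    also have "\<dots> = (taylor_coeff f n * of_real (radius k) ^ n + (if n = 0 then cnj (f 0) else 0)) / 2 / a"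
      unfolding circle_Re_fourier[OF f radius(1,2)[of k]] ..
    finally show ?thesis .
  qed
  have "(\<integral>t. p k t \<partial>arclen) = 1" for k
  proof -
    have "complex_of_real (\<integral>t. p k t \<partial>arclen) = (\<integral>t. p k t *\<^sub>R cis (- (real 0 * t)) \<partial>arclen)"
      by (simp add: scaleR_conv_of_real)
    also have "\<dots> = (\<integral>t. cis (- (real 0 * t)) \<partial>M k)"
      unfolding M_def using p_nn by (intro integral_density[symmetric]) auto
    also have "\<dots> = (f 0 + cnj (f 0)) / 2 / a" unfolding mom by simp
    also have "\<dots> = 1" using a unfolding complex_add_cnj a_def by simp
    finally show ?thesis by (metis of_real_eq_1_iff)
  qed
  then have em: "emeasure (M k) UNIV = 1" for k
    unfolding M_def using nn_integral_eq_integral[OF p_int[of k]] p_nn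
    by (simp add: emeasure_density)
  have rd: "real_distribution (M k)" for k
    using em[of k] by (intro real_distribution.intro prob_spaceI real_distribution_axioms.intro)
      (auto simp: M_def)
  \<comment> \<open>Tightness asks for half-open intervals; this one contains the parameter interval
    from 0 to 2 pi because pi < 4.\<close>
  have supp: "measure (M k) {-1<..9} = 1" for k
  proof -
    have "AE t in arclen. t \<in> {-1<..9}"
      unfolding arclen_def using pi_less_4 by (intro AE_uniform_measureI AE_I2) auto
    then have "AE t in M k. t \<in> {-1<..9}"
      unfolding M_def by (subst AE_density) (auto elim: eventually_mono)
    then show ?thesis
      using prob_space.prob_eq_1[of "M k" "{-1<..9}"] rd[of k]
      by (simp add: real_distribution_def M_def)
  qed
  have "tight M"
    unfolding tight_def
  proof (intro conjI allI impI)
    fix e :: real assume "e > 0"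
    then show "\<exists>a b. a < b \<and> (\<forall>k. measure (M k) {a<..b} > 1 - e)"
      using supp by (intro exI[of _ "-1"] exI[of _ 9]) simp
  qed (rule rd)
  from tight_imp_convergent_subsubsequence[OF this strict_mono_id]
  obtain r N where r: "strict_mono r" and N: "real_distribution N" "weak_conv_m (M \<circ> r) N"
    by auto
  interpret N: real_distribution N by fact
  have N_mom: "(\<integral>t. cis (- (real n * t)) \<partial>N) =
      (taylor_coeff f n + (if n = 0 then cnj (f 0) else 0)) / 2 / a" for n
  proof -
    have "(\<lambda>k. \<integral>t. cis (- (real n * t)) \<partial>M (r k)) \<longlonglongrightarrow> (\<integral>t. cis (- (real n * t)) \<partial>N)"
      using rd N(1) N(2)[unfolded comp_def] by (intro weak_conv_imp_integral_bdd_continuous_conv[where B = 1])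
        (auto intro!: continuous_intros simp: cis_conv_exp)
    moreover have "(\<lambda>k. (taylor_coeff f n * of_real (radius (r k)) ^ n + (if n = 0 then cnj (f 0) else 0)) / 2 / a)
        \<longlonglongrightarrow> (taylor_coeff f n * of_real 1 ^ n + (if n = 0 then cnj (f 0) else 0)) / 2 / a"
      using LIMSEQ_subseq_LIMSEQ[OF radius_tendsto r] a unfolding comp_def by (intro tendsto_intros) auto
    ultimately show ?thesis unfolding mom of_real_1 power_one mult_1_right by (rule LIMSEQ_unique)
  qed
  have cis_meas [measurable]: "cis \<in> N \<rightarrow>\<^sub>M borel_circle"
    by (intro measurable_restrict_space2) (auto simp: measurable_cong_sets[OF N.events_eq_borel refl])
  define \<mu> where "\<mu> = distr (density N (\<lambda>_. ennreal a)) borel_circle cis"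
  have "finite_measure (density N (\<lambda>_. ennreal a))"
    by (intro finite_measureI) (simp add: emeasure_density N.emeasure_space_1 ennreal_mult_eq_top_iff)
  then have "finite_measure \<mu>"
    unfolding \<mu>_def by (intro finite_measure.finite_measure_distr) simp_all
  then interpret \<mu>: circle_measure \<mu>
    by (intro circle_measure.intro circle_measure_axioms.intro) (simp_all add: \<mu>_def)
  have "herglotz_moments \<mu> f"
    unfolding herglotz_moments_def
  proof
    fix n
    have m: "(\<lambda>\<zeta>. cnj \<zeta> ^ n) \<in> borel_measurable borel_circle"
      by (intro borel_measurable_continuous_on_restrict continuous_intros)
    have cn: "cnj (cis t) ^ n = cis (- (real n * t))" for t
      by (simp add: cis_cnj Complex.DeMoivre)
    have "(\<integral>\<zeta>. cnj \<zeta> ^ n \<partial>\<mu>) = (\<integral>t. cnj (cis t) ^ n \<partial>density N (\<lambda>_. ennreal a))"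
      unfolding \<mu>_def by (intro integral_distr m) simp
    also have "\<dots> = (\<integral>t. a *\<^sub>R cis (- (real n * t)) \<partial>N)"
      unfolding cn using a by (intro integral_density) auto
    also have "\<dots> = (taylor_coeff f n + (if n = 0 then cnj (f 0) else 0)) / 2"
      using N_mom[of n] a by (simp add: scaleR_conv_of_real)
    finally show "(\<integral>\<zeta>. cnj \<zeta> ^ n \<partial>\<mu>) = (taylor_coeff f n + (if n = 0 then cnj (f 0) else 0)) / 2" .
  qed
  with \<mu>.circle_measure_axioms show ?thesis by (intro that[of \<mu>]) (auto intro: circle_measure.intro \<mu>.finite_measure_axioms)
qed

context circle_measure
begin

lemma Cauchy_of_herglotz_moments:
  assumes f: "f holomorphic_on unit_disc" and h: "herglotz_moments \<mu> f" and z: "z \<in> unit_disc"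
  shows "(\<integral>\<zeta>. 1 / (1 - cnj \<zeta> * z) \<partial>\<mu>) = (f z + cnj (f 0)) / 2"
proof -
  have s: "(\<lambda>n. (\<integral>\<zeta>. cnj \<zeta> ^ n * 1 \<partial>\<mu>) * z ^ n) sums (\<integral>\<zeta>. 1 / (1 - cnj \<zeta> * z) \<partial>\<mu>)"
    by (intro Cauchy_transform_sums z) simp
  have s': "(\<lambda>n. (taylor_coeff f n * z ^ n + (if n = 0 then cnj (f 0) else 0)) / 2) sums ((f z + cnj (f 0)) / 2)"
    by (intro sums_divide sums_add taylor_sums f z sums_single)
  have e: "(\<integral>\<zeta>. cnj \<zeta> ^ n * 1 \<partial>\<mu>) * z ^ n = (taylor_coeff f n * z ^ n + (if n = 0 then cnj (f 0) else 0)) / 2" for n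
    unfolding mult_1_right h[unfolded herglotz_moments_def, rule_format]
    by (cases "n = 0") (simp_all add: algebra_simps)
  show ?thesis using s s' unfolding e by (rule sums_unique2)
qed

lemma integrable_Cauchy_kernel:
  assumes "z \<in> unit_disc"
  shows "integrable \<mu> (\<lambda>\<zeta>. 1 / (1 - cnj \<zeta> * z))"
proof -
  have "1 - cnj \<zeta> * z \<noteq> 0" if "\<zeta> \<in> unit_circle" for \<zeta>
    using one_minus_cnj_mult_nz[of z \<zeta>] assms that
    by (metis complex_cnj_cnj complex_cnj_mult complex_cnj_one complex_cnj_diff complex_cnj_zero_iff
        dist_0_norm mem_ball mem_sphere mult.commute order_refl)
  then show ?thesis by (intro integrable_continuous continuous_intros) auto
qed

lemma poisson_eq_Cauchy:
  assumes z: "z \<in> unit_disc"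
  shows "(\<integral>\<zeta>. Re ((\<zeta> + z) / (\<zeta> - z)) \<partial>\<mu>) =
    Re (2 * (\<integral>\<zeta>. 1 / (1 - cnj \<zeta> * z) \<partial>\<mu>) - (\<integral>\<zeta>. 1 \<partial>\<mu>))"
proof -
  have "(\<integral>\<zeta>. Re ((\<zeta> + z) / (\<zeta> - z)) \<partial>\<mu>) = (\<integral>\<zeta>. Re (2 * (1 / (1 - cnj \<zeta> * z)) - 1) \<partial>\<mu>)"
  proof (rule integral_cong_circle)
    fix \<zeta> assume \<zeta>: "\<zeta> \<in> unit_circle"
    then have nz: "\<zeta> \<noteq> 0" "\<zeta> - z \<noteq> 0" using z by auto
    have "1 - cnj \<zeta> * z = cnj \<zeta> * (\<zeta> - z)" using circle_cnj_mult(2)[OF \<zeta>] by (simp add: algebra_simps)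
    also have "\<dots> = (\<zeta> - z) / \<zeta>" using circle_cnj_mult(2)[OF \<zeta>] nz by (simp add: field_simps)
    finally have e: "1 - cnj \<zeta> * z = (\<zeta> - z) / \<zeta>" .
    have "(\<zeta> + z) / (\<zeta> - z) = 2 * (1 / ((\<zeta> - z) / \<zeta>)) - 1"
      using nz by (simp add: field_simps)
    then show "Re ((\<zeta> + z) / (\<zeta> - z)) = Re (2 * (1 / (1 - cnj \<zeta> * z)) - 1)"
      unfolding e by simp
  qed
  also have "\<dots> = Re (\<integral>\<zeta>. 2 * (1 / (1 - cnj \<zeta> * z)) - 1 \<partial>\<mu>)"
    by (intro integral_Re Bochner_Integration.integrable_diff integrable_mult_right
        integrable_Cauchy_kernel z integrable_const)
  also have "(\<integral>\<zeta>. 2 * (1 / (1 - cnj \<zeta> * z)) - 1 \<partial>\<mu>) = 2 * (\<integral>\<zeta>. 1 / (1 - cnj \<zeta> * z) \<partial>\<mu>) - (\<integral>\<zeta>. 1 \<partial>\<mu>)"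
    using Bochner_Integration.integral_diff[OF
        integrable_mult_right[OF integrable_Cauchy_kernel[OF z], of 2] integrable_const[of 1]]
    by (simp only: integral_mult_right_zero)
  finally show ?thesis .
qed

text \<open>The Clark measure is defined by Poisson integrals but used through moments. To get back
  from the former, f is compared with the function q built from the moments: their real parts agree,
  so the Fourier coefficients on the circle of radius 1/2 agree. The undetermined imaginary constant
  of f cancels in f(0) plus its conjugate.\<close>

lemma poisson_iff_moments:
  assumes f: "f holomorphic_on unit_disc"
  shows "(\<forall>z\<in>unit_disc. Re (f z) = (\<integral>\<zeta>. Re ((\<zeta> + z) / (\<zeta> - z)) \<partial>\<mu>)) \<longleftrightarrow> herglotz_moments \<mu> f"
proof
  assume h: "herglotz_moments \<mu> f"
  have m: "(\<integral>\<zeta>. 1 \<partial>\<mu>) = (f 0 + cnj (f 0)) / 2"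
    using h[unfolded herglotz_moments_def, rule_format, of 0] by simp
  show "\<forall>z\<in>unit_disc. Re (f z) = (\<integral>\<zeta>. Re ((\<zeta> + z) / (\<zeta> - z)) \<partial>\<mu>)"
  proof
    fix z assume z: "z \<in> unit_disc"
    show "Re (f z) = (\<integral>\<zeta>. Re ((\<zeta> + z) / (\<zeta> - z)) \<partial>\<mu>)"
      unfolding poisson_eq_Cauchy[OF z] Cauchy_of_herglotz_moments[OF f h z] m by (simp add: field_simps)
  qed
next
  assume eq: "\<forall>z\<in>unit_disc. Re (f z) = (\<integral>\<zeta>. Re ((\<zeta> + z) / (\<zeta> - z)) \<partial>\<mu>)"
  define m where "m n = (\<integral>\<zeta>. cnj \<zeta> ^ n \<partial>\<mu>)" for n
  define q where "q z = 2 * (\<integral>\<zeta>. 1 / (1 - cnj \<zeta> * z) \<partial>\<mu>) - m 0" for z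
  let ?c = "\<lambda>n. if n = 0 then m 0 else 2 * m n"
  have m0: "cnj (m 0) = m 0" unfolding m_def by simp
  have qs: "(\<lambda>n. ?c n * z ^ n) sums q z" if z: "z \<in> unit_disc" for z
  proof -
    have "(\<lambda>n. m n * z ^ n) sums (\<integral>\<zeta>. 1 / (1 - cnj \<zeta> * z) \<partial>\<mu>)"
      using Cauchy_transform_sums[OF _ z, of "\<lambda>_. 1"] unfolding m_def by simp
    then have "(\<lambda>n. 2 * (m n * z ^ n) - (if n = 0 then m 0 else 0)) sums q z"
      unfolding q_def by (intro sums_diff sums_mult sums_single)
    moreover have "2 * (m n * z ^ n) - (if n = 0 then m 0 else 0) = ?c n * z ^ n" for n by simp
    ultimately show ?thesis by simp
  qed
  have q: "q holomorphic_on unit_disc" "taylor_coeff q = ?c"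
    using holomorphic_of_sums[OF qs] taylor_coeff_unique[OF qs] by auto
  have q0: "q 0 = m 0" using q(2) taylor_coeff_at_0[of q] by simp
  have Re: "Re (f z) = Re (q z)" if "z \<in> unit_disc" for z
    using eq that poisson_eq_Cauchy[OF that] unfolding q_def m_def by simp
  have "(taylor_coeff f n * of_real (1/2) ^ n + (if n = 0 then cnj (f 0) else 0)) / 2 =
      (taylor_coeff q n * of_real (1/2) ^ n + (if n = 0 then cnj (q 0) else 0)) / 2" for n
    unfolding circle_Re_fourier[OF f, of "1/2", symmetric, simplified] circle_Re_fourier[OF q(1), of "1/2", symmetric, simplified]
    using circle_Re_fourier[OF f, of "1/2" n] circle_Re_fourier[OF q(1), of "1/2" n]
      Re[OF circle_mem[of "1/2"]] by simp
  then have *: "taylor_coeff f n * of_real (1/2) ^ n + (if n = 0 then cnj (f 0) else 0) =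
      taylor_coeff q n * of_real (1/2) ^ n + (if n = 0 then cnj (q 0) else 0)" for n
    by (metis (no_types, lifting) divide_cancel_right zero_neq_numeral)
  show "herglotz_moments \<mu> f"
    unfolding herglotz_moments_def m_def[symmetric]
  proof
    fix n show "m n = (taylor_coeff f n + (if n = 0 then cnj (f 0) else 0)) / 2"
      using *[of n] q(2) q0 m0 by (cases "n = 0") auto
  qed
qed

end

lemma herglotz_moments_unique:
  assumes "circle_measure \<mu>" "circle_measure \<nu>" "herglotz_moments \<mu> f" "herglotz_moments \<nu> f"
  shows "\<mu> = \<nu>"
proof (rule circle_measure_eqI[OF assms(1,2)])
  fix n
  have "(\<integral>\<zeta>. cnj \<zeta> ^ n \<partial>\<mu>) = (\<integral>\<zeta>. cnj \<zeta> ^ n \<partial>\<nu>)"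
    using assms(3,4) unfolding herglotz_moments_def by metis
  from arg_cong[OF this, of cnj] show "(\<integral>\<zeta>. \<zeta> ^ n \<partial>\<mu>) = (\<integral>\<zeta>. \<zeta> ^ n \<partial>\<nu>)"
    by (simp flip: Bochner_Integration.integral_cnj)
qed

section \<open>Clark measures of an inner function\<close>

locale clark = nonconstant_inner +
  fixes \<beta> :: complex
  assumes \<beta>: "\<beta> \<in> unit_circle"
begin

abbreviation \<mu> :: "complex measure" where
  "\<mu> \<equiv> clark_measure u \<beta>"

text \<open>The Cayley transform of cnj \<beta> u; it maps the disc to the right half-plane, and its
  real part is the Poisson integral that defines the Clark measure.\<close>

definition herg :: "complex \<Rightarrow> complex" where
  "herg z = (1 + cnj \<beta> * u z) / (1 - cnj \<beta> * u z)"

lemma cmod_\<beta>u: "z \<in> unit_disc \<Longrightarrow> cmod (cnj \<beta> * u z) < 1"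
  using u_lt_1[of z] \<beta> by (simp add: norm_mult)

lemma \<beta>u_ne_1: "z \<in> unit_disc \<Longrightarrow> 1 - cnj \<beta> * u z \<noteq> 0"
  using cmod_\<beta>u[of z] by (metis eq_iff_diff_eq_0 norm_one less_irrefl)

lemma herg_holo: "herg holomorphic_on unit_disc"
  unfolding herg_def using \<beta>u_ne_1 by (intro holomorphic_intros u_holo) auto

lemma herg_Re:
  assumes "z \<in> unit_disc"
  shows "Re (herg z) = (1 - (cmod (u z))\<^sup>2) / (cmod (1 - cnj \<beta> * u z))\<^sup>2"
proof -
  define b where "b = cnj \<beta> * u z"
  have "herg z = (1 + b) * cnj (1 - b) / of_real ((cmod (1 - b))\<^sup>2)"
    unfolding herg_def b_def[symmetric] by (subst complex_div_cnj) simp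
  moreover have "Re ((1 + b) * cnj (1 - b)) = 1 - (cmod b)\<^sup>2"
    by (simp add: cmod_power2) (simp add: power2_eq_square algebra_simps)
  moreover have "cmod b = cmod (u z)" unfolding b_def using \<beta> by (simp add: norm_mult)
  ultimately show ?thesis unfolding b_def[symmetric] by (simp only: Re_divide_of_real)
qed

lemma herg_pos:
  assumes "z \<in> unit_disc"
  shows "Re (herg z) > 0"
  unfolding herg_Re[OF assms] using u_lt_1[OF assms] \<beta>u_ne_1[OF assms]
  by (simp add: abs_square_less_1)

text \<open>Herglotz gives existence and the moments give uniqueness; together they justify the
  definite description in \<open>clark_measure\<close>.\<close>

lemma circle_measure_\<mu>: "circle_measure \<mu>" and herglotz_\<mu>: "herglotz_moments \<mu> herg"
proof -
  let ?P = "\<lambda>\<mu>. sets \<mu> = sets borel_circle \<and> finite_measure \<mu> \<and>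
     (\<forall>z\<in>unit_disc. Re ((1 + cnj \<beta> * u z) / (1 - cnj \<beta> * u z)) = (\<integral>\<zeta>. Re ((\<zeta> + z) / (\<zeta> - z)) \<partial>\<mu>))"
  have iff: "?P \<nu> \<longleftrightarrow> circle_measure \<nu> \<and> herglotz_moments \<nu> herg" for \<nu>
    using circle_measure.poisson_iff_moments[of \<nu>, OF _ herg_holo]
    unfolding herg_def[symmetric] circle_measure_def circle_measure_axioms_def by auto
  obtain \<nu> where \<nu>: "circle_measure \<nu>" "herglotz_moments \<nu> herg"
    using herglotz_exists[OF herg_holo] herg_pos by (metis centre_in_ball less_imp_le zero_less_one)
  have "\<exists>!\<nu>. ?P \<nu>"
    unfolding iff using \<nu> herglotz_moments_unique by blast
  from theI'[OF this] have "?P \<mu>" unfolding clark_measure_def .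
  then show "circle_measure \<mu>" "herglotz_moments \<mu> herg" unfolding iff by auto
qed

end

sublocale clark \<subseteq> \<mu>: circle_measure "clark_measure u \<beta>"
  by (rule circle_measure_\<mu>)

context clark
begin

lemma Cauchy_\<mu>: "z \<in> unit_disc \<Longrightarrow> (\<integral>\<zeta>. 1 / (1 - cnj \<zeta> * z) \<partial>\<mu>) = (herg z + cnj (herg 0)) / 2"
  by (rule \<mu>.Cauchy_of_herglotz_moments[OF herg_holo herglotz_\<mu>])

lemma mass_\<mu>: "(\<integral>\<zeta>. 1 \<partial>\<mu>) = complex_of_real (Re (herg 0))"
  using herglotz_\<mu>[unfolded herglotz_moments_def, rule_format, of 0]
  by (simp add: complex_add_cnj del: lebesgue_integral_const)

end

section \<open>The Clark transform\<close>

lemma disc_denominator_nz: "z \<in> unit_disc \<Longrightarrow> \<zeta> \<in> unit_circle \<Longrightarrow> 1 - cnj \<zeta> * z \<noteq> 0"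
  using one_minus_cnj_mult_nz[of z \<zeta>] by (auto simp: complex_eq_iff mult.commute)

lemma L2_eq_sqint: "L2 M = sqint M"
  unfolding L2_def sqint_def ..

context circle_measure
begin

lemma sqint_continuous: "continuous_on unit_circle f \<Longrightarrow> f \<in> sqint \<mu>"
proof -
  assume f: "continuous_on unit_circle f"
  have "bounded (f ` unit_circle)"
    using f by (intro compact_imp_bounded compact_continuous_image) auto
  then obtain B where "\<forall>x\<in>unit_circle. cmod (f x) \<le> B" unfolding bounded_iff by blast
  then show ?thesis
    using measurable_of_continuous[OF f] space_circle
    by (intro sqint_bounded[of _ _ B]) (auto simp: finite_measure_axioms)
qed

lemma integrable_sqint: "f \<in> sqint \<mu> \<Longrightarrow> integrable \<mu> f"
  using integrable_sqint_mult[of f \<mu> "\<lambda>_. 1"] sqint_continuous[of "\<lambda>_. 1"] by simp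

lemma sqint_circle_mult: "f \<in> sqint \<mu> \<Longrightarrow> (\<lambda>\<zeta>. \<zeta> * f \<zeta>) \<in> sqint \<mu>"
  using space_circle by (intro sqint_bounded_mult[of _ _ _ 1] measurable_of_continuous continuous_intros) auto

end

context clark
begin

abbreviation L :: "(complex \<Rightarrow> complex) set" where
  "L \<equiv> sqint \<mu>"

abbreviation V :: "(complex \<Rightarrow> complex) \<Rightarrow> (complex \<Rightarrow> complex)" where
  "V \<equiv> clark_V u \<beta>"

text \<open>The scaled Cauchy kernel for which the value of \<open>V f\<close> at z is the inner
  product of f with \<open>kap z\<close>. Its counterpart in the model space is the reproducing
  kernel \<open>ku z\<close>.\<close>

definition kap :: "complex \<Rightarrow> complex \<Rightarrow> complex" where
  "kap z = (\<lambda>\<zeta>. cnj ((1 - cnj \<beta> * u z) / (1 - cnj \<zeta> * z)))"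

lemma kap_L: "z \<in> unit_disc \<Longrightarrow> kap z \<in> L"
  unfolding kap_def using disc_denominator_nz
  by (intro \<mu>.sqint_continuous continuous_intros) auto

lemma V_eq_sqip: "z \<in> unit_disc \<Longrightarrow> V f z = sqip \<mu> f (kap z)"
proof -
  assume z: "z \<in> unit_disc"
  have "sqip \<mu> f (kap z) = (\<integral>\<zeta>. (1 - cnj \<beta> * u z) * (f \<zeta> / (1 - cnj \<zeta> * z)) \<partial>\<mu>)"
    unfolding sqip_def kap_def complex_cnj_cnj
    by (intro Bochner_Integration.integral_cong) (auto simp: mult.commute)
  also have "\<dots> = (1 - cnj \<beta> * u z) * (\<integral>\<zeta>. f \<zeta> / (1 - cnj \<zeta> * z) \<partial>\<mu>)"
    by (rule integral_mult_right_zero)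
  finally show ?thesis using z unfolding clark_V_def by simp
qed

lemma V_outside: "z \<notin> unit_disc \<Longrightarrow> V f z = 0"
  unfolding clark_V_def by simp

text \<open>With p = cnj \<zeta> z and q = \<zeta> cnj w, 1/((1 - p)(1 - q)) = (1/(1 - p) + 1/(1 -
  q) - 1)/(1 - pq), and on the circle pq = cnj w z is free of \<zeta>. So the integral reduces to
  two Cauchy transforms and the total mass, all known through \<open>herg\<close>.\<close>

lemma kap_gram:
  assumes w: "w \<in> unit_disc" and z: "z \<in> unit_disc"
  shows "sqip \<mu> (kap w) (kap z) = h2_inner (ku w) (ku z)"
proof -
  define C where "C z = (\<integral>\<zeta>. 1 / (1 - cnj \<zeta> * z) \<partial>\<mu>)" for z
  define b where "b = cnj \<beta> * u z"
  define c where "c = cnj (cnj \<beta> * u w)"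
  define d where "d = 1 - cnj w * z"
  have nz: "1 - b \<noteq> 0" "1 - c \<noteq> 0"
  proof -
    show "1 - b \<noteq> 0" using \<beta>u_ne_1[OF z] unfolding b_def .
    have "cnj (1 - cnj \<beta> * u w) \<noteq> 0" using \<beta>u_ne_1[OF w] complex_cnj_zero_iff by blast
    then show "1 - c \<noteq> 0" unfolding c_def by simp
  qed
  have d: "d \<noteq> 0" unfolding d_def using one_minus_cnj_mult_nz[of w z] w z by simp
  note iz = \<mu>.integrable_Cauchy_kernel[OF z] and iw = \<mu>.integrable_Cauchy_kernel[OF w]
  have iw': "integrable \<mu> (\<lambda>\<zeta>. cnj (1 / (1 - cnj \<zeta> * w)))" using iw by (rule integrable_cnj)
  have "sqip \<mu> (kap w) (kap z) =
      (\<integral>\<zeta>. (1 - b) * (1 - c) / d * (1 / (1 - cnj \<zeta> * z) + cnj (1 / (1 - cnj \<zeta> * w)) - 1) \<partial>\<mu>)"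
    unfolding sqip_def
  proof (rule \<mu>.integral_cong_circle)
    fix \<zeta> assume \<zeta>: "\<zeta> \<in> unit_circle"
    define p where "p = cnj \<zeta> * z"
    define q where "q = cnj (cnj \<zeta> * w)"
    have p: "1 - p \<noteq> 0" using disc_denominator_nz[OF z \<zeta>] unfolding p_def .
    have "cnj (1 - cnj \<zeta> * w) \<noteq> 0" using disc_denominator_nz[OF w \<zeta>] complex_cnj_zero_iff by blast
    then have q: "1 - q \<noteq> 0" unfolding q_def by simp
    have "p * q = (cnj \<zeta> * \<zeta>) * (cnj w * z)" unfolding p_def q_def by simp
    then have pq: "d = 1 - p * q" using circle_cnj_mult(2)[OF \<zeta>] unfolding d_def by simp
    have k: "kap w \<zeta> * cnj (kap z \<zeta>) = (1 - c) / (1 - q) * ((1 - b) / (1 - p))"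
      unfolding kap_def p_def q_def b_def c_def by simp
    have r: "cnj (1 / (1 - cnj \<zeta> * w)) = 1 / (1 - q)" unfolding q_def by simp
    have "(1 - c) / (1 - q) * ((1 - b) / (1 - p)) = (1 - b) * (1 - c) * (1 / ((1 - p) * (1 - q)))"
      using p q by (simp add: field_simps)
    also have "1 / ((1 - p) * (1 - q)) = (1 / (1 - p) + 1 / (1 - q) - 1) / d"
    proof -
      have "1 / (1 - p) + 1 / (1 - q) - 1 = d / ((1 - p) * (1 - q))"
      proof -
        have "1 / P + 1 / Q - 1 = (1 - (1 - P) * (1 - Q)) / (P * Q)" if "P \<noteq> 0" "Q \<noteq> 0" for P Q :: complex
          using that by (simp add: field_simps)
        from this[OF p q] show ?thesis unfolding pq by simp
      qed
      then show ?thesis using d by simp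
    qed
    finally show "kap w \<zeta> * cnj (kap z \<zeta>) =
        (1 - b) * (1 - c) / d * (1 / (1 - cnj \<zeta> * z) + cnj (1 / (1 - cnj \<zeta> * w)) - 1)"
      unfolding k r p_def[symmetric] by simp
  qed
  also have "\<dots> = (1 - b) * (1 - c) / d * (\<integral>\<zeta>. (1 / (1 - cnj \<zeta> * z) + cnj (1 / (1 - cnj \<zeta> * w)) - 1) \<partial>\<mu>)"
    by (rule integral_mult_right_zero)
  also have "(\<integral>\<zeta>. (1 / (1 - cnj \<zeta> * z) + cnj (1 / (1 - cnj \<zeta> * w)) - 1) \<partial>\<mu>) =
      (\<integral>\<zeta>. 1 / (1 - cnj \<zeta> * z) \<partial>\<mu>) + (\<integral>\<zeta>. cnj (1 / (1 - cnj \<zeta> * w)) \<partial>\<mu>) - (\<integral>\<zeta>. 1 \<partial>\<mu>)"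
    using Bochner_Integration.integral_diff[OF Bochner_Integration.integrable_add[OF iz iw'] \<mu>.integrable_const]
      Bochner_Integration.integral_add[OF iz iw'] by metis
  also have "(\<integral>\<zeta>. cnj (1 / (1 - cnj \<zeta> * w)) \<partial>\<mu>) = cnj (\<integral>\<zeta>. 1 / (1 - cnj \<zeta> * w) \<partial>\<mu>)"
    by (rule Bochner_Integration.integral_cnj)
  also have "(\<integral>\<zeta>. 1 / (1 - cnj \<zeta> * z) \<partial>\<mu>) + cnj (\<integral>\<zeta>. 1 / (1 - cnj \<zeta> * w) \<partial>\<mu>) - (\<integral>\<zeta>. 1 \<partial>\<mu>) =
      (herg z + cnj (herg w)) / 2"
    unfolding Cauchy_\<mu>[OF z] Cauchy_\<mu>[OF w] mass_\<mu> by (simp add: complex_eq_iff field_simps)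
  also have "herg z = (1 + b) / (1 - b)" unfolding herg_def b_def ..
  also have "cnj (herg w) = (1 + c) / (1 - c)" unfolding herg_def c_def by simp
  also have "(1 - b) * (1 - c) / d * (((1 + b) / (1 - b) + (1 + c) / (1 - c)) / 2) = (1 - b * c) / d"
  proof -
    have e: "(1 + b) / (1 - b) + (1 + c) / (1 - c) = 2 * (1 - b * c) / ((1 - b) * (1 - c))"
      using nz by (simp add: field_simps)
    have "P * Q / d * (2 * X / (P * Q) / 2) = X / d" if "P \<noteq> 0" "Q \<noteq> 0" for P Q X :: complex
      using that by simp
    from this[OF nz] show ?thesis unfolding e .
  qed
  also have "b * c = (cnj \<beta> * \<beta>) * (cnj (u w) * u z)" unfolding b_def c_def by simp
  also have "(1 - (cnj \<beta> * \<beta>) * (cnj (u w) * u z)) / d = ku w z"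
    unfolding ku_eval[OF z] d_def circle_cnj_mult(2)[OF \<beta>] by simp
  also have "\<dots> = h2_inner (ku w) (ku z)" using ku_inner[OF ku_K[OF w] z] by simp
  finally show ?thesis .
qed

text \<open>The kernels are indexed by all complex numbers, with the index 0 used outside the disc.\<close>

definition into_disc :: "complex \<Rightarrow> complex" where
  "into_disc w = (if w \<in> unit_disc then w else 0)"

lemma into_disc: "into_disc w \<in> unit_disc" "w \<in> unit_disc \<Longrightarrow> into_disc w = w"
  unfolding into_disc_def by auto

lemma ku_total:
  assumes "f \<in> K" "\<And>w. h2_inner f (ku (into_disc w)) = 0"
  shows "Re (h2_inner f f) = 0"
proof -
  have "f w = 0" if "w \<in> unit_disc" for w
    using assms(2)[of w] ku_inner[OF assms(1) that] into_disc(2)[OF that] by simp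
  then have "f = (\<lambda>_. 0)" using H2_eqI[OF K_H2[OF assms(1)] zero_H2(1)] by simp
  then show ?thesis using K.ip_zero[OF K.zero_mem] by simp
qed

text \<open>The future Clark transform of \<open>cnj\<close>, given explicitly because membership of
  Clark transforms in the model space becomes available only after the kernels are known to be
  total.\<close>

definition vcnj :: "complex \<Rightarrow> complex" where
  "vcnj = (\<lambda>z. cnj \<beta> / (1 - cnj \<beta> * u 0) * k0_conj u z)"

lemma vcnj_K: "vcnj \<in> K"
  unfolding vcnj_def by (intro K.scale_mem kt_K)

lemma cnj_L: "cnj \<in> L"
  by (intro \<mu>.sqint_continuous continuous_intros)

text \<open>Multiplication by cnj \<zeta> shifts the moments by one, so the Cauchy transform of
  \<open>cnj\<close> is half the backward shift of \<open>herg\<close>. Expressing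
  \<open>herg\<close> through u leaves a multiple of \<open>k0_conj u\<close>.\<close>

lemma V_cnj:
  assumes z: "z \<in> unit_disc"
  shows "sqip \<mu> cnj (kap z) = vcnj z"
proof -
  have "integrable \<mu> cnj" using \<mu>.integrable_sqint[OF cnj_L] .
  from \<mu>.Cauchy_transform_sums[OF this z]
  have s: "(\<lambda>n. (\<integral>\<zeta>. cnj \<zeta> ^ Suc n \<partial>\<mu>) * z ^ n) sums (\<integral>\<zeta>. cnj \<zeta> / (1 - cnj \<zeta> * z) \<partial>\<mu>)"
    by (simp add: mult.commute)
  have m: "(\<integral>\<zeta>. cnj \<zeta> ^ Suc n \<partial>\<mu>) = taylor_coeff herg (Suc n) / 2" for n
    using herglotz_\<mu>[unfolded herglotz_moments_def, rule_format, of "Suc n"] by simp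
  have s': "(\<lambda>n. taylor_coeff herg (Suc n) * z ^ n / 2) sums (k0_conj herg z / 2)"
    by (intro sums_divide k0_conj_sums herg_holo z)
  from s have "(\<lambda>n. taylor_coeff herg (Suc n) * z ^ n / 2) sums (\<integral>\<zeta>. cnj \<zeta> / (1 - cnj \<zeta> * z) \<partial>\<mu>)"
    unfolding m by simp
  then have I: "(\<integral>\<zeta>. cnj \<zeta> / (1 - cnj \<zeta> * z) \<partial>\<mu>) = k0_conj herg z / 2"
    using s' by (rule sums_unique2)
  have nz: "1 - cnj \<beta> * u z \<noteq> 0" "1 - cnj \<beta> * u 0 \<noteq> 0" using \<beta>u_ne_1 z by auto
  have "(1 - cnj \<beta> * u z) * (k0_conj herg z / 2) = vcnj z"
  proof (cases "z = 0")
    case True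
    have "(u has_field_derivative deriv u 0) (at 0)"
      using holomorphic_derivI[OF u_holo, of 0] by simp
    then have "(herg has_field_derivative 2 * cnj \<beta> * deriv u 0 / (1 - cnj \<beta> * u 0)\<^sup>2) (at 0)"
      unfolding herg_def using nz
      by (auto intro!: derivative_eq_intros simp: power2_eq_square field_simps)
    then have "deriv herg 0 = 2 * cnj \<beta> * deriv u 0 / (1 - cnj \<beta> * u 0)\<^sup>2"
      by (rule DERIV_imp_deriv)
    then show ?thesis
      unfolding vcnj_def k0_conj_def using True nz by (simp add: power2_eq_square)
  next
    case False
    have "herg z - herg 0 = 2 * cnj \<beta> * (u z - u 0) / ((1 - cnj \<beta> * u z) * (1 - cnj \<beta> * u 0))"
      unfolding herg_def using nz by (simp add: field_simps)
    then show ?thesis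
      unfolding vcnj_def k0_conj_def using False nz z by simp
  qed
  then show ?thesis
    using V_eq_sqip[OF z, of cnj] z unfolding clark_V_def I by simp
qed

lemma vcnj_sqn: "Re (h2_inner vcnj vcnj) = Re (sqip \<mu> cnj cnj)"
proof -
  have "sqip \<mu> cnj cnj = (\<integral>\<zeta>. 1 \<partial>\<mu>)"
    unfolding sqip_def by (intro \<mu>.integral_cong_circle) (simp add: circle_cnj_mult(2))
  then have 1: "Re (sqip \<mu> cnj cnj) = (1 - (cmod (u 0))\<^sup>2) / (cmod (1 - cnj \<beta> * u 0))\<^sup>2"
    unfolding mass_\<mu> using herg_Re[of 0] by simp
  define a where "a = cnj \<beta> / (1 - cnj \<beta> * u 0)"
  have "h2_inner vcnj vcnj = a * (cnj a * h2_inner (k0_conj u) (k0_conj u))"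
    unfolding vcnj_def a_def[symmetric] using kt_K by (simp add: K.ips K.mems)
  also have "\<dots> = of_real ((cmod a)\<^sup>2 * (1 - (cmod (u 0))\<^sup>2))"
    unfolding kt_sqn by (simp add: complex_norm_square[unfolded of_real_power])
  finally have "Re (h2_inner vcnj vcnj) = (cmod a)\<^sup>2 * (1 - (cmod (u 0))\<^sup>2)" by simp
  moreover have "(cmod a)\<^sup>2 = 1 / (cmod (1 - cnj \<beta> * u 0))\<^sup>2"
    unfolding a_def using \<beta> by (simp add: norm_divide power_divide)
  ultimately show ?thesis unfolding 1 by simp
qed

interpretation L: semi_hilbert "sqint (clark_measure u \<beta>)" "sqip (clark_measure u \<beta>)"
  by (rule semi_hilbert_sqint)

text \<open>\<open>cnj\<close> lies in the closed span of the kernels because its projection onto that span has norm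
  \<open>\<parallel>vcnj\<parallel> = \<parallel>cnj\<parallel>\<close>. This equality uses that \<open>u\<close> is inner and not merely bounded by 1; it is what
  makes the analytic polynomials dense in \<open>L\<^sup>2\<close> of the Clark measure.\<close>

lemma cnj_in_closed_span:
  assumes y: "y \<in> L" "\<And>z. z \<in> unit_disc \<Longrightarrow> sqip \<mu> y (kap z) = 0"
  shows "(\<integral>\<zeta>. \<zeta> * y \<zeta> \<partial>\<mu>) = 0"
proof -
  \<comment> \<open>x is the projection of \<open>cnj\<close> onto the closed span of the kernels:
    it lies in that span and has the same inner products with the kernels as \<open>cnj\<close>,
    namely the values of \<open>vcnj\<close>.\<close>
  obtain x where x: "x \<in> L" "\<And>w. sqip \<mu> x (kap (into_disc w)) = h2_inner vcnj (ku (into_disc w))"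
    "L.sqn x = Re (h2_inner vcnj vcnj)"
    "\<And>z. z \<in> L \<Longrightarrow> (\<And>w. sqip \<mu> z (kap (into_disc w)) = 0) \<Longrightarrow> sqip \<mu> x z = 0"
    using isometry_transfer[OF semi_hilbert_K semi_hilbert_sqint[of \<mu>],
        of "\<lambda>w. ku (into_disc w)" "\<lambda>w. kap (into_disc w)" vcnj]
      ku_K kap_L into_disc(1) kap_gram ku_total vcnj_K by (metis (no_types, lifting))
  have d: "(\<lambda>\<zeta>. cnj \<zeta> - x \<zeta>) \<in> L" using L.diff_mem[OF cnj_L x(1)] .
  have "sqip \<mu> (\<lambda>\<zeta>. cnj \<zeta> - x \<zeta>) (kap (into_disc w)) = 0" for w
    using L.ip_diff[OF cnj_L x(1) kap_L[OF into_disc(1)]] x(2)[of w] V_cnj[OF into_disc(1)]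
      ku_inner[OF vcnj_K into_disc(1)] by simp
  then have xd: "sqip \<mu> x (\<lambda>\<zeta>. cnj \<zeta> - x \<zeta>) = 0" using x(4)[OF d] by blast
  then have "sqip \<mu> x cnj = sqip \<mu> x x" using L.ip_diff_right[OF cnj_L x(1) x(1)] by simp
  moreover have "sqip \<mu> cnj x = cnj (sqip \<mu> x cnj)" by (rule L.ip_sym[OF x(1) cnj_L])
  ultimately have "L.sqn (\<lambda>\<zeta>. cnj \<zeta> - x \<zeta>) = L.sqn cnj - L.sqn x"
    using cnj_L x(1) by (simp add: L.ips L.mems)
  then have "L.sqn (\<lambda>\<zeta>. cnj \<zeta> - x \<zeta>) = 0" using x(3) vcnj_sqn by simp
  then have "sqip \<mu> (\<lambda>\<zeta>. cnj \<zeta> - x \<zeta>) y = 0" using L.ip_eq_0_of_sqn_0[OF d y(1)] by simp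
  moreover have "sqip \<mu> x y = 0" using x(4)[OF y(1)] y(2) into_disc(1) by blast
  ultimately have "sqip \<mu> cnj y = 0" using L.ip_diff[OF cnj_L x(1) y(1)] by simp
  then have "sqip \<mu> y cnj = 0" using L.ip_sym[OF cnj_L y(1)] by simp
  then show ?thesis unfolding sqip_def by (simp add: mult.commute)
qed

text \<open>The factor 1 - cnj \<beta> u has no zeros, so orthogonality to all kernels says that the
  Cauchy transform, and with it every Taylor coefficient, vanishes.\<close>

lemma kap_orth_iff_moments:
  assumes y: "y \<in> L"
  shows "(\<forall>z\<in>unit_disc. sqip \<mu> y (kap z) = 0) \<longleftrightarrow> (\<forall>n. (\<integral>\<zeta>. cnj \<zeta> ^ n * y \<zeta> \<partial>\<mu>) = 0)"
proof -
  let ?C = "\<lambda>z. \<integral>\<zeta>. y \<zeta> / (1 - cnj \<zeta> * z) \<partial>\<mu>"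
  have s: "(\<lambda>n. (\<integral>\<zeta>. cnj \<zeta> ^ n * y \<zeta> \<partial>\<mu>) * z ^ n) sums ?C z" if "z \<in> unit_disc" for z
    using \<mu>.Cauchy_transform_sums[OF \<mu>.integrable_sqint[OF y] that] .
  have "(\<forall>z\<in>unit_disc. sqip \<mu> y (kap z) = 0) \<longleftrightarrow> (\<forall>z\<in>unit_disc. ?C z = 0)"
    using V_eq_sqip[of _ y] \<beta>u_ne_1 unfolding clark_V_def by auto
  also have "\<dots> \<longleftrightarrow> (\<forall>n. (\<integral>\<zeta>. cnj \<zeta> ^ n * y \<zeta> \<partial>\<mu>) = 0)"
  proof
    assume C0: "\<forall>z\<in>unit_disc. ?C z = 0"
    have "taylor_coeff (\<lambda>_. 0) = (\<lambda>n. \<integral>\<zeta>. cnj \<zeta> ^ n * y \<zeta> \<partial>\<mu>)"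
      using s C0 by (intro taylor_coeff_unique) simp
    then show "\<forall>n. (\<integral>\<zeta>. cnj \<zeta> ^ n * y \<zeta> \<partial>\<mu>) = 0"
      unfolding zero_H2(2) by metis
  next
    assume m: "\<forall>n. (\<integral>\<zeta>. cnj \<zeta> ^ n * y \<zeta> \<partial>\<mu>) = 0"
    show "\<forall>z\<in>unit_disc. ?C z = 0"
    proof
      fix z :: complex assume "z \<in> unit_disc"
      from s[OF this] have "(\<lambda>_. 0) sums ?C z" by (simp add: m)
      then show "?C z = 0" by (simp add: sums_0 sums_unique2)
    qed
  qed
  finally show ?thesis .
qed

text \<open>Orthogonality to the kernels passes from y to \<zeta> y: the moments of \<zeta> y with n
  > 0 are earlier moments of y, and the one with n = 0 is supplied by
  \<open>cnj_in_closed_span\<close>. Iteration adds the moments against powers of \<zeta> to those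
  against powers of cnj \<zeta>.\<close>

lemma kap_total:
  assumes "y \<in> L" "\<And>z. z \<in> unit_disc \<Longrightarrow> sqip \<mu> y (kap z) = 0"
  shows "AE \<zeta> in \<mu>. y \<zeta> = 0"
proof -
  have P: "(\<lambda>\<zeta>. \<zeta> ^ k * y \<zeta>) \<in> L \<and> (\<forall>n. (\<integral>\<zeta>. cnj \<zeta> ^ n * (\<zeta> ^ k * y \<zeta>) \<partial>\<mu>) = 0)" for k
  proof (induction k)
    case 0
    then show ?case using assms kap_orth_iff_moments[OF assms(1)] by simp
  next
    case (Suc k)
    let ?y = "\<lambda>\<zeta>. \<zeta> ^ k * y \<zeta>"
    have y: "?y \<in> L" "\<And>n. (\<integral>\<zeta>. cnj \<zeta> ^ n * ?y \<zeta> \<partial>\<mu>) = 0" using Suc by auto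
    have "(\<integral>\<zeta>. cnj \<zeta> ^ n * (\<zeta> * ?y \<zeta>) \<partial>\<mu>) = 0" for n
    proof (cases n)
      case 0
      then show ?thesis using cnj_in_closed_span[OF y(1)] kap_orth_iff_moments[OF y(1)] y(2) by simp
    next
      case (Suc m)
      have "(\<integral>\<zeta>. cnj \<zeta> ^ n * (\<zeta> * ?y \<zeta>) \<partial>\<mu>) = (\<integral>\<zeta>. cnj \<zeta> ^ m * ?y \<zeta> \<partial>\<mu>)"
      proof (rule \<mu>.integral_cong_circle)
        fix \<zeta> assume \<zeta>: "\<zeta> \<in> unit_circle"
        have "cnj \<zeta> ^ n * (\<zeta> * ?y \<zeta>) = (cnj \<zeta> * \<zeta>) * (cnj \<zeta> ^ m * ?y \<zeta>)"
          unfolding Suc by simp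
        then show "cnj \<zeta> ^ n * (\<zeta> * ?y \<zeta>) = cnj \<zeta> ^ m * ?y \<zeta>"
          unfolding circle_cnj_mult(2)[OF \<zeta>] by simp
      qed
      then show ?thesis using y(2) by simp
    qed
    then show ?case using \<mu>.sqint_circle_mult[OF y(1)] by (simp add: mult.assoc)
  qed
  show ?thesis
  proof (rule \<mu>.moments_zero)
    show "integrable \<mu> y" using \<mu>.integrable_sqint[OF assms(1)] .
    show "(\<integral>\<zeta>. \<zeta> ^ n * y \<zeta> \<partial>\<mu>) = 0" for n using P[of n] by (metis (no_types, lifting) Bochner_Integration.integral_cong mult_1 power_0)
    show "(\<integral>\<zeta>. cnj \<zeta> ^ n * y \<zeta> \<partial>\<mu>) = 0" for n using P[of 0] by simp
  qed
qed

lemma V_lin: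
  assumes "f \<in> L" "g \<in> L"
  shows "V (\<lambda>\<zeta>. c * f \<zeta> + g \<zeta>) = (\<lambda>z. c * V f z + V g z)"
proof
  fix z show "V (\<lambda>\<zeta>. c * f \<zeta> + g \<zeta>) z = c * V f z + V g z"
    using L.ip_lin[OF assms kap_L] by (cases "z \<in> unit_disc") (simp_all add: V_eq_sqip V_outside)
qed

text \<open>Transfer from the Cauchy kernels to the reproducing kernels yields an element of the
  model space whose inner products with the latter are prescribed by f. These are its point values,
  so it is \<open>V f\<close>; totality of the Cauchy kernels makes the norms agree.\<close>

lemma V_K: "f \<in> L \<Longrightarrow> V f \<in> K"
  and V_sqn: "f \<in> L \<Longrightarrow> Re (h2_inner (V f) (V f)) = Re (sqip \<mu> f f)"
proof -
  have *: "V f \<in> K \<and> Re (h2_inner (V f) (V f)) = Re (sqip \<mu> f f)" if f: "f \<in> L"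
  proof -
    have tot: "L.sqn x = 0" if "x \<in> L" "\<And>w. sqip \<mu> x (kap (into_disc w)) = 0" for x
      using kap_total[OF that(1)] that(2) into_disc(2) sqip_zero_iff_AE[OF that(1)] by metis
    obtain y where y: "y \<in> K" "\<And>w. h2_inner y (ku (into_disc w)) = sqip \<mu> f (kap (into_disc w))"
      "Re (h2_inner y y) = Re (sqip \<mu> f f)"
      using isometry_transfer[OF semi_hilbert_sqint[of \<mu>] semi_hilbert_K,
          of "\<lambda>w. kap (into_disc w)" "\<lambda>w. ku (into_disc w)" f]
        ku_K kap_L into_disc(1) kap_gram tot f by (metis (no_types, lifting))
    have "y = V f"
    proof
      fix z show "y z = V f z"
        using y(2)[of z] ku_inner[OF y(1)] V_eq_sqip[of z f] into_disc(2)[of z]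
          H2D(2)[OF K_H2[OF y(1)]] V_outside[of z f] by (cases "z \<in> unit_disc") auto
    qed
    then show ?thesis using y by simp
  qed
  show "f \<in> L \<Longrightarrow> V f \<in> K" "f \<in> L \<Longrightarrow> Re (h2_inner (V f) (V f)) = Re (sqip \<mu> f f)"
    using * by auto
qed

lemma V_inner: "f \<in> L \<Longrightarrow> g \<in> L \<Longrightarrow> h2_inner (V f) (V g) = sqip \<mu> f g"
  by (rule semi_hilbert_polarization[OF semi_hilbert_sqint[of \<mu>] semi_hilbert_K, of V])
    (auto simp: V_K V_lin V_sqn)

text \<open>Transfer in the opposite direction, from the reproducing kernels to the Cauchy kernels;
  totality now holds because elements of the model space are determined by their values.\<close>

lemma V_surj:
  assumes "g \<in> K"
  shows "\<exists>f\<in>L. V f = g"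
proof -
  obtain x where x: "x \<in> L" "\<And>w. sqip \<mu> x (kap (into_disc w)) = h2_inner g (ku (into_disc w))"
    using isometry_transfer[OF semi_hilbert_K semi_hilbert_sqint[of \<mu>],
        of "\<lambda>w. ku (into_disc w)" "\<lambda>w. kap (into_disc w)" g]
      ku_K kap_L into_disc(1) kap_gram ku_total assms by (metis (no_types, lifting))
  have "V x = g"
  proof
    fix z show "V x z = g z"
      using x(2)[of z] ku_inner[OF assms] V_eq_sqip[of z x] into_disc(2)[of z]
        H2D(2)[OF K_H2[OF assms]] V_outside[of z x] by (cases "z \<in> unit_disc") auto
  qed
  then show ?thesis using x(1) by blast
qed

lemma V_cong_AE: "f \<in> L \<Longrightarrow> g \<in> L \<Longrightarrow> V f = V g \<longleftrightarrow> (AE \<zeta> in \<mu>. f \<zeta> = g \<zeta>)"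
proof -
  assume f: "f \<in> L" and g: "g \<in> L"
  have d: "(\<lambda>\<zeta>. f \<zeta> - g \<zeta>) \<in> L" using L.diff_mem[OF f g] .
  have Vd: "V (\<lambda>\<zeta>. f \<zeta> - g \<zeta>) = (\<lambda>z. V f z - V g z)" using V_lin[OF g f, of "-1"] by simp
  have "V f = V g \<longleftrightarrow> V (\<lambda>\<zeta>. f \<zeta> - g \<zeta>) = (\<lambda>_. 0)" unfolding Vd by (auto simp: fun_eq_iff)
  also have "\<dots> \<longleftrightarrow> Re (h2_inner (V (\<lambda>\<zeta>. f \<zeta> - g \<zeta>)) (V (\<lambda>\<zeta>. f \<zeta> - g \<zeta>))) = 0"
    using K_definite[OF V_K[OF d]] K.ip_zero[OF K.zero_mem] by auto
  also have "\<dots> \<longleftrightarrow> (AE \<zeta> in \<mu>. f \<zeta> = g \<zeta>)"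
    unfolding V_sqn[OF d] sqip_zero_iff_AE[OF d] by simp
  finally show ?thesis .
qed

abbreviation W :: "(complex \<Rightarrow> complex) \<Rightarrow> (complex \<Rightarrow> complex)" where
  "W \<equiv> clark_V_inv u \<beta>"

lemma W_L: "g \<in> K \<Longrightarrow> W g \<in> L" and V_W: "g \<in> K \<Longrightarrow> V (W g) = g"
proof -
  assume "g \<in> K"
  then have "g \<in> V ` L" using V_surj by blast
  then show "W g \<in> L" "V (W g) = g"
    unfolding clark_V_inv_def L2_eq_sqint by (rule inv_into_into, rule f_inv_into_f)
qed

lemma W_V_AE: "f \<in> L \<Longrightarrow> AE \<zeta> in \<mu>. W (V f) \<zeta> = f \<zeta>"
  using V_cong_AE[OF W_L[OF V_K]] V_W[OF V_K] by blast

text \<open>On the circle \<zeta>/(1 - cnj \<zeta> z) = \<zeta> + z/(1 - cnj \<zeta> z). The second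
  term gives z times \<open>V f\<close>; the first gives the constant <f, cnj> = <V f, vcnj>, which,
  multiplied by 1 - cnj \<beta> u, is the correction term of \<open>pshift\<close>.\<close>

lemma V_times_circle:
  assumes f: "f \<in> L"
  shows "V (\<lambda>\<zeta>. \<zeta> * f \<zeta>) = pshift \<beta> (V f)"
proof (rule H2_eqI)
  show "V (\<lambda>\<zeta>. \<zeta> * f \<zeta>) \<in> H2" using K_H2[OF V_K[OF \<mu>.sqint_circle_mult[OF f]]] .
  show "pshift \<beta> (V f) \<in> H2" using pshift_H2[OF K_H2[OF V_K[OF f]]] .
  fix z assume z: "z \<in> unit_disc"
  note nz = \<beta>u_ne_1[OF z] \<beta>u_ne_1[of 0, simplified]
  have nz': "1 - \<beta> * cnj (u 0) \<noteq> 0" using denom_nz[of \<beta>] \<beta> by simp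
  have i1: "integrable \<mu> (\<lambda>\<zeta>. \<zeta> * f \<zeta>)" using \<mu>.integrable_sqint[OF \<mu>.sqint_circle_mult[OF f]] .
  have i2: "integrable \<mu> (\<lambda>\<zeta>. f \<zeta> / (1 - cnj \<zeta> * z))"
  proof -
    have "(\<lambda>\<zeta>. 1 / (1 - cnj \<zeta> * z)) \<in> L"
      using disc_denominator_nz[OF z] by (intro \<mu>.sqint_continuous continuous_intros) auto
    from integrable_sqint_mult[OF f this] show ?thesis by simp
  qed
  have "(\<integral>\<zeta>. \<zeta> * f \<zeta> / (1 - cnj \<zeta> * z) \<partial>\<mu>) = (\<integral>\<zeta>. \<zeta> * f \<zeta> + z * (f \<zeta> / (1 - cnj \<zeta> * z)) \<partial>\<mu>)"
  proof (rule \<mu>.integral_cong_circle)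
    fix \<zeta> assume \<zeta>: "\<zeta> \<in> unit_circle"
    define d where "d = 1 - cnj \<zeta> * z"
    have "\<zeta> * d + z = \<zeta> - (\<zeta> * cnj \<zeta>) * z + z" unfolding d_def by (simp add: algebra_simps)
    then have "\<zeta> * d + z = \<zeta>" using circle_cnj_mult(1)[OF \<zeta>] by simp
    then have "\<zeta> * f \<zeta> / d = (\<zeta> * d + z) * f \<zeta> / d" by simp
    also have "\<dots> = \<zeta> * f \<zeta> + z * (f \<zeta> / d)"
      using disc_denominator_nz[OF z \<zeta>] unfolding d_def[symmetric] by (simp add: field_simps)
    finally show "\<zeta> * f \<zeta> / (1 - cnj \<zeta> * z) = \<zeta> * f \<zeta> + z * (f \<zeta> / (1 - cnj \<zeta> * z))"
      unfolding d_def .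
  qed
  also have "\<dots> = (\<integral>\<zeta>. \<zeta> * f \<zeta> \<partial>\<mu>) + z * (\<integral>\<zeta>. f \<zeta> / (1 - cnj \<zeta> * z) \<partial>\<mu>)"
    using Bochner_Integration.integral_add[OF i1 integrable_mult_right[OF i2, of z]]
    by (simp only: integral_mult_right_zero)
  also have "(\<integral>\<zeta>. \<zeta> * f \<zeta> \<partial>\<mu>) = sqip \<mu> f cnj" unfolding sqip_def by (simp add: mult.commute)
  also have "\<dots> = h2_inner (V f) (V cnj)" using V_inner[OF f cnj_L] by simp
  also have "V cnj = vcnj"
    using V_cnj V_eq_sqip by (intro H2_eqI K_H2 V_K cnj_L vcnj_K) auto
  also have "h2_inner (V f) vcnj = cnj (cnj \<beta> / (1 - cnj \<beta> * u 0)) * h2_inner (V f) (k0_conj u)"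
    unfolding vcnj_def by (rule K.ip_scale_right[OF kt_K V_K[OF f]])
  finally have e: "(\<integral>\<zeta>. \<zeta> * f \<zeta> / (1 - cnj \<zeta> * z) \<partial>\<mu>) =
    \<beta> / (1 - \<beta> * cnj (u 0)) * h2_inner (V f) (k0_conj u) + z * (\<integral>\<zeta>. f \<zeta> / (1 - cnj \<zeta> * z) \<partial>\<mu>)"
    by simp
  have "V (\<lambda>\<zeta>. \<zeta> * f \<zeta>) z = (1 - cnj \<beta> * u z) * (\<integral>\<zeta>. \<zeta> * f \<zeta> / (1 - cnj \<zeta> * z) \<partial>\<mu>)"
    unfolding clark_V_def using z by simp
  also have "\<dots> = (h2_inner (V f) (k0_conj u) / (1 - \<beta> * cnj (u 0))) * (\<beta> - (\<beta> * cnj \<beta>) * u z) + z * V f z"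
    unfolding e clark_V_def using z by (simp add: algebra_simps)
  also have "\<beta> * cnj \<beta> = 1" using circle_cnj_mult(1)[OF \<beta>] .
  finally show "V (\<lambda>\<zeta>. \<zeta> * f \<zeta>) z = pshift \<beta> (V f) z"
    unfolding pshift_def using z u1_eval[OF z] by (simp add: kern_def)
qed

end

section \<open>Self-adjoint operators and their resolvents\<close>

context nonconstant_inner
begin

lemma dense_orth_zero:
  assumes "densely_defined_in K A" "dom A \<subseteq> K" "h \<in> K" "\<And>f. f \<in> dom A \<Longrightarrow> h2_inner f h = 0"
  shows "h = (\<lambda>_. 0)"
proof -
  have "K.sqn h \<le> 0"
  proof (rule field_le_epsilon)
    fix e :: real assume e: "e > 0"
    obtain f where f: "f \<in> dom A" "h2_norm (\<lambda>z. h z - f z) < sqrt e"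
      using assms(1,3) e unfolding densely_defined_in_def by (meson real_sqrt_gt_zero)
    have fK: "f \<in> K" using f assms(2) by blast
    have d: "(\<lambda>z. h z - f z) \<in> K" using K.diff_mem[OF assms(3) fK] .
    have "K.sqn (\<lambda>z. h z - f z) < e" using f(2) unfolding h2_norm_def by simp
    moreover have "h2_inner (\<lambda>z. h z - f z) h = h2_inner h h"
      using K.ip_diff[OF assms(3) fK assms(3)] assms(4)[OF f(1)] by simp
    then have "(cmod (h2_inner h h))\<^sup>2 \<le> K.sqn (\<lambda>z. h z - f z) * K.sqn h"
      using K.Cauchy_Schwarz[OF d assms(3)] by simp
    then have "K.sqn h * K.sqn h \<le> K.sqn (\<lambda>z. h z - f z) * K.sqn h"
      unfolding cmod_power2 K.Im_ip_self[OF assms(3)] by (simp add: power2_eq_square)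
    ultimately show "K.sqn h \<le> 0 + e"
      using K.ip_nonneg[OF assms(3)] e by (cases "K.sqn h = 0") auto
  qed
  then show ?thesis using K_definite[OF assms(3)] K.ip_nonneg[OF assms(3)] by simp
qed

lemma op_adjoint_Some_iff:
  assumes "densely_defined_in K A" "dom A \<subseteq> K"
  shows "op_adjoint K A g = Some h \<longleftrightarrow>
    g \<in> K \<and> h \<in> K \<and> (\<forall>f\<in>dom A. h2_inner (the (A f)) g = h2_inner f h)"
proof -
  let ?P = "\<lambda>h. h \<in> K \<and> (\<forall>f\<in>dom A. h2_inner (the (A f)) g = h2_inner f h)"
  have uniq: "h = h'" if "?P h" "?P h'" for h h'
  proof -
    have "(\<lambda>z. h z - h' z) = (\<lambda>_. 0)"
    proof (rule dense_orth_zero[OF assms])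
      show "(\<lambda>z. h z - h' z) \<in> K" using that by (intro K.diff_mem) auto
      show "h2_inner f (\<lambda>z. h z - h' z) = 0" if "f \<in> dom A" for f
      proof -
        have "f \<in> K" using that assms(2) by blast
        moreover have "h2_inner f h = h2_inner f h'" using \<open>?P h\<close> \<open>?P h'\<close> that by metis
        ultimately show ?thesis using K.ip_diff_right[of h h' f] \<open>?P h\<close> \<open>?P h'\<close> by simp
      qed
    qed
    then show ?thesis by (simp add: fun_eq_iff)
  qed
  show ?thesis
  proof (cases "g \<in> K \<and> (\<exists>h. ?P h)")
    case True
    then obtain h0 where h0: "?P h0" by blast
    then have "(THE h. ?P h) = h0" using uniq by (intro the_equality) blast+
    then have "op_adjoint K A g = Some h0" using True h0 unfolding op_adjoint_def by auto
    then show ?thesis using True h0 uniq[of h h0] by auto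
  next
    case False
    then have "op_adjoint K A g = None" unfolding op_adjoint_def by auto
    then show ?thesis using False by auto
  qed
qed

text \<open>Obtained by duality from multiplication by z rather than from the explicit formula,
  whose backward shift involves a derivative at 0.\<close>

lemma pshift_adj_lin:
  assumes "f \<in> K" "g \<in> K"
  shows "pshift_adj \<alpha> (\<lambda>z. c * f z + g z) = (\<lambda>z. c * pshift_adj \<alpha> f z + pshift_adj \<alpha> g z)"
proof (rule K_eqI)
  note m = pshift_adj_K[OF assms(1), of \<alpha>] pshift_adj_K[OF assms(2), of \<alpha>]
  note l = K.lin_mem[OF assms, of c]
  show "pshift_adj \<alpha> (\<lambda>z. c * f z + g z) \<in> K" by (rule pshift_adj_K[OF l])
  show "(\<lambda>z. c * pshift_adj \<alpha> f z + pshift_adj \<alpha> g z) \<in> K" by (rule K.lin_mem[OF m])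
  fix h assume h: "h \<in> K"
  have a: "h2_inner (pshift_adj \<alpha> f) h = h2_inner f (pshift \<alpha> h)" if "f \<in> K" for f
    using pshift_adj_inner[OF that h, of \<alpha>] H2.ip_sym[OF K_H2[OF h] K_H2[OF pshift_adj_K[OF that, of \<alpha>]]]
      H2.ip_sym[OF pshift_H2[OF K_H2[OF h], of \<alpha>] K_H2[OF that]] by simp
  show "h2_inner (pshift_adj \<alpha> (\<lambda>z. c * f z + g z)) h =
      h2_inner (\<lambda>z. c * pshift_adj \<alpha> f z + pshift_adj \<alpha> g z) h"
    unfolding K.ip_lin[OF m h] a[OF l] a[OF assms(1)] a[OF assms(2)]
    by (rule H2.ip_lin) (intro K_H2 assms pshift_H2 h)+
qed

end

locale self_adjoint_operator = nonconstant_inner +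
  fixes A :: operator
  assumes lin_A: "linear_operator_in (model_space u) A"
    and closed_A: "closed_in (model_space u) A"
    and dense_A: "densely_defined_in (model_space u) A"
    and self_adjoint_A: "self_adjoint_in (model_space u) A"
begin

abbreviation Af :: "(complex \<Rightarrow> complex) \<Rightarrow> (complex \<Rightarrow> complex)" where
  "Af f \<equiv> the (A f)"

lemma dom_K: "f \<in> dom A \<Longrightarrow> f \<in> K" and Af_K: "f \<in> dom A \<Longrightarrow> Af f \<in> K"
  using lin_A unfolding linear_operator_in_def by (auto simp: ran_def subset_iff)

lemma A_zero: "(\<lambda>_. 0) \<in> dom A"
  using lin_A unfolding linear_operator_in_def by simp

lemma A_lin: "f \<in> dom A \<Longrightarrow> g \<in> dom A \<Longrightarrow> A (\<lambda>z. c * f z + g z) = Some (\<lambda>z. c * Af f z + Af g z)"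
  using lin_A unfolding linear_operator_in_def by blast

lemma A_lin_dom: "f \<in> dom A \<Longrightarrow> g \<in> dom A \<Longrightarrow> (\<lambda>z. c * f z + g z) \<in> dom A"
  using A_lin by blast

lemma A_Some_iff: "A g = Some h \<longleftrightarrow> g \<in> K \<and> h \<in> K \<and> (\<forall>f\<in>dom A. h2_inner (Af f) g = h2_inner f h)"
  using op_adjoint_Some_iff[OF dense_A, of g h] dom_K self_adjoint_A
  unfolding self_adjoint_in_def by auto

lemma A_symmetric: "f \<in> dom A \<Longrightarrow> g \<in> dom A \<Longrightarrow> h2_inner (Af f) g = h2_inner f (Af g)"
  using A_Some_iff[of g "Af g"] by (auto simp: domIff)

definition sh :: "complex \<Rightarrow> (complex \<Rightarrow> complex) \<Rightarrow> (complex \<Rightarrow> complex)" where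
  "sh w f = (\<lambda>z. Af f z - w * f z)"

lemma sh_K: "f \<in> dom A \<Longrightarrow> sh w f \<in> K"
  unfolding sh_def by (intro K.diff_mem K.scale_mem dom_K Af_K)

lemma sh_lin:
  assumes "f \<in> dom A" "g \<in> dom A"
  shows "sh w (\<lambda>z. c * f z + g z) = (\<lambda>z. c * sh w f z + sh w g z)"
  unfolding sh_def A_lin[OF assms] by (simp add: algebra_simps)

text \<open>The conditions on w say that it is i or -i. Symmetry of A cancels the cross terms, and
  the resulting identity yields both injectivity of A - w and the estimate behind its closed
  range.\<close>

lemma sh_sqn:
  assumes "f \<in> dom A" "cnj w = - w" "cmod w = 1"
  shows "K.sqn (sh w f) = K.sqn (Af f) + K.sqn f"
proof -
  note K = dom_K[OF assms(1)] Af_K[OF assms(1)]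
  have "w * cnj w = 1" using complex_norm_square[of w] assms(3) by simp
  then have w: "w * w = -1" using assms(2) by (metis minus_equation_iff mult_minus_right)
  have "h2_inner (sh w f) (sh w f) = h2_inner (Af f) (Af f) - cnj w * h2_inner (Af f) f
      - w * (h2_inner f (Af f) - cnj w * h2_inner f f)"
    unfolding sh_def using K by (simp add: K.ips K.mems)
  also have "\<dots> = h2_inner (Af f) (Af f) - (w * w) * h2_inner f f"
    unfolding A_symmetric[OF assms(1,1)] assms(2) by (simp add: algebra_simps)
  finally show ?thesis unfolding w by simp
qed

lemma sh_inj:
  assumes "f \<in> dom A" "g \<in> dom A" "sh w f = sh w g" "cnj w = - w" "cmod w = 1"
  shows "f = g"
proof -
  let ?d = "\<lambda>z. - 1 * f z + g z"
  have d: "?d \<in> dom A" using A_lin_dom[OF assms(1,2)] .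
  have "sh w ?d = (\<lambda>_. 0)" unfolding sh_lin[OF assms(1,2)] assms(3) by simp
  then have "K.sqn (Af ?d) + K.sqn ?d = 0"
    using sh_sqn[OF d assms(4,5)] K.ip_zero[OF K.zero_mem] by simp
  then have "K.sqn ?d = 0"
    using K.ip_nonneg[OF Af_K[OF d]] K.ip_nonneg[OF dom_K[OF d]] by simp
  then have "?d = (\<lambda>_. 0)" using K_definite[OF dom_K[OF d]] by simp
  then have "- 1 * f z + g z = 0" for z by (rule fun_cong)
  then show ?thesis by (simp add: fun_eq_iff)
qed

lemma conv_h2_norm:
  assumes "K.conv F f"
  shows "(\<lambda>n. h2_norm (\<lambda>z. F n z - f z)) \<longlonglongrightarrow> 0"
  unfolding h2_norm_def using assms tendsto_real_sqrt[of _ 0] unfolding K.conv_def by fastforce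

text \<open>The range of \<open>A - w\<close> is closed because \<open>A\<close> is, and a vector orthogonal to it is an eigenvector
  of \<open>A\<^sup>* = A\<close> for the non-real eigenvalue \<open>cnj w\<close>.\<close>

lemma sh_surj:
  assumes x: "x \<in> K" and w: "cnj w = - w" "cmod w = 1"
  shows "\<exists>f\<in>dom A. sh w f = x"
proof -
  define S where "S = sh w ` dom A"
  have SK: "s \<in> K" if "s \<in> S" for s using that sh_K unfolding S_def by blast
  have "K.subspace_of S"
    unfolding K.subspace_of_def
  proof (intro conjI ballI allI)
    show "S \<subseteq> K" using SK by blast
    have "sh w (\<lambda>z. - 1 * 0 + 0) = (\<lambda>_. 0)" unfolding sh_lin[OF A_zero A_zero] by simp
    then have "sh w (\<lambda>_. 0) = (\<lambda>_. 0)" by simp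
    then show "(\<lambda>_. 0) \<in> S" unfolding S_def using A_zero by (metis image_eqI)
    show "(\<lambda>z. c * s z + t z) \<in> S" if "s \<in> S" "t \<in> S" for s t c
    proof -
      obtain f g where fg: "f \<in> dom A" "g \<in> dom A" "s = sh w f" "t = sh w g"
        using \<open>s \<in> S\<close> \<open>t \<in> S\<close> unfolding S_def by blast
      have "(\<lambda>z. c * s z + t z) = sh w (\<lambda>z. c * f z + g z)" unfolding sh_lin[OF fg(1,2)] fg(3,4) ..
      then show ?thesis unfolding S_def using A_lin_dom[OF fg(1,2)] by (rule image_eqI)
    qed
  qed
  then obtain F m where F: "\<And>n. F n \<in> S" "K.conv F m" "\<And>s. s \<in> S \<Longrightarrow> h2_inner (\<lambda>z. x z - m z) s = 0"
    using K.approx_projection[OF _ x] by metis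
  have m: "m \<in> K" using F(2) unfolding K.conv_def by blast
  have FK: "F n \<in> K" for n using F(2) unfolding K.conv_def by blast
  obtain g where g: "\<And>n. g n \<in> dom A" "\<And>n. sh w (g n) = F n"
    using F(1) unfolding S_def image_iff by metis
  have AF: "Af (g n) = (\<lambda>z. F n z + w * g n z)" for n
    unfolding g(2)[symmetric] sh_def by simp
  obtain f where f: "K.conv g f"
  proof (rule K.complete_conv[of g])
    fix e :: real assume e: "e > 0"
    \<comment> \<open>A - w does not decrease norms, so preimages of a Cauchy sequence form a Cauchy
      sequence.\<close>
    have "K.sqn (\<lambda>z. g i z - g j z) \<le> K.sqn (\<lambda>z. F i z - F j z)" for i j
    proof -
      have d: "(\<lambda>z. g i z - g j z) \<in> dom A" using A_lin_dom[OF g(1) g(1), of "-1" j i] by simp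
      have "sh w (\<lambda>z. g i z - g j z) = (\<lambda>z. F i z - F j z)"
        using sh_lin[OF g(1) g(1), of w "-1" j i] by (simp add: g(2))
      then show ?thesis using sh_sqn[OF d w] K.ip_nonneg[OF Af_K[OF d]] by simp
    qed
    then show "\<exists>N. \<forall>i\<ge>N. \<forall>j\<ge>N. K.sqn (\<lambda>z. g i z - g j z) < e"
      using K.conv_Cauchy[OF F(2) e] by (meson le_less_trans)
  qed (use g(1) dom_K in auto)
  have fK: "f \<in> K" using f unfolding K.conv_def by blast
  have gK: "g n \<in> K" for n using g(1) dom_K by blast
  have mwK: "(\<lambda>z. m z + w * f z) \<in> K" by (intro K.add_mem K.scale_mem m fK)
  have "K.conv (\<lambda>n. Af (g n)) (\<lambda>z. m z + w * f z)"
    unfolding K.conv_def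
  proof (intro conjI allI mwK)
    show "Af (g n) \<in> K" for n using Af_K g(1) by blast
    have le: "K.sqn (\<lambda>z. Af (g n) z - (m z + w * f z)) \<le>
        2 * K.sqn (\<lambda>z. F n z - m z) + 2 * K.sqn (\<lambda>z. g n z - f z)" for n
    proof -
      have "(\<lambda>z. Af (g n) z - (m z + w * f z)) = (\<lambda>z. (F n z - m z) + w * (g n z - f z))"
        unfolding AF by (simp add: algebra_simps)
      moreover have "K.sqn (\<lambda>z. w * (g n z - f z)) = K.sqn (\<lambda>z. g n z - f z)"
      proof -
        have "h2_inner (\<lambda>z. w * (g n z - f z)) (\<lambda>z. w * (g n z - f z)) =
            w * (cnj w * h2_inner (\<lambda>z. g n z - f z) (\<lambda>z. g n z - f z))"
          using K.diff_mem[OF gK[of n] fK] K.scale_mem[OF K.diff_mem[OF gK[of n] fK], of w]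
          by (simp only: K.ip_scale K.ip_scale_right)
        also have "\<dots> = (w * cnj w) * h2_inner (\<lambda>z. g n z - f z) (\<lambda>z. g n z - f z)" by simp
        also have "w * cnj w = 1" using complex_norm_square[of w] w(2) by simp
        finally show ?thesis by simp
      qed
      ultimately show ?thesis
        using K.sqn_add_le[OF K.diff_mem[OF FK[of n] m] K.scale_mem[OF K.diff_mem[OF gK[of n] fK], of w]]
        by simp
    qed
    show "(\<lambda>n. K.sqn (\<lambda>z. Af (g n) z - (m z + w * f z))) \<longlonglongrightarrow> 0"
    proof (rule tendsto_sandwich)
      show "\<forall>\<^sub>F n in sequentially. 0 \<le> K.sqn (\<lambda>z. Af (g n) z - (m z + w * f z))"
        using Af_K[OF g(1)] mwK by (intro always_eventually allI K.ip_nonneg K.diff_mem)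
      show "\<forall>\<^sub>F n in sequentially. K.sqn (\<lambda>z. Af (g n) z - (m z + w * f z)) \<le>
          2 * K.sqn (\<lambda>z. F n z - m z) + 2 * K.sqn (\<lambda>z. g n z - f z)"
        using le by (intro always_eventually allI)
      show "(\<lambda>n. 2 * K.sqn (\<lambda>z. F n z - m z) + 2 * K.sqn (\<lambda>z. g n z - f z)) \<longlonglongrightarrow> 0"
        using F(2) f unfolding K.conv_def
        by (intro tendsto_add_zero tendsto_mult_right_zero) auto
    qed simp
  qed
  then have Af: "A f = Some (\<lambda>z. m z + w * f z)"
    using closed_A conv_h2_norm[OF f] conv_h2_norm g(1) fK mwK unfolding closed_in_def by blast
  then have mS: "sh w f = m" unfolding sh_def by simp
  let ?q = "\<lambda>z. x z - m z"
  have q: "?q \<in> K" by (rule K.diff_mem[OF x m])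
  have Aq: "A ?q = Some (\<lambda>z. cnj w * ?q z)"
    unfolding A_Some_iff
  proof (intro conjI ballI q K.scale_mem)
    fix h assume h: "h \<in> dom A"
    have "h2_inner ?q (sh w h) = 0" using F(3) h unfolding S_def by blast
    then have "h2_inner (sh w h) ?q = 0" using K.ip_sym[OF q sh_K[OF h, of w]] by simp
    then have "h2_inner (Af h) ?q - w * h2_inner h ?q = 0"
      unfolding sh_def using dom_K[OF h] Af_K[OF h] q
      by (simp add: K.ip_diff[of "Af h"] K.ip_scale[of h] K.scale_mem)
    then show "h2_inner (Af h) ?q = h2_inner h (\<lambda>z. cnj w * ?q z)"
      using K.ip_scale_right[OF q dom_K[OF h], of "cnj w"] by simp
  qed
  then have qd: "?q \<in> dom A" by blast
  have "cnj w * h2_inner ?q ?q = w * h2_inner ?q ?q"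
    using A_symmetric[OF qd qd] K.ip_scale[OF q q, of "cnj w"] K.ip_scale_right[OF q q, of "cnj w"]
    unfolding Aq by (simp only: option.sel complex_cnj_cnj)
  then have "w * h2_inner ?q ?q = 0" unfolding w(1) by simp
  then have "h2_inner ?q ?q = 0" using w(2) by auto
  then have "?q = (\<lambda>_. 0)" using K_definite[OF q] by simp
  then have "x z - m z = 0" for z by (rule fun_cong)
  then have "x = m" by (simp add: fun_eq_iff)
  then show ?thesis using mS Af by blast
qed

definition res :: "complex \<Rightarrow> (complex \<Rightarrow> complex) \<Rightarrow> (complex \<Rightarrow> complex)" where
  "res w x = (SOME f. f \<in> dom A \<and> sh w f = x)"

lemma i_cases: "w = \<i> \<or> w = - \<i> \<Longrightarrow> cnj w = - w \<and> cmod w = 1"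
  by auto

lemma res:
  assumes "x \<in> K" "w = \<i> \<or> w = - \<i>"
  shows "res w x \<in> dom A" "sh w (res w x) = x"
  using someI_ex[of "\<lambda>f. f \<in> dom A \<and> sh w f = x"] sh_surj[OF assms(1)] i_cases[OF assms(2)]
  unfolding res_def by blast+

lemma res_K: "x \<in> K \<Longrightarrow> w = \<i> \<or> w = - \<i> \<Longrightarrow> res w x \<in> K"
  using res(1) dom_K by blast

lemma res_sh:
  assumes "f \<in> dom A" "w = \<i> \<or> w = - \<i>"
  shows "res w (sh w f) = f"
  using sh_inj[OF res(1)[OF sh_K[OF assms(1)] assms(2)] assms(1) res(2)[OF sh_K[OF assms(1)] assms(2)]]
    i_cases[OF assms(2)] by blast

lemma res_adj:
  assumes "x \<in> K" "y \<in> K"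
  shows "h2_inner (res \<i> x) y = h2_inner x (res (- \<i>) y)"
proof -
  define f where "f = res \<i> x"
  define g where "g = res (- \<i>) y"
  have f: "f \<in> dom A" "x = sh \<i> f" and g: "g \<in> dom A" "y = sh (- \<i>) g"
    unfolding f_def g_def using res[OF assms(1)] res[OF assms(2)] by auto
  note m = dom_K[OF f(1)] dom_K[OF g(1)] Af_K[OF f(1)] Af_K[OF g(1)]
  have "h2_inner f (sh (- \<i>) g) = h2_inner f (Af g) - \<i> * h2_inner f g"
    unfolding sh_def using m by (simp add: K.ips K.mems)
  moreover have "h2_inner (sh \<i> f) g = h2_inner (Af f) g - \<i> * h2_inner f g"
    unfolding sh_def using m by (simp add: K.ips K.mems)
  ultimately show ?thesis
    using A_symmetric[OF f(1) g(1)] f(2) g(2) unfolding f_def[symmetric] g_def[symmetric] by simp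
qed

lemma res_comm:
  assumes lin: "\<And>c f g. f \<in> K \<Longrightarrow> g \<in> K \<Longrightarrow> B (\<lambda>z. c * f z + g z) = (\<lambda>z. c * B f z + B g z)"
    and comm: "\<And>f. f \<in> dom A \<Longrightarrow> B f \<in> dom A \<and> B (Af f) = Af (B f)"
    and x: "x \<in> K" and w: "w = \<i> \<or> w = - \<i>"
  shows "res w (B x) = B (res w x)"
proof -
  note f = res[OF x w]
  have "B x = B (\<lambda>z. (- w) * res w x z + Af (res w x) z)"
    using f(2) unfolding sh_def by (simp add: fun_eq_iff[symmetric])
  also have "\<dots> = (\<lambda>z. (- w) * B (res w x) z + B (Af (res w x)) z)"
    by (rule lin[OF dom_K[OF f(1)] Af_K[OF f(1)]])
  also have "\<dots> = sh w (B (res w x))"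
    unfolding sh_def using comm[OF f(1)] by simp
  finally show ?thesis using res_sh[OF _ w] comm[OF f(1)] by simp
qed

text \<open>The resolvent is injective, so c is nonzero, and A - i is its inverse 1/c on the whole
  space. Symmetry of A, tested on one nonzero vector, makes the scalar 1/c + i real.\<close>

lemma scalar_resolvent:
  assumes "\<And>f. f \<in> K \<Longrightarrow> res \<i> f = (\<lambda>z. c * f z)"
  shows "\<exists>a::real. A = (\<lambda>f. if f \<in> K then Some (\<lambda>z. of_real a * f z) else None)"
proof -
  obtain f0 where f0: "f0 \<in> K" "f0 \<noteq> (\<lambda>_. 0)" using K_nonzero by blast
  have c: "c \<noteq> 0"
  proof
    assume "c = 0"
    then have "res \<i> f0 = (\<lambda>z. 0 * f0 z)" using assms[OF f0(1)] by simp
    then have "sh \<i> (\<lambda>_. 0) = f0" using res(2)[OF f0(1), of \<i>] by simp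
    moreover have "sh \<i> (\<lambda>z. - 1 * 0 + 0) = (\<lambda>_. 0)" unfolding sh_lin[OF A_zero A_zero] by simp
    ultimately show False using f0(2) by simp
  qed
  define a where "a = 1 / c + \<i>"
  have A: "A x = Some (\<lambda>z. a * x z)" if x: "x \<in> K" for x
  proof -
    have r: "(\<lambda>z. c * x z) \<in> dom A" "sh \<i> (\<lambda>z. c * x z) = x" using res[OF x, of \<i>] assms[OF x] by auto
    have "A (\<lambda>z. (1 / c) * (c * x z) + 0) = Some (\<lambda>z. (1 / c) * Af (\<lambda>z. c * x z) z + Af (\<lambda>_. 0) z)"
      by (rule A_lin[OF r(1) A_zero])
    moreover have "Af (\<lambda>_. 0) = (\<lambda>_. 0)" using A_lin[OF A_zero A_zero, of "-1"] by simp
    moreover have "Af (\<lambda>z. c * x z) z = x z + \<i> * (c * x z)" for z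
      using fun_cong[OF r(2), of z] unfolding sh_def by (simp add: algebra_simps)
    ultimately show ?thesis using c unfolding a_def by (simp add: field_simps)
  qed
  have d: "f0 \<in> dom A" using A[OF f0(1)] by blast
  have "a * h2_inner f0 f0 = cnj a * h2_inner f0 f0"
    using A_symmetric[OF d d] A[OF f0(1)] f0(1) by (simp add: K.ip_scale K.ip_scale_right)
  moreover have "h2_inner f0 f0 \<noteq> 0" using K_definite[OF f0(1)] f0(2) by auto
  ultimately have "a = cnj a" by simp
  then have a: "a = of_real (Re a)" by (simp add: complex_eq_iff)
  have "A = (\<lambda>f. if f \<in> K then Some (\<lambda>z. of_real (Re a) * f z) else None)"
  proof
    fix f show "A f = (if f \<in> K then Some (\<lambda>z. of_real (Re a) * f z) else None)"
      using A[of f] a dom_K[of f] by (cases "f \<in> K") auto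
  qed
  then show ?thesis by blast
qed

end

section \<open>The functional calculus\<close>

context clark
begin

interpretation L: semi_hilbert "sqint (clark_measure u \<beta>)" "sqip (clark_measure u \<beta>)"
  by (rule semi_hilbert_sqint)

lemma V_zero: "V (\<lambda>_. 0) = (\<lambda>_. 0)"
  by (intro ext) (auto simp: clark_V_def)

lemma V_cong_circle:
  assumes "f \<in> L" "g \<in> L" "\<And>\<zeta>. \<zeta> \<in> unit_circle \<Longrightarrow> f \<zeta> = g \<zeta>"
  shows "V f = V g"
  unfolding V_cong_AE[OF assms(1,2)] using assms(3) \<mu>.space_circle by (intro AE_I2) auto

lemma measurable_\<mu>: "\<Phi> \<in> borel_measurable borel_circle \<longleftrightarrow> \<Phi> \<in> borel_measurable \<mu>"
  using measurable_cong_sets[OF \<mu>.sets_circle refl] by blast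

lemma clark_calculus_eq:
  "clark_calculus u \<beta> \<Phi> f = (if f \<in> K \<and> (\<lambda>\<zeta>. \<Phi> \<zeta> * W f \<zeta>) \<in> L
     then Some (V (\<lambda>\<zeta>. \<Phi> \<zeta> * W f \<zeta>)) else None)"
  unfolding clark_calculus_def mult_dom_def L2_eq_sqint using W_L by auto

text \<open>\<open>clark_calculus\<close> works with the representative chosen by \<open>W\<close>.
  Any other may be used instead, since the product with \<Phi> changes only on a null set.\<close>

lemma clark_calculus_V:
  assumes \<Phi>: "\<Phi> \<in> borel_measurable \<mu>" and F: "F \<in> L" and \<Phi>F: "(\<lambda>\<zeta>. \<Phi> \<zeta> * F \<zeta>) \<in> L"
  shows "clark_calculus u \<beta> \<Phi> (V F) = Some (V (\<lambda>\<zeta>. \<Phi> \<zeta> * F \<zeta>))"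
proof -
  have ae: "AE \<zeta> in \<mu>. \<Phi> \<zeta> * F \<zeta> = \<Phi> \<zeta> * W (V F) \<zeta>" using W_V_AE[OF F] by eventually_elim simp
  have "(\<lambda>\<zeta>. \<Phi> \<zeta> * W (V F) \<zeta>) \<in> borel_measurable \<mu>"
    using \<Phi> sqintD(1)[OF W_L[OF V_K[OF F]]] by simp
  from sqint_cong_AE[OF \<Phi>F this ae] have m: "(\<lambda>\<zeta>. \<Phi> \<zeta> * W (V F) \<zeta>) \<in> L" .
  show ?thesis
    unfolding clark_calculus_eq using m V_K[OF F] V_cong_AE[OF \<Phi>F m] ae by simp
qed

lemma clark_calculus_dom: "dom (clark_calculus u \<beta> \<Phi>) \<subseteq> K"
  unfolding clark_calculus_eq[abs_def] by (auto split: if_splits)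

lemma clark_calculus_const: "clark_calculus u \<beta> (\<lambda>_. a) = (\<lambda>f. if f \<in> K then Some (\<lambda>z. a * f z) else None)"
proof
  fix f show "clark_calculus u \<beta> (\<lambda>_. a) f = (if f \<in> K then Some (\<lambda>z. a * f z) else None)"
  proof (cases "f \<in> K")
    case True
    show ?thesis
      unfolding clark_calculus_eq
      using True L.scale_mem[OF W_L[OF True], of a] V_lin[OF W_L[OF True] L.zero_mem, of a] V_W[OF True]
      by (simp add: V_zero)
  qed (simp add: clark_calculus_eq)
qed

text \<open>The point is that the domain of the adjoint is no larger. If the adjoint maps g to h,
  the function \<Phi> W g - W h is cut off to the set where |\<Phi>| \<le> n. The result lies in the
  transformed domain, and testing the adjoint relation against it shows that its norm is 0; letting
  n grow gives \<Phi> W g = W h almost everywhere.\<close>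

lemma clark_calculus_self_adjoint:
  assumes \<Phi>: "\<Phi> \<in> borel_measurable borel_circle" and real: "\<And>\<zeta>. \<zeta> \<in> unit_circle \<Longrightarrow> \<Phi> \<zeta> \<in> \<real>"
    and dense: "densely_defined_in K (clark_calculus u \<beta> \<Phi>)"
  shows "self_adjoint_in K (clark_calculus u \<beta> \<Phi>)"
proof -
  let ?A = "clark_calculus u \<beta> \<Phi>"
  have \<Phi>m [measurable]: "\<Phi> \<in> borel_measurable \<mu>" using \<Phi> measurable_\<mu> by blast
  have iff: "op_adjoint K ?A g = Some h \<longleftrightarrow> ?A g = Some h" for g h
  proof
    assume Ag: "?A g = Some h"
    then have g: "g \<in> K" and \<Phi>G: "(\<lambda>\<zeta>. \<Phi> \<zeta> * W g \<zeta>) \<in> L" and h: "h = V (\<lambda>\<zeta>. \<Phi> \<zeta> * W g \<zeta>)"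
      unfolding clark_calculus_eq by (auto split: if_splits)
    show "op_adjoint K ?A g = Some h"
      unfolding op_adjoint_Some_iff[OF dense clark_calculus_dom]
    proof (intro conjI ballI g)
      show "h \<in> K" unfolding h by (rule V_K[OF \<Phi>G])
      fix f assume "f \<in> dom ?A"
      then have f: "f \<in> K" and \<Phi>F: "(\<lambda>\<zeta>. \<Phi> \<zeta> * W f \<zeta>) \<in> L" and Af: "the (?A f) = V (\<lambda>\<zeta>. \<Phi> \<zeta> * W f \<zeta>)"
        unfolding clark_calculus_eq by (auto split: if_splits)
      have "h2_inner (the (?A f)) g = sqip \<mu> (\<lambda>\<zeta>. \<Phi> \<zeta> * W f \<zeta>) (W g)"
        unfolding Af using V_inner[OF \<Phi>F W_L[OF g]] V_W[OF g] by simp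
      also have "\<dots> = sqip \<mu> (W f) (\<lambda>\<zeta>. \<Phi> \<zeta> * W g \<zeta>)"
        unfolding sqip_def
      proof (rule \<mu>.integral_cong_circle)
        fix \<zeta> assume "\<zeta> \<in> unit_circle"
        then have "cnj (\<Phi> \<zeta>) = \<Phi> \<zeta>" using real Reals_cnj_iff by blast
        then show "\<Phi> \<zeta> * W f \<zeta> * cnj (W g \<zeta>) = W f \<zeta> * cnj (\<Phi> \<zeta> * W g \<zeta>)" by simp
      qed
      also have "\<dots> = h2_inner f h"
        unfolding h using V_inner[OF W_L[OF f] \<Phi>G] V_W[OF f] by simp
      finally show "h2_inner (the (?A f)) g = h2_inner f h" .
    qed
  next
    assume "op_adjoint K ?A g = Some h"
    then have g: "g \<in> K" and h: "h \<in> K"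
      and adj: "\<And>f. f \<in> dom ?A \<Longrightarrow> h2_inner (the (?A f)) g = h2_inner f h"
      unfolding op_adjoint_Some_iff[OF dense clark_calculus_dom] by auto
    note [measurable] = sqintD(1)[OF W_L[OF g]] sqintD(1)[OF W_L[OF h]]
    define i where "i n \<zeta> = (if cmod (\<Phi> \<zeta>) \<le> real n then 1 else 0 :: complex)" for n \<zeta>
    have i_meas [measurable]: "i n \<in> borel_measurable \<mu>" for n unfolding i_def by measurable
    have i_bd: "cmod (i n \<zeta>) \<le> 1" "cmod (i n \<zeta> * \<Phi> \<zeta>) \<le> real n" for n \<zeta> unfolding i_def by auto
    have "AE \<zeta> in \<mu>. i n \<zeta> * (\<Phi> \<zeta> * W g \<zeta> - W h \<zeta>) = 0" for n
    proof -
      let ?F = "\<lambda>\<zeta>. i n \<zeta> * (\<Phi> \<zeta> * W g \<zeta> - W h \<zeta>)"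
      have 1: "(\<lambda>\<zeta>. (i n \<zeta> * \<Phi> \<zeta>) * W g \<zeta>) \<in> L"
        using i_bd by (intro sqint_bounded_mult[OF W_L[OF g], of _ "real n"]; simp)
      have 2: "(\<lambda>\<zeta>. i n \<zeta> * W h \<zeta>) \<in> L"
        using i_bd by (intro sqint_bounded_mult[OF W_L[OF h], of _ 1]; simp)
      from L.diff_mem[OF 1 2] have F: "?F \<in> L" by (simp add: algebra_simps)
      have "(\<lambda>\<zeta>. (i n \<zeta> * \<Phi> \<zeta>) * ?F \<zeta>) \<in> L"
        using i_bd by (intro sqint_bounded_mult[OF F, of _ "real n"]; simp)
      moreover have "(i n \<zeta> * \<Phi> \<zeta>) * ?F \<zeta> = \<Phi> \<zeta> * ?F \<zeta>" for \<zeta> unfolding i_def by simp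
      ultimately have \<Phi>F: "(\<lambda>\<zeta>. \<Phi> \<zeta> * ?F \<zeta>) \<in> L" by simp
      note A = clark_calculus_V[OF \<Phi>m F \<Phi>F]
      then have "V ?F \<in> dom ?A" by blast
      from adj[OF this] have eq: "sqip \<mu> (\<lambda>\<zeta>. \<Phi> \<zeta> * ?F \<zeta>) (W g) = sqip \<mu> ?F (W h)"
        unfolding A option.sel using V_inner[OF \<Phi>F W_L[OF g]] V_inner[OF F W_L[OF h]] V_W[OF g] V_W[OF h]
        by simp
      have "sqip \<mu> ?F ?F = (\<integral>\<zeta>. \<Phi> \<zeta> * ?F \<zeta> * cnj (W g \<zeta>) - ?F \<zeta> * cnj (W h \<zeta>) \<partial>\<mu>)"
        unfolding sqip_def
      proof (rule \<mu>.integral_cong_circle)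
        fix \<zeta> assume "\<zeta> \<in> unit_circle"
        then have r: "cnj (\<Phi> \<zeta>) = \<Phi> \<zeta>" using real Reals_cnj_iff by blast
        have "?F \<zeta> * cnj (?F \<zeta>) = ?F \<zeta> * cnj (\<Phi> \<zeta> * W g \<zeta> - W h \<zeta>)" unfolding i_def by simp
        also have "\<dots> = \<Phi> \<zeta> * ?F \<zeta> * cnj (W g \<zeta>) - ?F \<zeta> * cnj (W h \<zeta>)"
          unfolding complex_cnj_diff complex_cnj_mult r by (simp add: algebra_simps)
        finally show "?F \<zeta> * cnj (?F \<zeta>) = \<Phi> \<zeta> * ?F \<zeta> * cnj (W g \<zeta>) - ?F \<zeta> * cnj (W h \<zeta>)" .
      qed
      also have "\<dots> = sqip \<mu> (\<lambda>\<zeta>. \<Phi> \<zeta> * ?F \<zeta>) (W g) - sqip \<mu> ?F (W h)"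
        unfolding sqip_def
        by (rule Bochner_Integration.integral_diff[OF integrable_sqip[OF \<Phi>F W_L[OF g]] integrable_sqip[OF F W_L[OF h]]])
      finally have "Re (sqip \<mu> ?F ?F) = 0" unfolding eq by simp
      then show ?thesis using sqip_zero_iff_AE[OF F] by blast
    qed
    then have "AE \<zeta> in \<mu>. \<forall>n. i n \<zeta> * (\<Phi> \<zeta> * W g \<zeta> - W h \<zeta>) = 0"
      unfolding AE_all_countable by blast
    then have ae: "AE \<zeta> in \<mu>. W h \<zeta> = \<Phi> \<zeta> * W g \<zeta>"
    proof eventually_elim
      fix \<zeta> assume *: "\<forall>n. i n \<zeta> * (\<Phi> \<zeta> * W g \<zeta> - W h \<zeta>) = 0"
      obtain n where "cmod (\<Phi> \<zeta>) \<le> real n" using real_arch_simple by blast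
      then have "i n \<zeta> = 1" unfolding i_def by simp
      then show "W h \<zeta> = \<Phi> \<zeta> * W g \<zeta>" using spec[OF *, of n] by simp
    qed
    have \<Phi>G: "(\<lambda>\<zeta>. \<Phi> \<zeta> * W g \<zeta>) \<in> L"
      by (rule sqint_cong_AE[OF W_L[OF h] _ ae]) simp
    have "V (\<lambda>\<zeta>. \<Phi> \<zeta> * W g \<zeta>) = h" using V_cong_AE[OF W_L[OF h] \<Phi>G] ae V_W[OF h] by simp
    then show "?A g = Some h" unfolding clark_calculus_eq using g \<Phi>G by simp
  qed
  show ?thesis
    unfolding self_adjoint_in_def
  proof
    fix g show "op_adjoint K ?A g = ?A g"
      using iff[of g] by (cases "?A g"; cases "op_adjoint K ?A g") auto
  qed
qed

end

section \<open>The unimodular case: resolvents as multiplication operators\<close>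

locale clark_self_adjoint = clark + self_adjoint_operator +
  assumes comm_dom: "\<And>f. f \<in> dom A \<Longrightarrow> pshift \<beta> f \<in> dom A"
    and comm_eq: "\<And>f. f \<in> dom A \<Longrightarrow> pshift \<beta> (the (A f)) = the (A (pshift \<beta> f))"
begin

interpretation L: semi_hilbert "sqint (clark_measure u \<beta>)" "sqip (clark_measure u \<beta>)"
  by (rule semi_hilbert_sqint)

lemma res_pshift: "f \<in> K \<Longrightarrow> w = \<i> \<or> w = - \<i> \<Longrightarrow> res w (pshift \<beta> f) = pshift \<beta> (res w f)"
  by (rule res_comm) (auto simp: pshift_lin comm_dom comm_eq)

text \<open>The multiplier of the resolvent at -i, found as its value on the constant 1. This
  resolvent, not the one at i, is computed on monomials, because the adjoint relation then yields
  the resolvent at i on every function, with the conjugate multiplier.\<close>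

definition \<phi>' :: "complex \<Rightarrow> complex" where
  "\<phi>' = W (res (- \<i>) (V (\<lambda>_. 1)))"

lemma one_L: "(\<lambda>_. 1) \<in> L"
  by (intro \<mu>.sqint_continuous continuous_intros)

lemma \<phi>'_L: "\<phi>' \<in> L" and V_\<phi>': "V \<phi>' = res (- \<i>) (V (\<lambda>_. 1))"
  unfolding \<phi>'_def using W_L V_W res_K V_K one_L by auto

lemma \<phi>'_meas [measurable]: "\<phi>' \<in> borel_measurable \<mu>"
  using sqintD(1)[OF \<phi>'_L] .

lemma pow_L: "(\<lambda>\<zeta>. \<zeta> ^ n) \<in> L" "(\<lambda>\<zeta>. cnj \<zeta> ^ n) \<in> L"
  by (intro \<mu>.sqint_continuous continuous_intros)+

lemma pow_mult_L: "f \<in> L \<Longrightarrow> (\<lambda>\<zeta>. \<zeta> ^ n * f \<zeta>) \<in> L" "f \<in> L \<Longrightarrow> (\<lambda>\<zeta>. cnj \<zeta> ^ n * f \<zeta>) \<in> L"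
  using \<mu>.space_circle
  by (auto intro!: sqint_bounded_mult[of _ _ _ 1] \<mu>.measurable_of_continuous continuous_intros simp: norm_power)

lemma res_pow: "res (- \<i>) (V (\<lambda>\<zeta>. \<zeta> ^ n)) = V (\<lambda>\<zeta>. \<zeta> ^ n * \<phi>' \<zeta>)"
proof (induction n)
  case 0
  then show ?case using V_\<phi>' by simp
next
  case (Suc n)
  have "res (- \<i>) (V (\<lambda>\<zeta>. \<zeta> ^ Suc n)) = res (- \<i>) (pshift \<beta> (V (\<lambda>\<zeta>. \<zeta> ^ n)))"
    using V_times_circle[OF pow_L(1), of n] by simp
  also have "\<dots> = pshift \<beta> (V (\<lambda>\<zeta>. \<zeta> ^ n * \<phi>' \<zeta>))"
    using res_pshift[OF V_K[OF pow_L(1)]] Suc by simp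
  also have "\<dots> = V (\<lambda>\<zeta>. \<zeta> ^ Suc n * \<phi>' \<zeta>)"
    using V_times_circle[OF pow_mult_L(1)[OF \<phi>'_L], of n] by (simp add: mult.assoc)
  finally show ?case .
qed

lemma pshift_V_inj:
  assumes "f \<in> L" "g \<in> L" "pshift \<beta> (V f) = pshift \<beta> (V g)"
  shows "V f = V g"
proof -
  have "V (\<lambda>\<zeta>. \<zeta> * f \<zeta>) = V (\<lambda>\<zeta>. \<zeta> * g \<zeta>)" using assms V_times_circle by simp
  then have "AE \<zeta> in \<mu>. \<zeta> * f \<zeta> = \<zeta> * g \<zeta>"
    using V_cong_AE \<mu>.sqint_circle_mult assms by blast
  moreover have "AE \<zeta> in \<mu>. \<zeta> \<noteq> 0" using \<mu>.space_circle by (intro AE_I2) auto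
  ultimately have "AE \<zeta> in \<mu>. f \<zeta> = g \<zeta>" by eventually_elim simp
  then show ?thesis using V_cong_AE assms by blast
qed

text \<open>Multiplication by \<zeta> lowers the exponent of cnj \<zeta> by one and leads to the
  known case; injectivity of \<open>pshift \<beta>\<close> then cancels that multiplication.\<close>

lemma res_cnj_pow: "res (- \<i>) (V (\<lambda>\<zeta>. cnj \<zeta> ^ n)) = V (\<lambda>\<zeta>. cnj \<zeta> ^ n * \<phi>' \<zeta>)"
proof (induction n)
  case 0
  then show ?case using V_\<phi>' by simp
next
  case (Suc n)
  let ?p = "\<lambda>\<zeta>. cnj \<zeta> ^ Suc n"
  have e: "\<zeta> * cnj \<zeta> ^ Suc n = cnj \<zeta> ^ n" if "\<zeta> \<in> unit_circle" for \<zeta>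
    using circle_cnj_mult(1)[OF that] by (simp flip: mult.assoc)
  define r where "r = res (- \<i>) (V ?p)"
  have r: "r \<in> K" unfolding r_def by (rule res_K[OF V_K[OF pow_L(2)]]) simp
  have "pshift \<beta> (V (W r)) = res (- \<i>) (pshift \<beta> (V ?p))"
    unfolding V_W[OF r] unfolding r_def by (rule res_pshift[OF V_K[OF pow_L(2)], symmetric]) simp
  also have "pshift \<beta> (V ?p) = V (\<lambda>\<zeta>. cnj \<zeta> ^ n)"
    unfolding V_times_circle[OF pow_L(2), symmetric]
    by (intro V_cong_circle \<mu>.sqint_circle_mult pow_L e)
  also have "res (- \<i>) (V (\<lambda>\<zeta>. cnj \<zeta> ^ n)) = V (\<lambda>\<zeta>. cnj \<zeta> ^ n * \<phi>' \<zeta>)" by (rule Suc)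
  also have "\<dots> = V (\<lambda>\<zeta>. \<zeta> * (cnj \<zeta> ^ Suc n * \<phi>' \<zeta>))"
  proof (rule V_cong_circle)
    fix \<zeta> assume "\<zeta> \<in> unit_circle"
    from e[OF this] show "cnj \<zeta> ^ n * \<phi>' \<zeta> = \<zeta> * (cnj \<zeta> ^ Suc n * \<phi>' \<zeta>)"
      by (simp flip: mult.assoc)
  qed (intro \<mu>.sqint_circle_mult pow_mult_L \<phi>'_L)+
  also have "\<dots> = pshift \<beta> (V (\<lambda>\<zeta>. cnj \<zeta> ^ Suc n * \<phi>' \<zeta>))"
    by (rule V_times_circle[OF pow_mult_L(2)[OF \<phi>'_L]])
  finally have "V (W r) = V (\<lambda>\<zeta>. cnj \<zeta> ^ Suc n * \<phi>' \<zeta>)"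
    by (intro pshift_V_inj W_L r pow_mult_L \<phi>'_L)
  then show ?case unfolding V_W[OF r] unfolding r_def .
qed

text \<open>The resolvent becomes multiplication by \<open>cnj \<phi>'\<close>: testing against monomials moves it to the
  adjoint resolvent, which is known on them.\<close>

lemma res_multiplication:
  assumes f: "f \<in> L"
  shows "(\<lambda>\<zeta>. cnj (\<phi>' \<zeta>) * f \<zeta>) \<in> L" "res \<i> (V f) = V (\<lambda>\<zeta>. cnj (\<phi>' \<zeta>) * f \<zeta>)"
proof -
  have rK: "res \<i> (V f) \<in> K" using res_K V_K[OF f] by simp
  define \<psi> where "\<psi> = W (res \<i> (V f))"
  have \<psi>: "\<psi> \<in> L" "V \<psi> = res \<i> (V f)" unfolding \<psi>_def using W_L V_W rK by auto
  have i: "integrable \<mu> (\<lambda>\<zeta>. cnj (\<phi>' \<zeta>) * f \<zeta>)" by (intro integrable_sqint_mult sqint_cnj \<phi>'_L f)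
  have key: "(\<integral>\<zeta>. cnj (p \<zeta>) * (\<psi> \<zeta> - cnj (\<phi>' \<zeta>) * f \<zeta>) \<partial>\<mu>) = 0"
    if p: "p \<in> L" "(\<lambda>\<zeta>. p \<zeta> * \<phi>' \<zeta>) \<in> L" "res (- \<i>) (V p) = V (\<lambda>\<zeta>. p \<zeta> * \<phi>' \<zeta>)" for p
  proof -
    have "sqip \<mu> \<psi> p = h2_inner (res \<i> (V f)) (V p)" using V_inner[OF \<psi>(1) p(1)] \<psi>(2) by simp
    also have "\<dots> = h2_inner (V f) (V (\<lambda>\<zeta>. p \<zeta> * \<phi>' \<zeta>))"
      using res_adj[OF V_K[OF f] V_K[OF p(1)]] p(3) by simp
    also have "\<dots> = sqip \<mu> f (\<lambda>\<zeta>. p \<zeta> * \<phi>' \<zeta>)" by (rule V_inner[OF f p(2)])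
    finally have eq: "sqip \<mu> \<psi> p = sqip \<mu> f (\<lambda>\<zeta>. p \<zeta> * \<phi>' \<zeta>)" .
    have "(\<integral>\<zeta>. cnj (p \<zeta>) * (\<psi> \<zeta> - cnj (\<phi>' \<zeta>) * f \<zeta>) \<partial>\<mu>) =
        (\<integral>\<zeta>. \<psi> \<zeta> * cnj (p \<zeta>) - f \<zeta> * cnj (p \<zeta> * \<phi>' \<zeta>) \<partial>\<mu>)"
      by (simp add: algebra_simps)
    also have "\<dots> = sqip \<mu> \<psi> p - sqip \<mu> f (\<lambda>\<zeta>. p \<zeta> * \<phi>' \<zeta>)"
      unfolding sqip_def
      by (rule Bochner_Integration.integral_diff[OF integrable_sqip[OF \<psi>(1) p(1)] integrable_sqip[OF f p(2)]])
    finally show ?thesis using eq by simp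
  qed
  have "AE \<zeta> in \<mu>. \<psi> \<zeta> - cnj (\<phi>' \<zeta>) * f \<zeta> = 0"
  proof (rule \<mu>.moments_zero)
    show "integrable \<mu> (\<lambda>\<zeta>. \<psi> \<zeta> - cnj (\<phi>' \<zeta>) * f \<zeta>)"
      using \<mu>.integrable_sqint[OF \<psi>(1)] i by simp
    show "(\<integral>\<zeta>. \<zeta> ^ n * (\<psi> \<zeta> - cnj (\<phi>' \<zeta>) * f \<zeta>) \<partial>\<mu>) = 0" for n
      using key[OF pow_L(2) pow_mult_L(2)[OF \<phi>'_L] res_cnj_pow, of n] by simp
    show "(\<integral>\<zeta>. cnj \<zeta> ^ n * (\<psi> \<zeta> - cnj (\<phi>' \<zeta>) * f \<zeta>) \<partial>\<mu>) = 0" for n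
      using key[OF pow_L(1) pow_mult_L(1)[OF \<phi>'_L] res_pow, of n] by simp
  qed
  then have ae: "AE \<zeta> in \<mu>. \<psi> \<zeta> = cnj (\<phi>' \<zeta>) * f \<zeta>" by eventually_elim simp
  have "(\<lambda>\<zeta>. cnj (\<phi>' \<zeta>) * f \<zeta>) \<in> borel_measurable \<mu>" using i by simp
  from sqint_cong_AE[OF \<psi>(1) this ae] show m: "(\<lambda>\<zeta>. cnj (\<phi>' \<zeta>) * f \<zeta>) \<in> L" .
  show "res \<i> (V f) = V (\<lambda>\<zeta>. cnj (\<phi>' \<zeta>) * f \<zeta>)"
    using V_cong_AE[OF \<psi>(1) m] ae \<psi>(2) by simp
qed

text \<open>The first resolvent identity R - R' = 2i R R', verified by applying A - i, which is
  injective.\<close>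

lemma resolvent_identity:
  assumes x: "x \<in> K"
  shows "res \<i> x = (\<lambda>z. 2 * \<i> * res \<i> (res (- \<i>) x) z + res (- \<i>) x z)"
proof -
  let ?y = "res (- \<i>) x"
  have y: "?y \<in> dom A" "sh (- \<i>) ?y = x" using res[OF x, of "- \<i>"] by auto
  have z: "res \<i> ?y \<in> dom A" "sh \<i> (res \<i> ?y) = ?y" using res[OF dom_K[OF y(1)], of \<i>] by auto
  have "sh \<i> (\<lambda>z. 2 * \<i> * res \<i> ?y z + ?y z) = (\<lambda>z. 2 * \<i> * ?y z + sh \<i> ?y z)"
    unfolding sh_lin[OF z(1) y(1)] z(2) ..
  also have "\<dots> = sh (- \<i>) ?y" unfolding sh_def by (simp add: fun_eq_iff)
  finally have "sh \<i> (\<lambda>z. 2 * \<i> * res \<i> ?y z + ?y z) = x" unfolding y(2) .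
  then show ?thesis using res_sh[OF A_lin_dom[OF z(1) y(1), of "2 * \<i>"], of \<i>] by simp
qed

text \<open>On the constant 1 the resolvent identity reads cnj \<phi>' - \<phi>' = 2i |\<phi>'|^2;
  division by |\<phi>'|^2 gives the imaginary part. The zero set of \<phi>' is null because its
  indicator is annihilated by the injective resolvent.\<close>

lemma \<phi>'_AE: "AE \<zeta> in \<mu>. \<phi>' \<zeta> \<noteq> 0 \<and> Im (1 / cnj (\<phi>' \<zeta>)) = -1"
proof -
  note m1 = res_multiplication[OF one_L] and m2 = res_multiplication[OF \<phi>'_L]
  have "V (\<lambda>\<zeta>. cnj (\<phi>' \<zeta>) * 1) = V (\<lambda>\<zeta>. 2 * \<i> * (cnj (\<phi>' \<zeta>) * \<phi>' \<zeta>) + \<phi>' \<zeta>)"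
    unfolding V_lin[OF m2(1) \<phi>'_L] m1(2)[symmetric] m2(2)[symmetric] V_\<phi>'
    by (rule resolvent_identity[OF V_K[OF one_L]])
  then have a1: "AE \<zeta> in \<mu>. cnj (\<phi>' \<zeta>) * 1 = 2 * \<i> * (cnj (\<phi>' \<zeta>) * \<phi>' \<zeta>) + \<phi>' \<zeta>"
    using V_cong_AE[OF m1(1) L.lin_mem[OF m2(1) \<phi>'_L, of "2 * \<i>"]] by simp
  define N where "N \<zeta> = (if \<phi>' \<zeta> = 0 then 1 else 0 :: complex)" for \<zeta>
  have N: "N \<in> L"
  proof (rule sqint_bounded[of _ _ 1])
    show "N \<in> borel_measurable \<mu>" unfolding N_def[abs_def] by measurable
  qed (auto simp: N_def \<mu>.finite_measure_axioms)
  have "(\<lambda>\<zeta>. cnj (\<phi>' \<zeta>) * N \<zeta>) = (\<lambda>_. 0)" unfolding N_def by auto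
  then have "res \<i> (V N) = (\<lambda>_. 0)" using res_multiplication(2)[OF N] by (simp add: V_zero)
  then have "V N = sh \<i> (\<lambda>_. 0)" using res(2)[OF V_K[OF N], of \<i>] by simp
  also have "\<dots> = sh \<i> (\<lambda>z. - 1 * 0 + 0)" by simp
  also have "\<dots> = (\<lambda>_. 0)" unfolding sh_lin[OF A_zero A_zero] by simp
  also have "\<dots> = V (\<lambda>_. 0)" by (rule V_zero[symmetric])
  finally have a2: "AE \<zeta> in \<mu>. N \<zeta> = 0" using V_cong_AE[OF N L.zero_mem] by simp
  from a1 a2 show ?thesis
  proof eventually_elim
    fix \<zeta> assume e: "cnj (\<phi>' \<zeta>) * 1 = 2 * \<i> * (cnj (\<phi>' \<zeta>) * \<phi>' \<zeta>) + \<phi>' \<zeta>" and "N \<zeta> = 0"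
    then have nz: "\<phi>' \<zeta> \<noteq> 0" unfolding N_def by (auto split: if_splits)
    have sq: "cnj (\<phi>' \<zeta>) * \<phi>' \<zeta> = of_real ((cmod (\<phi>' \<zeta>))\<^sup>2)"
      by (simp add: complex_norm_square mult.commute del: of_real_power)
    have "Im (\<phi>' \<zeta>) = - ((cmod (\<phi>' \<zeta>))\<^sup>2)"
      using arg_cong[OF e[unfolded sq], of Im] by simp
    moreover have "1 / cnj (\<phi>' \<zeta>) = \<phi>' \<zeta> / of_real ((cmod (\<phi>' \<zeta>))\<^sup>2)"
      unfolding sq[symmetric] using nz by simp
    ultimately show "\<phi>' \<zeta> \<noteq> 0 \<and> Im (1 / cnj (\<phi>' \<zeta>)) = -1"
      using nz by (simp del: of_real_power)
  qed
qed

text \<open>Almost everywhere this is i + 1/cnj \<phi>'. The real part is taken so that the values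
  are real at every point, including the null set where that formula may fail.\<close>

definition \<Phi> :: "complex \<Rightarrow> complex" where
  "\<Phi> \<zeta> = of_real (Re (1 / cnj (\<phi>' \<zeta>)))"

lemma \<Phi>_meas [measurable]: "\<Phi> \<in> borel_measurable \<mu>"
proof -
  have [measurable]: "(\<lambda>\<zeta>. cnj (\<phi>' \<zeta>)) \<in> borel_measurable \<mu>" using sqintD(1)[OF sqint_cnj[OF \<phi>'_L]] .
  show ?thesis unfolding \<Phi>_def by measurable
qed

lemma \<Phi>_AE: "AE \<zeta> in \<mu>. \<Phi> \<zeta> * cnj (\<phi>' \<zeta>) = \<i> * cnj (\<phi>' \<zeta>) + 1"
  using \<phi>'_AE
proof eventually_elim
  fix \<zeta> assume *: "\<phi>' \<zeta> \<noteq> 0 \<and> Im (1 / cnj (\<phi>' \<zeta>)) = -1"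
  then have "\<Phi> \<zeta> = 1 / cnj (\<phi>' \<zeta>) + \<i>" unfolding \<Phi>_def by (simp add: complex_eq_iff)
  then show "\<Phi> \<zeta> * cnj (\<phi>' \<zeta>) = \<i> * cnj (\<phi>' \<zeta>) + 1" using * by (simp add: distrib_right)
qed

lemma A_eq_clark_calculus: "A = clark_calculus u \<beta> \<Phi>"
proof
  fix f
  show "A f = clark_calculus u \<beta> \<Phi> f"
  proof (cases "f \<in> dom A")
    case True
    define X where "X = W (sh \<i> f)"
    have X: "X \<in> L" "V X = sh \<i> f" unfolding X_def using W_L V_W sh_K[OF True] by auto
    note m = res_multiplication[OF X(1)]
    let ?F = "\<lambda>\<zeta>. cnj (\<phi>' \<zeta>) * X \<zeta>"
    have f: "f = V ?F" using m(2) X(2) res_sh[OF True, of \<i>] by simp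
    have iF: "(\<lambda>\<zeta>. \<i> * ?F \<zeta> + X \<zeta>) \<in> L" by (rule L.lin_mem[OF m(1) X(1)])
    have ae: "AE \<zeta> in \<mu>. \<i> * ?F \<zeta> + X \<zeta> = \<Phi> \<zeta> * ?F \<zeta>"
      using \<Phi>_AE
    proof eventually_elim
      fix \<zeta> assume "\<Phi> \<zeta> * cnj (\<phi>' \<zeta>) = \<i> * cnj (\<phi>' \<zeta>) + 1"
      then have "\<Phi> \<zeta> * cnj (\<phi>' \<zeta>) * X \<zeta> = (\<i> * cnj (\<phi>' \<zeta>) + 1) * X \<zeta>" by simp
      then show "\<i> * ?F \<zeta> + X \<zeta> = \<Phi> \<zeta> * ?F \<zeta>" by (simp add: algebra_simps)
    qed
    have "(\<lambda>\<zeta>. \<Phi> \<zeta> * ?F \<zeta>) \<in> borel_measurable \<mu>" using sqintD(1)[OF m(1)] \<Phi>_meas by simp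
    from sqint_cong_AE[OF iF this ae] have \<Phi>F: "(\<lambda>\<zeta>. \<Phi> \<zeta> * ?F \<zeta>) \<in> L" .
    have "V (\<lambda>\<zeta>. \<Phi> \<zeta> * ?F \<zeta>) = V (\<lambda>\<zeta>. \<i> * ?F \<zeta> + X \<zeta>)"
      using V_cong_AE[OF iF \<Phi>F] ae by simp
    also have "\<dots> = (\<lambda>z. \<i> * f z + sh \<i> f z)" unfolding V_lin[OF m(1) X(1)] f[symmetric] X(2) ..
    also have "\<dots> = Af f" unfolding sh_def by (simp add: fun_eq_iff)
    finally have "clark_calculus u \<beta> \<Phi> f = Some (Af f)"
      using clark_calculus_V[OF \<Phi>_meas m(1) \<Phi>F] f by simp
    then show ?thesis using True by auto
  next
    case False
    have "f \<in> dom A" if f: "f \<in> K" and \<Phi>F: "(\<lambda>\<zeta>. \<Phi> \<zeta> * W f \<zeta>) \<in> L"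
    proof -
      \<comment> \<open>X is (\<Phi> - i) W f. The multiplier of the resolvent takes it back to W f,
        which exhibits f as a value of the resolvent and so as an element of
        \<open>dom A\<close>.\<close>
      define X where "X \<zeta> = - \<i> * W f \<zeta> + \<Phi> \<zeta> * W f \<zeta>" for \<zeta>
      have X: "X \<in> L" unfolding X_def by (rule L.lin_mem[OF W_L[OF f] \<Phi>F])
      note m = res_multiplication[OF X]
      have "AE \<zeta> in \<mu>. cnj (\<phi>' \<zeta>) * X \<zeta> = W f \<zeta>"
        using \<Phi>_AE
      proof eventually_elim
        fix \<zeta> assume e: "\<Phi> \<zeta> * cnj (\<phi>' \<zeta>) = \<i> * cnj (\<phi>' \<zeta>) + 1"
        have "cnj (\<phi>' \<zeta>) * X \<zeta> = (\<Phi> \<zeta> * cnj (\<phi>' \<zeta>) - \<i> * cnj (\<phi>' \<zeta>)) * W f \<zeta>"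
          unfolding X_def by (simp add: algebra_simps)
        then show "cnj (\<phi>' \<zeta>) * X \<zeta> = W f \<zeta>" unfolding e by simp
      qed
      then have "res \<i> (V X) = f" unfolding m(2) using V_cong_AE[OF m(1) W_L[OF f]] V_W[OF f] by simp
      then show ?thesis using res(1)[OF V_K[OF X], of \<i>] by simp
    qed
    then have "clark_calculus u \<beta> \<Phi> f = None" using False unfolding clark_calculus_eq by auto
    then show ?thesis using False by (simp add: domIff)
  qed
qed

end

section \<open>Reduction of the extended parameter to its cases\<close>

context self_adjoint_operator
begin

lemma commutes_withD:
  assumes "commutes_with A (\<lambda>f. if f \<in> K then Some (B f) else None)" "f \<in> dom A"
  shows "B f \<in> dom A" "B (Af f) = Af (B f)"
  using assms dom_K Af_K unfolding commutes_with_def by auto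

lemma scalar_of_commutes:
  assumes \<alpha>: "cmod \<alpha> < 1"
    and comm: "\<And>w f. w = \<i> \<or> w = - \<i> \<Longrightarrow> f \<in> K \<Longrightarrow> res w (pshift \<alpha> f) = pshift \<alpha> (res w f)"
  shows "\<exists>a::real. A = (\<lambda>f. if f \<in> K then Some (\<lambda>z. of_real a * f z) else None)"
proof -
  have "\<exists>c. \<forall>f\<in>K. res \<i> f = (\<lambda>z. c * f z)"
    by (rule commuting_pair_scalar[OF \<alpha>, of _ "res (- \<i>)"]) (auto simp: res_K res_adj comm)
  then show ?thesis using scalar_resolvent by blast
qed

text \<open>The adjoint of \<open>res w\<close> is \<open>res (- w)\<close>, so taking adjoints
  turns commutation of both resolvents with the adjoint shift into commutation with the shift
  itself.\<close>

lemma res_pshift_of_adj: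
  assumes comm: "\<And>w f. w = \<i> \<or> w = - \<i> \<Longrightarrow> f \<in> K \<Longrightarrow> res w (pshift_adj \<alpha> f) = pshift_adj \<alpha> (res w f)"
    and \<alpha>: "cmod \<alpha> \<le> 1" and w: "w = \<i> \<or> w = - \<i>" and f: "f \<in> K"
  shows "res w (pshift \<alpha> f) = pshift \<alpha> (res w f)"
proof (rule K_eqI)
  have adj: "h2_inner (res w x) y = h2_inner x (res (- w) y)" if "x \<in> K" "y \<in> K" for x y
  proof (cases "w = \<i>")
    case True
    then show ?thesis using res_adj[OF that] by simp
  next
    case False
    then have "w = - \<i>" using w by simp
    then show ?thesis
      using res_adj[OF that(2,1)] K.ip_sym[OF that(2) res_K[OF that(1), of w]]
        K.ip_sym[OF res_K[OF that(2), of \<i>] that(1)] by simp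
  qed
  have w': "- w = \<i> \<or> - w = - \<i>" using w by auto
  note m = pshift_K[OF f \<alpha>] res_K[OF f w] res_K[OF pshift_K[OF f \<alpha>] w] pshift_K[OF res_K[OF f w] \<alpha>]
  show "res w (pshift \<alpha> f) \<in> K" "pshift \<alpha> (res w f) \<in> K" by (rule m)+
  fix h assume h: "h \<in> K"
  have "h2_inner (res w (pshift \<alpha> f)) h = h2_inner (pshift \<alpha> f) (res (- w) h)"
    by (rule adj[OF m(1) h])
  also have "\<dots> = h2_inner f (pshift_adj \<alpha> (res (- w) h))"
    by (rule pshift_adj_inner[OF res_K[OF h w'] f])
  also have "\<dots> = h2_inner f (res (- w) (pshift_adj \<alpha> h))" using comm[OF w' h] by simp
  also have "\<dots> = h2_inner (res w f) (pshift_adj \<alpha> h)" using adj[OF f pshift_adj_K[OF h]] by simp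
  also have "\<dots> = h2_inner (pshift \<alpha> (res w f)) h" by (rule pshift_adj_inner[OF h m(2), symmetric])
  finally show "h2_inner (res w (pshift \<alpha> f)) h = h2_inner (pshift \<alpha> (res w f)) h" .
qed

text \<open>Parameters outside the closed disc, infinity included, give the adjoint of
  \<open>pshift\<close> at the reflected parameter, which has modulus less than 1. Two shapes of
  operator remain.\<close>

lemma S_op_cases:
  obtains \<alpha> where "cmod \<alpha> \<le> 1" "S_op u a = (\<lambda>f. if f \<in> K then Some (pshift \<alpha> f) else None)"
  | \<alpha> where "cmod \<alpha> < 1" "S_op u a = (\<lambda>f. if f \<in> K then Some (pshift_adj \<alpha> f) else None)"
proof (cases a)
  case None
  have "(\<lambda>f. if f \<in> K then Some (compressed_shift u f) else None) = perturbed_shift u 0"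
    unfolding perturbed_shift_def by (simp add: fun_eq_iff)
  then have "S_op u a = op_adjoint K (perturbed_shift u 0)" unfolding S_op_def None by simp
  then show ?thesis using that(2)[of 0] op_adjoint_pshift[of 0] by simp
next
  case (Some \<alpha>)
  show ?thesis
  proof (cases "cmod \<alpha> \<le> 1")
    case True
    then show ?thesis using that(1)[of \<alpha>] perturbed_shift_eq[OF True] unfolding S_op_def Some by simp
  next
    case False
    then have lt: "cmod (1 / cnj \<alpha>) < 1" by (simp add: norm_divide divide_less_eq)
    then show ?thesis
      using that(2)[OF lt] op_adjoint_pshift[OF less_imp_le[OF lt]] False unfolding S_op_def Some by simp
  qed
qed

text \<open>A real scalar operator is a constant multiplier under any Clark transform; the witness
  uses \<beta> = 1.\<close>

lemma clark_calculus_of_scalar: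
  assumes "A = (\<lambda>f. if f \<in> K then Some (\<lambda>z. of_real a * f z) else None)"
  shows "\<exists>\<beta>\<in>unit_circle. \<exists>\<Phi>. \<Phi> \<in> borel_measurable borel_circle \<and> (\<forall>\<zeta>\<in>unit_circle. \<Phi> \<zeta> \<in> \<real>) \<and>
    A = clark_calculus u \<beta> \<Phi>"
proof -
  interpret clark u 1 by unfold_locales simp
  show ?thesis
    using assms clark_calculus_const[of "of_real a"]
    by (intro bexI[of _ 1] exI[of _ "\<lambda>_. of_real a"]) simp_all
qed

lemma exists_clark_calculus:
  assumes "commutes_with A (S_op u a)"
  shows "\<exists>\<beta>\<in>unit_circle. \<exists>\<Phi>. \<Phi> \<in> borel_measurable borel_circle \<and> (\<forall>\<zeta>\<in>unit_circle. \<Phi> \<zeta> \<in> \<real>) \<and>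
    A = clark_calculus u \<beta> \<Phi>"
proof (rule S_op_cases[of a])
  fix \<alpha> assume \<alpha>: "cmod \<alpha> \<le> 1" and S: "S_op u a = (\<lambda>f. if f \<in> K then Some (pshift \<alpha> f) else None)"
  note c = commutes_withD[OF assms[unfolded S]]
  show ?thesis
  proof (cases "cmod \<alpha> = 1")
    case True
    interpret clark_self_adjoint u \<alpha> A by unfold_locales (use True c in auto)
    show ?thesis
      using True A_eq_clark_calculus \<Phi>_meas measurable_\<mu>
      by (intro bexI[of _ \<alpha>] exI[of _ \<Phi>]) (auto simp: \<Phi>_def[abs_def])
  next
    case False
    have "res w (pshift \<alpha> f) = pshift \<alpha> (res w f)" if "w = \<i> \<or> w = - \<i>" "f \<in> K" for w f
      by (rule res_comm[OF pshift_lin _ that(2,1)]) (use c in auto)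
    then show ?thesis using scalar_of_commutes[of \<alpha>] False \<alpha> clark_calculus_of_scalar by auto
  qed
next
  fix \<alpha> assume \<alpha>: "cmod \<alpha> < 1" and S: "S_op u a = (\<lambda>f. if f \<in> K then Some (pshift_adj \<alpha> f) else None)"
  note c = commutes_withD[OF assms[unfolded S]]
  have "res w (pshift_adj \<alpha> f) = pshift_adj \<alpha> (res w f)" if "w = \<i> \<or> w = - \<i>" "f \<in> K" for w f
    by (rule res_comm[OF pshift_adj_lin _ that(2,1)]) (use c in auto)
  then have "res w (pshift \<alpha> f) = pshift \<alpha> (res w f)" if "w = \<i> \<or> w = - \<i>" "f \<in> K" for w f
    using res_pshift_of_adj[of \<alpha> w f] \<alpha> that by simp
  then obtain b :: real where "A = (\<lambda>f. if f \<in> K then Some (\<lambda>z. of_real b * f z) else None)"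
    using scalar_of_commutes[OF \<alpha>] by blast
  then show ?thesis by (rule clark_calculus_of_scalar)
qed

end

theorem theorem6p1:
  fixes u :: "complex \<Rightarrow> complex" and A :: operator
  assumes "inner_function u"
    and "\<not> u constant_on unit_disc"
    and "linear_operator_in (model_space u) A"
    and "closed_in (model_space u) A"
    and "densely_defined_in (model_space u) A"
    and "\<exists>\<alpha>. commutes_with A (S_op u \<alpha>)"
  shows "self_adjoint_in (model_space u) A \<longleftrightarrow>
    (\<exists>\<beta>\<in>unit_circle. \<exists>\<Phi>. \<Phi> \<in> borel_measurable borel_circle \<and> (\<forall>\<zeta>\<in>unit_circle. \<Phi> \<zeta> \<in> \<real>) \<and>
       A = clark_calculus u \<beta> \<Phi>)"
proof
  interpret nonconstant_inner u using assms(1,2) by unfold_locales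
  show "self_adjoint_in K A" if ex: "\<exists>\<beta>\<in>unit_circle. \<exists>\<Phi>. \<Phi> \<in> borel_measurable borel_circle \<and>
      (\<forall>\<zeta>\<in>unit_circle. \<Phi> \<zeta> \<in> \<real>) \<and> A = clark_calculus u \<beta> \<Phi>"
  proof -
    obtain \<beta> \<Phi> where \<beta>: "\<beta> \<in> unit_circle" and \<Phi>: "\<Phi> \<in> borel_measurable borel_circle"
      "\<And>\<zeta>. \<zeta> \<in> unit_circle \<Longrightarrow> \<Phi> \<zeta> \<in> \<real>" and A: "A = clark_calculus u \<beta> \<Phi>"
      using ex by blast
    interpret clark u \<beta> using \<beta> by unfold_locales
    show ?thesis using clark_calculus_self_adjoint[OF \<Phi>] assms(5) unfolding A by blast
  qed
  assume "self_adjoint_in K A"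
  then interpret self_adjoint_operator u A using assms by unfold_locales
  show "\<exists>\<beta>\<in>unit_circle. \<exists>\<Phi>. \<Phi> \<in> borel_measurable borel_circle \<and> (\<forall>\<zeta>\<in>unit_circle. \<Phi> \<zeta> \<in> \<real>) \<and>
       A = clark_calculus u \<beta> \<Phi>"
    using assms(6) exists_clark_calculus by blast
qed

end
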